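(* Let $K_0$ be an infinite field, $K \supseteq K_0$ a field, and let $\varsigma : \operatorname{Dir}_K(K) \to \operatorname{Dir}_{\mathcal{C}}(B)$ be a $d$-inflator on $K$, where $B$ is a semisimple object of length $d$ in a $K_0$-linear abelian category $\mathcal{C}$. Let $R$ be the set of $x \in K$ specializing to any endomorphism of $B$ (i.e. to some endomorphism of $B$), let $I$ be the set of $x \in K$ specializing to $0$, and let $\widehat{\operatorname{res}} : R \to \operatorname{End}_{\mathcal{C}}(B)$ be the map sending $x$ to $\varphi$ if $x$ specializes to $\varphi$. Then: 1. $R$ is a $K_0$-subalgebra of $K$. 2. $\widehat{\operatorname{res}} : R \to \operatorname{End}_{\mathcal{C}}(B)$ is a $K_0$-algebra homomorphism. 3. $I$ is the kernel of $\widehat{\operatorname{res}}$, so $I$ is an ideal in $R$. 4. $I$ is contained in the Jacobson radical of $R$.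
   Context: Fix an infinite field $K_0$. For an object $A$ of a $K_0$-linear abelian category $\mathcal{C}$, $\operatorname{Sub}_{\mathcal{C}}(A^n)$ is the modular lattice of subobjects of $A^n$. The directory $\operatorname{Dir}_{\mathcal{C}}(A)$ is the multi-sorted structure $(\operatorname{Sub}_{\mathcal{C}}(A^n))_{n\ge1}$ with the lattice structure on each sort, the maps $\oplus: \operatorname{Sub}(A^n)\times\operatorname{Sub}(A^m)\to\operatorname{Sub}(A^{n+m})$, and the action of $GL_n(K_0)$ on $\operatorname{Sub}(A^n)$. A directory is any structure isomorphic to one of this form. If $\mathcal{C}$ is the category of left modules over a $K_0$-algebra $S$, one writes $\operatorname{Sub}_S$, $\operatorname{Dir}_S$. A morphism of directories $f:D_\bullet\to D'_\bullet$ is a family of maps $f_n:D_n\to D'_n$, each order-preserving and $GL_n(K_0)$-equivariant, with $f_{n+m}(x\oplus y)=f_n(x)\oplus f_m(y)$ (the lattice operations need not be preserved). "Semisimple" means semisimple of finite length. A directory $\operatorname{Dir}_{\mathcal{C}}(B)$ is semisimple of length $d$ if $B$ is semisimple of length $d$. For a field $K\supseteq K_0$, a $d$-inflator on $K$ is a morphism of directories $\varsigma:\operatorname{Dir}_K(K)\to D_\bullet$, where $D_\bullet$ is semisimple of length $d$, such that $\ell(\varsigma_n(V))=d\cdot\dim_K(V)$ for all $n$ and all $V\in\operatorname{Sub}_K(K^n)$; here $\ell$ denotes length. For $\alpha\in K$ let $\Theta_\alpha=\{(x,\alpha x):x\in K\}\in\operatorname{Sub}_K(K^2)$, and for $\varphi\in\operatorname{End}_{\mathcal{C}}(B)$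 let $\Theta_\varphi\in\operatorname{Sub}_{\mathcal{C}}(B^2)$ be the graph of $\varphi$ (the image of $(\mathrm{id},\varphi):B\to B^2$). Say that $\alpha$ specializes to $\varphi$ if $\varsigma_2(\Theta_\alpha)=\Theta_\varphi$. (Each $\alpha$ specializes to at most one $\varphi$.)
   Formalization: Part 4 (I is contained in the Jacobson radical of R) is stated only for d ≥ 1: for d = 0 the object B is zero, every x in K specializes to 0, so I = R = K while the Jacobson radical of K is 0. Parts 1–3 are proved for all d. *)

theory Defs
  imports
    "Jordan_Normal_Form.VS_Connect"
    "HOL-Algebra.Embedded_Algebras"
    "HOL-Library.Extended_Nat"
begin

section \<open>Abelian categories that are linear over a commutative ring\<close>

text \<open>
  Every hom-set is a module over the base ring; the fields \<open>mult\<close> and \<open>one\<close> of the record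
  \<open>Hom C X Y\<close> carry no meaning. Hom-sets of different pairs of objects may overlap, so an arrow
  does not determine its domain and codomain, and the notions below take them as arguments.
  \<open>g \<bullet>\<^bsub>C\<^esub> f\<close> is ``first \<open>f\<close>, then \<open>g\<close>''.
\<close>

record ('k, 'o, 'm) linear_cat =
  Obj :: "'o set"
  Hom :: "'o \<Rightarrow> 'o \<Rightarrow> ('k, 'm) module"
  Comp :: "'m \<Rightarrow> 'm \<Rightarrow> 'm" (infixl "\<bullet>\<index>" 70)
  Ident :: "'o \<Rightarrow> 'm"

abbreviation arr :: "('k, 'o, 'm) linear_cat \<Rightarrow> 'o \<Rightarrow> 'o \<Rightarrow> 'm set" where
  "arr C X Y \<equiv> carrier (Hom C X Y)"

locale linear_category =
  fixes k :: "('k, 'x) ring_scheme" and C :: "('k, 'o, 'm) linear_cat"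
  assumes hom_module:
      "\<lbrakk>X \<in> Obj C; Y \<in> Obj C\<rbrakk> \<Longrightarrow> Module.module k (Hom C X Y)"
    and ident_closed:
      "X \<in> Obj C \<Longrightarrow> Ident C X \<in> arr C X X"
    and comp_closed:
      "\<lbrakk>X \<in> Obj C; Y \<in> Obj C; Z \<in> Obj C; f \<in> arr C X Y; g \<in> arr C Y Z\<rbrakk>
        \<Longrightarrow> g \<bullet>\<^bsub>C\<^esub> f \<in> arr C X Z"
    and ident_left:
      "\<lbrakk>X \<in> Obj C; Y \<in> Obj C; f \<in> arr C X Y\<rbrakk> \<Longrightarrow> Ident C Y \<bullet>\<^bsub>C\<^esub> f = f"
    and ident_right:
      "\<lbrakk>X \<in> Obj C; Y \<in> Obj C; f \<in> arr C X Y\<rbrakk> \<Longrightarrow> f \<bullet>\<^bsub>C\<^esub> Ident C X = f"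
    and comp_assoc:
      "\<lbrakk>W \<in> Obj C; X \<in> Obj C; Y \<in> Obj C; Z \<in> Obj C;
        f \<in> arr C W X; g \<in> arr C X Y; h \<in> arr C Y Z\<rbrakk>
        \<Longrightarrow> (h \<bullet>\<^bsub>C\<^esub> g) \<bullet>\<^bsub>C\<^esub> f = h \<bullet>\<^bsub>C\<^esub> (g \<bullet>\<^bsub>C\<^esub> f)"
    and comp_add_left:
      "\<lbrakk>X \<in> Obj C; Y \<in> Obj C; Z \<in> Obj C; f \<in> arr C X Y; g \<in> arr C Y Z; h \<in> arr C Y Z\<rbrakk>
        \<Longrightarrow> (g \<oplus>\<^bsub>Hom C Y Z\<^esub> h) \<bullet>\<^bsub>C\<^esub> f = (g \<bullet>\<^bsub>C\<^esub> f) \<oplus>\<^bsub>Hom C X Z\<^esub> (h \<bullet>\<^bsub>C\<^esub> f)"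
    and comp_add_right:
      "\<lbrakk>X \<in> Obj C; Y \<in> Obj C; Z \<in> Obj C; f \<in> arr C X Y; g \<in> arr C X Y; h \<in> arr C Y Z\<rbrakk>
        \<Longrightarrow> h \<bullet>\<^bsub>C\<^esub> (f \<oplus>\<^bsub>Hom C X Y\<^esub> g) = (h \<bullet>\<^bsub>C\<^esub> f) \<oplus>\<^bsub>Hom C X Z\<^esub> (h \<bullet>\<^bsub>C\<^esub> g)"
    and comp_smult_left:
      "\<lbrakk>X \<in> Obj C; Y \<in> Obj C; Z \<in> Obj C; a \<in> carrier k; f \<in> arr C X Y; g \<in> arr C Y Z\<rbrakk>
        \<Longrightarrow> (a \<odot>\<^bsub>Hom C Y Z\<^esub> g) \<bullet>\<^bsub>C\<^esub> f = a \<odot>\<^bsub>Hom C X Z\<^esub> (g \<bullet>\<^bsub>C\<^esub> f)"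
    and comp_smult_right:
      "\<lbrakk>X \<in> Obj C; Y \<in> Obj C; Z \<in> Obj C; a \<in> carrier k; f \<in> arr C X Y; g \<in> arr C Y Z\<rbrakk>
        \<Longrightarrow> g \<bullet>\<^bsub>C\<^esub> (a \<odot>\<^bsub>Hom C X Y\<^esub> f) = a \<odot>\<^bsub>Hom C X Z\<^esub> (g \<bullet>\<^bsub>C\<^esub> f)"

definition is_mono :: "('k, 'o, 'm) linear_cat \<Rightarrow> 'o \<Rightarrow> 'o \<Rightarrow> 'm \<Rightarrow> bool" where
  "is_mono C X Y f \<longleftrightarrow> f \<in> arr C X Y \<and>
    (\<forall>W\<in>Obj C. \<forall>g\<in>arr C W X. \<forall>h\<in>arr C W X. f \<bullet>\<^bsub>C\<^esub> g = f \<bullet>\<^bsub>C\<^esub> h \<longrightarrow> g = h)"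

definition is_epi :: "('k, 'o, 'm) linear_cat \<Rightarrow> 'o \<Rightarrow> 'o \<Rightarrow> 'm \<Rightarrow> bool" where
  "is_epi C X Y f \<longleftrightarrow> f \<in> arr C X Y \<and>
    (\<forall>Z\<in>Obj C. \<forall>g\<in>arr C Y Z. \<forall>h\<in>arr C Y Z. g \<bullet>\<^bsub>C\<^esub> f = h \<bullet>\<^bsub>C\<^esub> f \<longrightarrow> g = h)"

definition is_iso :: "('k, 'o, 'm) linear_cat \<Rightarrow> 'o \<Rightarrow> 'o \<Rightarrow> 'm \<Rightarrow> bool" where
  "is_iso C X Y f \<longleftrightarrow> f \<in> arr C X Y \<and>
    (\<exists>g\<in>arr C Y X. g \<bullet>\<^bsub>C\<^esub> f = Ident C X \<and> f \<bullet>\<^bsub>C\<^esub> g = Ident C Y)"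

definition is_kernel :: "('k, 'o, 'm) linear_cat \<Rightarrow> 'o \<Rightarrow> 'o \<Rightarrow> 'm \<Rightarrow> 'o \<Rightarrow> 'm \<Rightarrow> bool" where
  "is_kernel C X Y f K \<kappa> \<longleftrightarrow>
    K \<in> Obj C \<and> \<kappa> \<in> arr C K X \<and> f \<bullet>\<^bsub>C\<^esub> \<kappa> = \<zero>\<^bsub>Hom C K Y\<^esub> \<and>
    (\<forall>W\<in>Obj C. \<forall>g\<in>arr C W X. f \<bullet>\<^bsub>C\<^esub> g = \<zero>\<^bsub>Hom C W Y\<^esub> \<longrightarrow>
      (\<exists>!h. h \<in> arr C W K \<and> \<kappa> \<bullet>\<^bsub>C\<^esub> h = g))"

definition is_cokernel :: "('k, 'o, 'm) linear_cat \<Rightarrow> 'o \<Rightarrow> 'o \<Rightarrow> 'm \<Rightarrow> 'o \<Rightarrow> 'm \<Rightarrow> bool" where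
  "is_cokernel C X Y f Q q \<longleftrightarrow>
    Q \<in> Obj C \<and> q \<in> arr C Y Q \<and> q \<bullet>\<^bsub>C\<^esub> f = \<zero>\<^bsub>Hom C X Q\<^esub> \<and>
    (\<forall>Z\<in>Obj C. \<forall>g\<in>arr C Y Z. g \<bullet>\<^bsub>C\<^esub> f = \<zero>\<^bsub>Hom C X Z\<^esub> \<longrightarrow>
      (\<exists>!h. h \<in> arr C Q Z \<and> h \<bullet>\<^bsub>C\<^esub> q = g))"

text \<open>\<open>P\<close> is the direct sum of the objects \<open>A 0, \<dots>, A (n - 1)\<close>; for \<open>n = 0\<close> it is a zero object.\<close>

definition biproduct ::
  "('k, 'o, 'm) linear_cat \<Rightarrow> nat \<Rightarrow> (nat \<Rightarrow> 'o) \<Rightarrow> 'o \<Rightarrow> (nat \<Rightarrow> 'm) \<Rightarrow> (nat \<Rightarrow> 'm) \<Rightarrow> bool" where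
  "biproduct C n A P \<iota> \<pi> \<longleftrightarrow>
    P \<in> Obj C \<and>
    (\<forall>r<n. A r \<in> Obj C \<and> \<iota> r \<in> arr C (A r) P \<and> \<pi> r \<in> arr C P (A r)) \<and>
    (\<forall>r<n. \<forall>s<n. \<pi> s \<bullet>\<^bsub>C\<^esub> \<iota> r = (if r = s then Ident C (A r) else \<zero>\<^bsub>Hom C (A r) (A s)\<^esub>)) \<and>
    finsum (Hom C P P) (\<lambda>r. \<iota> r \<bullet>\<^bsub>C\<^esub> \<pi> r) {..<n} = Ident C P"

locale abelian_linear_category = linear_category +
  assumes biproduct_exists:
      "(\<And>r. r < n \<Longrightarrow> A r \<in> Obj C) \<Longrightarrow> \<exists>P \<iota> \<pi>. biproduct C n A P \<iota> \<pi>"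
    and kernel_exists:
      "\<lbrakk>X \<in> Obj C; Y \<in> Obj C; f \<in> arr C X Y\<rbrakk> \<Longrightarrow> \<exists>K \<kappa>. is_kernel C X Y f K \<kappa>"
    and cokernel_exists:
      "\<lbrakk>X \<in> Obj C; Y \<in> Obj C; f \<in> arr C X Y\<rbrakk> \<Longrightarrow> \<exists>Q q. is_cokernel C X Y f Q q"
    and mono_normal:
      "\<lbrakk>X \<in> Obj C; Y \<in> Obj C; is_mono C X Y f\<rbrakk>
        \<Longrightarrow> \<exists>Z\<in>Obj C. \<exists>g\<in>arr C Y Z. is_kernel C Y Z g X f"
    and epi_normal:
      "\<lbrakk>X \<in> Obj C; Y \<in> Obj C; is_epi C X Y f\<rbrakk>
        \<Longrightarrow> \<exists>W\<in>Obj C. \<exists>g\<in>arr C W X. is_cokernel C W X g Y f"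

definition End_alg :: "('k, 'o, 'm) linear_cat \<Rightarrow> 'o \<Rightarrow> ('k, 'm) module" where
  "End_alg C B = (Hom C B B)\<lparr>mult := Comp C, one := Ident C B\<rparr>"


section \<open>Subobjects, length, semisimplicity\<close>

text \<open>A subobject of \<open>A\<close> is an equivalence class of pairs \<open>(X, i)\<close> with \<open>i : X \<rightarrow> A\<close> monic.\<close>

definition Monos :: "('k, 'o, 'm) linear_cat \<Rightarrow> 'o \<Rightarrow> ('o \<times> 'm) set" where
  "Monos C A = {(X, i). X \<in> Obj C \<and> is_mono C X A i}"

definition factors :: "('k, 'o, 'm) linear_cat \<Rightarrow> 'o \<times> 'm \<Rightarrow> 'o \<times> 'm \<Rightarrow> bool" where
  "factors C = (\<lambda>(X, i) (Y, j). \<exists>h\<in>arr C X Y. j \<bullet>\<^bsub>C\<^esub> h = i)"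

definition mono_rel :: "('k, 'o, 'm) linear_cat \<Rightarrow> 'o \<Rightarrow> (('o \<times> 'm) \<times> ('o \<times> 'm)) set" where
  "mono_rel C A = {(x, y). x \<in> Monos C A \<and> y \<in> Monos C A \<and> factors C x y \<and> factors C y x}"

definition Sub :: "('k, 'o, 'm) linear_cat \<Rightarrow> 'o \<Rightarrow> ('o \<times> 'm) set set" where
  "Sub C A = Monos C A // mono_rel C A"

definition sub_le :: "('k, 'o, 'm) linear_cat \<Rightarrow> ('o \<times> 'm) set \<Rightarrow> ('o \<times> 'm) set \<Rightarrow> bool" where
  "sub_le C S T \<longleftrightarrow> (\<exists>x\<in>S. \<exists>y\<in>T. factors C x y)"

text \<open>The image of \<open>f : X \<rightarrow> Y\<close> is the kernel of its cokernel; all choices together form one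
  equivalence class, i.e. one subobject of \<open>Y\<close>.\<close>

definition image_sub :: "('k, 'o, 'm) linear_cat \<Rightarrow> 'o \<Rightarrow> 'o \<Rightarrow> 'm \<Rightarrow> ('o \<times> 'm) set" where
  "image_sub C X Y f =
    {(Z, j). \<exists>Q q. is_cokernel C X Y f Q q \<and> is_kernel C Y Q q Z j}"

text \<open>The supremum of \<open>l\<close> over all chains \<open>x\<^sub>0 < \<dots> < x\<^sub>l\<close> in a nonempty poset.\<close>

definition poset_length :: "'s set \<Rightarrow> ('s \<Rightarrow> 's \<Rightarrow> bool) \<Rightarrow> enat" where
  "poset_length P rel =
    (SUP X\<in>{X. X \<subseteq> P \<and> finite X \<and> X \<noteq> {} \<and> (\<forall>x\<in>X. \<forall>y\<in>X. rel x y \<or> rel y x)}. enat (card X - 1))"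

definition obj_length :: "('k, 'o, 'm) linear_cat \<Rightarrow> 'o \<Rightarrow> enat" where
  "obj_length C B = poset_length (Sub C B) (sub_le C)"

definition simple_obj :: "('k, 'o, 'm) linear_cat \<Rightarrow> 'o \<Rightarrow> bool" where
  "simple_obj C X \<longleftrightarrow> X \<in> Obj C \<and> Ident C X \<noteq> \<zero>\<^bsub>Hom C X X\<^esub> \<and>
    (\<forall>Y\<in>Obj C. \<forall>i. is_mono C Y X i \<longrightarrow> i = \<zero>\<^bsub>Hom C Y X\<^esub> \<or> is_iso C Y X i)"

definition semisimple_of_length :: "('k, 'o, 'm) linear_cat \<Rightarrow> 'o \<Rightarrow> nat \<Rightarrow> bool" where
  "semisimple_of_length C B d \<longleftrightarrow>
    (\<exists>n S \<iota> \<pi>. (\<forall>r<n. simple_obj C (S r)) \<and> biproduct C n S B \<iota> \<pi>) \<and>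
    obj_length C B = enat d"


section \<open>Directories\<close>

text \<open>Only the sorts with index at least 1 matter. The lattice structure is given by its order.\<close>

record ('a, 's) directory =
  Sort :: "nat \<Rightarrow> 's set"
  Leq :: "nat \<Rightarrow> 's \<Rightarrow> 's \<Rightarrow> bool"
  Oplus :: "nat \<Rightarrow> nat \<Rightarrow> 's \<Rightarrow> 's \<Rightarrow> 's"
  Act :: "nat \<Rightarrow> 'a mat \<Rightarrow> 's \<Rightarrow> 's"

definition GL :: "'a::field set \<Rightarrow> nat \<Rightarrow> 'a mat set" where
  "GL K0 n = {g \<in> carrier_mat n n. elements_mat g \<subseteq> K0 \<and>
    (\<exists>h\<in>carrier_mat n n. elements_mat h \<subseteq> K0 \<and> inverts_mat g h \<and> inverts_mat h g)}"

definition dir_morphism ::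
  "'a::field set \<Rightarrow> ('a, 's) directory \<Rightarrow> ('a, 't) directory \<Rightarrow> (nat \<Rightarrow> 's \<Rightarrow> 't) \<Rightarrow> bool" where
  "dir_morphism K0 D D' f \<longleftrightarrow>
    (\<forall>n\<ge>1. \<forall>x\<in>Sort D n. f n x \<in> Sort D' n) \<and>
    (\<forall>n\<ge>1. \<forall>x\<in>Sort D n. \<forall>y\<in>Sort D n. Leq D n x y \<longrightarrow> Leq D' n (f n x) (f n y)) \<and>
    (\<forall>n\<ge>1. \<forall>g\<in>GL K0 n. \<forall>x\<in>Sort D n. f n (Act D n g x) = Act D' n g (f n x)) \<and>
    (\<forall>n\<ge>1. \<forall>m\<ge>1. \<forall>x\<in>Sort D n. \<forall>y\<in>Sort D m.
      f (n + m) (Oplus D n m x y) = Oplus D' n m (f n x) (f m y))"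

definition dir_length :: "('a, 's) directory \<Rightarrow> nat \<Rightarrow> 's \<Rightarrow> enat" where
  "dir_length D n x = poset_length {y \<in> Sort D n. Leq D n y x} (Leq D n)"

subsection \<open>The directory of a field as a vector space over itself\<close>

definition Dir_field :: "('a::field, 'a vec set) directory" where
  "Dir_field = \<lparr>
    Sort = (\<lambda>n. {V. VectorSpace.subspace class_ring V (module_vec TYPE('a) n)}),
    Leq = (\<lambda>n V W. V \<subseteq> W),
    Oplus = (\<lambda>n m V W. {v @\<^sub>v w | v w. v \<in> V \<and> w \<in> W}),
    Act = (\<lambda>n g V. (\<lambda>v. g *\<^sub>v v) ` V)\<rparr>"

definition subspace_dim :: "nat \<Rightarrow> 'a::field vec set \<Rightarrow> nat" where
  "subspace_dim n V =
    vectorspace.dim class_ring ((module_vec TYPE('a) n)\<lparr>carrier := V\<rparr>)"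

subsection \<open>The directory of an object\<close>

text \<open>In an abelian category the power exists by \<open>biproduct_exists\<close>; different choices yield
  isomorphic directories.\<close>

definition pow_data ::
  "('k, 'o, 'm) linear_cat \<Rightarrow> 'o \<Rightarrow> nat \<Rightarrow> 'o \<times> (nat \<Rightarrow> 'm) \<times> (nat \<Rightarrow> 'm)" where
  "pow_data C B n = (SOME (P, \<iota>, \<pi>). biproduct C n (\<lambda>_. B) P \<iota> \<pi>)"

definition pow_obj :: "('k, 'o, 'm) linear_cat \<Rightarrow> 'o \<Rightarrow> nat \<Rightarrow> 'o" where
  "pow_obj C B n = fst (pow_data C B n)"

definition pow_inj :: "('k, 'o, 'm) linear_cat \<Rightarrow> 'o \<Rightarrow> nat \<Rightarrow> nat \<Rightarrow> 'm" where
  "pow_inj C B n = fst (snd (pow_data C B n))"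

definition pow_prj :: "('k, 'o, 'm) linear_cat \<Rightarrow> 'o \<Rightarrow> nat \<Rightarrow> nat \<Rightarrow> 'm" where
  "pow_prj C B n = snd (snd (pow_data C B n))"

text \<open>Matrices act on column vectors, as in \<open>Dir_field\<close>.\<close>

definition mat_arrow :: "('a, 'o, 'm) linear_cat \<Rightarrow> 'o \<Rightarrow> nat \<Rightarrow> 'a mat \<Rightarrow> 'm" where
  "mat_arrow C B n g =
    finsum (Hom C (pow_obj C B n) (pow_obj C B n))
      (\<lambda>(r, s). g $$ (r, s) \<odot>\<^bsub>Hom C (pow_obj C B n) (pow_obj C B n)\<^esub>
        (pow_inj C B n r \<bullet>\<^bsub>C\<^esub> pow_prj C B n s))
      ({..<n} \<times> {..<n})"

text \<open>\<open>B\<^sup>n\<close> is embedded in \<open>B\<^sup>N\<close> as the block of coordinates \<open>c, \<dots>, c + n - 1\<close>.\<close>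

definition block_arrow :: "('k, 'o, 'm) linear_cat \<Rightarrow> 'o \<Rightarrow> nat \<Rightarrow> nat \<Rightarrow> nat \<Rightarrow> 'm" where
  "block_arrow C B n N c =
    finsum (Hom C (pow_obj C B n) (pow_obj C B N))
      (\<lambda>r. pow_inj C B N (c + r) \<bullet>\<^bsub>C\<^esub> pow_prj C B n r) {..<n}"

text \<open>\<open>S \<oplus> T\<close> is represented by \<open>i \<oplus> j : X \<oplus> Y \<rightarrow> B\<^sup>n \<oplus> B\<^sup>m = B\<^sup>n\<^sup>+\<^sup>m\<close>, where
  \<open>(X, i) \<in> S\<close> and \<open>(Y, j) \<in> T\<close>. Letting \<open>Z\<close> range over all direct sums of \<open>X\<close> and \<open>Y\<close>
  (with all choices of structure maps) yields the full equivalence class. Likewise, since the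
  action is by automorphisms of \<open>B\<^sup>n\<close>, composing all representatives with one of them yields a
  full equivalence class.\<close>

definition sub_oplus ::
  "('k, 'o, 'm) linear_cat \<Rightarrow> 'o \<Rightarrow> nat \<Rightarrow> nat \<Rightarrow> ('o \<times> 'm) set \<Rightarrow> ('o \<times> 'm) set \<Rightarrow> ('o \<times> 'm) set"
  where
  "sub_oplus C B n m S T =
    {(Z, z). \<exists>X i Y j \<iota> \<pi>. (X, i) \<in> S \<and> (Y, j) \<in> T \<and>
      biproduct C 2 (\<lambda>r. if r = 0 then X else Y) Z \<iota> \<pi> \<and>
      z = (block_arrow C B n (n + m) 0 \<bullet>\<^bsub>C\<^esub> i \<bullet>\<^bsub>C\<^esub> \<pi> 0)
            \<oplus>\<^bsub>Hom C Z (pow_obj C B (n + m))\<^esub>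
          (block_arrow C B m (n + m) n \<bullet>\<^bsub>C\<^esub> j \<bullet>\<^bsub>C\<^esub> \<pi> 1)}"

definition Dir :: "('a, 'o, 'm) linear_cat \<Rightarrow> 'o \<Rightarrow> ('a, ('o \<times> 'm) set) directory" where
  "Dir C B = \<lparr>
    Sort = (\<lambda>n. Sub C (pow_obj C B n)),
    Leq = (\<lambda>n. sub_le C),
    Oplus = sub_oplus C B,
    Act = (\<lambda>n g S. (\<lambda>(X, i). (X, mat_arrow C B n g \<bullet>\<^bsub>C\<^esub> i)) ` S)\<rparr>"


section \<open>Inflators and specialization\<close>

definition inflator ::
  "'a::field set \<Rightarrow> ('a, 'o, 'm) linear_cat \<Rightarrow> 'o \<Rightarrow> nat \<Rightarrow> (nat \<Rightarrow> 'a vec set \<Rightarrow> ('o \<times> 'm) set) \<Rightarrow> bool"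
  where
  "inflator K0 C B d \<sigma> \<longleftrightarrow>
    semisimple_of_length C B d \<and>
    dir_morphism K0 Dir_field (Dir C B) \<sigma> \<and>
    (\<forall>n\<ge>1. \<forall>V\<in>Sort Dir_field n. dir_length (Dir C B) n (\<sigma> n V) = enat (d * subspace_dim n V))"

definition line_graph :: "'a::field \<Rightarrow> 'a vec set" where
  "line_graph \<alpha> = {vec_of_list [x, \<alpha> * x] | x. True}"

definition arrow_graph :: "('k, 'o, 'm) linear_cat \<Rightarrow> 'o \<Rightarrow> 'm \<Rightarrow> ('o \<times> 'm) set" where
  "arrow_graph C B \<phi> = image_sub C B (pow_obj C B 2)
    ((pow_inj C B 2 0 \<bullet>\<^bsub>C\<^esub> Ident C B) \<oplus>\<^bsub>Hom C B (pow_obj C B 2)\<^esub> (pow_inj C B 2 1 \<bullet>\<^bsub>C\<^esub> \<phi>))"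

definition specializes ::
  "('a::field, 'o, 'm) linear_cat \<Rightarrow> 'o \<Rightarrow> (nat \<Rightarrow> 'a vec set \<Rightarrow> ('o \<times> 'm) set) \<Rightarrow> 'a \<Rightarrow> 'm \<Rightarrow> bool"
  where
  "specializes C B \<sigma> \<alpha> \<phi> \<longleftrightarrow> \<phi> \<in> arr C B B \<and> \<sigma> 2 (line_graph \<alpha>) = arrow_graph C B \<phi>"

definition spec_ring ::
  "('a::field, 'o, 'm) linear_cat \<Rightarrow> 'o \<Rightarrow> (nat \<Rightarrow> 'a vec set \<Rightarrow> ('o \<times> 'm) set) \<Rightarrow> 'a set" where
  "spec_ring C B \<sigma> = {x. \<exists>\<phi>. specializes C B \<sigma> x \<phi>}"

definition spec_ideal ::
  "('a::field, 'o, 'm) linear_cat \<Rightarrow> 'o \<Rightarrow> (nat \<Rightarrow> 'a vec set \<Rightarrow> ('o \<times> 'm) set) \<Rightarrow> 'a set" where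
  "spec_ideal C B \<sigma> = {x. specializes C B \<sigma> x \<zero>\<^bsub>Hom C B B\<^esub>}"

definition res_hat ::
  "('a::field, 'o, 'm) linear_cat \<Rightarrow> 'o \<Rightarrow> (nat \<Rightarrow> 'a vec set \<Rightarrow> ('o \<times> 'm) set) \<Rightarrow> 'a \<Rightarrow> 'm" where
  "res_hat C B \<sigma> x = (THE \<phi>. specializes C B \<sigma> x \<phi>)"

text \<open>For commutative rings, where one-sided and two-sided maximal ideals agree.\<close>

definition jacobson_radical :: "('a, 'b) ring_scheme \<Rightarrow> 'a set" where
  "jacobson_radical R = carrier R \<inter> \<Inter>{M. maximalideal M R}"

end

theory Submission
  imports Defs "Jordan_Normal_Form.Gauss_Jordan_Elimination"
begin

text \<open>
  If \<open>\<alpha>\<close> specializes to \<open>\<phi>\<close> and \<open>\<beta>\<close> to \<open>\<psi>\<close>, consider the line \<open>K \<cdot> (1, \<beta>, \<alpha>)\<close> in \<open>K\<^sup>3\<close>. It lies in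
  \<open>\<Theta>\<^sub>\<beta> \<oplus> K\<close> and, after exchanging coordinates, in \<open>\<Theta>\<^sub>\<alpha> \<oplus> K\<close>, so its image under \<open>\<sigma>\<close> lies in the
  graph of \<open>(\<psi>, \<phi>) : B \<rightarrow> B\<^sup>2\<close>. Both have length \<open>d\<close>, hence they are equal. Applying a shear in
  \<open>GL\<^sub>3(K\<^sub>0)\<close> and projecting to the first two coordinates shows that the graph of \<open>\<phi> + \<psi>\<close> lies in
  the image of the line \<open>K \<cdot> (1, \<alpha> + \<beta>)\<close>, and again lengths agree. Products are treated in the
  same way with the line \<open>K \<cdot> (1, \<beta>, \<alpha> \<beta>)\<close>. The shear \<open>(x, y) \<mapsto> (x, y + a x)\<close> carries the specialization of \<open>0\<close> to that
  of \<open>a \<in> K\<^sub>0\<close>. Exchanging the coordinates of \<open>\<Theta>\<^sub>\<alpha>\<close> shows that \<open>\<alpha>\<^sup>-\<^sup>1\<close> specializes to the identity if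
  \<open>\<alpha>\<close> does; thus \<open>1 + I\<close> consists of units of \<open>R\<close>, which puts \<open>I\<close> into the Jacobson radical.
\<close>

subsection \<open>Arrows\<close>

text \<open>\<open>\<sigma>\<close> need not preserve meets or joins, so the image of a line is
  never computed as an intersection. Monotonicity and compatibility with direct sums yield only
  upper bounds: a line contained in V \<oplus> V' constrains the coordinates of every arrow into its
  image. Equality of lengths turns such a bound into an equality, hence into a membership that
  matrices and projections can transport. The last comparison runs the other way: a copy of
  \<open>B\<close> found inside the image of a line fills it. Arrows into the powers of
  \<open>B\<close>, read through their coordinates, replace the intersections and direct images that
  would otherwise have to be formed in \<open>C\<close>; projecting a subobject means forgetting
  coordinates. That 0 specializes to 0 has its own reason: the line of (1, 0) lies in the direct sum
  of the field and the zero space, and the image of the zero space has length 0. The radical needs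
  \<open>0 < d\<close>. For \<open>d = 0\<close> every element specializes to 0, so the ideal is the
  whole field, whose radical is zero.\<close>

context linear_category
begin

lemma hom_abelian_group: "\<lbrakk>X \<in> Obj C; Y \<in> Obj C\<rbrakk> \<Longrightarrow> abelian_group (Hom C X Y)"
  using hom_module by (blast dest: module.axioms(2))

lemma zero_arr: "\<lbrakk>X \<in> Obj C; Y \<in> Obj C\<rbrakk> \<Longrightarrow> \<zero>\<^bsub>Hom C X Y\<^esub> \<in> arr C X Y"
  by (rule abelian_monoid.zero_closed[OF abelian_group.axioms(1)[OF hom_abelian_group]])

lemma add_arr:
  "\<lbrakk>X \<in> Obj C; Y \<in> Obj C; f \<in> arr C X Y; g \<in> arr C X Y\<rbrakk> \<Longrightarrow> f \<oplus>\<^bsub>Hom C X Y\<^esub> g \<in> arr C X Y"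
  by (rule abelian_monoid.a_closed[OF abelian_group.axioms(1)[OF hom_abelian_group]])

lemma smult_arr:
  "\<lbrakk>X \<in> Obj C; Y \<in> Obj C; a \<in> carrier k; f \<in> arr C X Y\<rbrakk> \<Longrightarrow> a \<odot>\<^bsub>Hom C X Y\<^esub> f \<in> arr C X Y"
  by (rule module.smult_closed[OF hom_module])

lemma comp_zero_right:
  assumes "X \<in> Obj C" "Y \<in> Obj C" "Z \<in> Obj C" "h \<in> arr C Y Z"
  shows "h \<bullet>\<^bsub>C\<^esub> \<zero>\<^bsub>Hom C X Y\<^esub> = \<zero>\<^bsub>Hom C X Z\<^esub>"
proof -
  interpret XY: abelian_group "Hom C X Y" using assms hom_abelian_group by blast
  interpret XZ: abelian_group "Hom C X Z" using assms hom_abelian_group by blast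
  let ?z = "h \<bullet>\<^bsub>C\<^esub> \<zero>\<^bsub>Hom C X Y\<^esub>"
  have z: "?z \<in> arr C X Z" using assms by (intro comp_closed[of X Y]) auto
  have "?z \<oplus>\<^bsub>Hom C X Z\<^esub> ?z = ?z"
    using comp_add_right[OF assms(1-3) XY.zero_closed XY.zero_closed assms(4)] by simp
  then show ?thesis using z XZ.add.r_cancel_one' by metis
qed

lemma comp_zero_left:
  assumes "X \<in> Obj C" "Y \<in> Obj C" "Z \<in> Obj C" "f \<in> arr C X Y"
  shows "\<zero>\<^bsub>Hom C Y Z\<^esub> \<bullet>\<^bsub>C\<^esub> f = \<zero>\<^bsub>Hom C X Z\<^esub>"
proof -
  interpret YZ: abelian_group "Hom C Y Z" using assms hom_abelian_group by blast
  interpret XZ: abelian_group "Hom C X Z" using assms hom_abelian_group by blast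
  let ?z = "\<zero>\<^bsub>Hom C Y Z\<^esub> \<bullet>\<^bsub>C\<^esub> f"
  have z: "?z \<in> arr C X Z" using assms by (intro comp_closed[of X Y]) auto
  have "?z \<oplus>\<^bsub>Hom C X Z\<^esub> ?z = ?z"
    using comp_add_left[OF assms(1-4) YZ.zero_closed YZ.zero_closed] by simp
  then show ?thesis using z XZ.add.r_cancel_one' by metis
qed

lemma comp_finsum_right:
  assumes XYZ: "X \<in> Obj C" "Y \<in> Obj C" "Z \<in> Obj C" and h: "h \<in> arr C Y Z"
    and f: "f \<in> I \<rightarrow> arr C X Y" and I: "finite I"
  shows "h \<bullet>\<^bsub>C\<^esub> finsum (Hom C X Y) f I = finsum (Hom C X Z) (\<lambda>i. h \<bullet>\<^bsub>C\<^esub> f i) I"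
proof -
  interpret XY: abelian_group "Hom C X Y" using XYZ hom_abelian_group by blast
  interpret XZ: abelian_group "Hom C X Z" using XYZ hom_abelian_group by blast
  show ?thesis
    using I f
  proof (induction I rule: finite_induct)
    case empty
    then show ?case using comp_zero_right[OF XYZ h] by simp
  next
    case (insert i I)
    have c: "h \<bullet>\<^bsub>C\<^esub> f j \<in> arr C X Z" if "j \<in> insert i I" for j
      using insert.prems that XYZ h by (intro comp_closed[of X Y]) auto
    have fs: "finsum (Hom C X Y) f I \<in> arr C X Y"
      using insert.prems by (intro XY.finsum_closed) auto
    have "h \<bullet>\<^bsub>C\<^esub> finsum (Hom C X Y) f (insert i I)
        = h \<bullet>\<^bsub>C\<^esub> (f i \<oplus>\<^bsub>Hom C X Y\<^esub> finsum (Hom C X Y) f I)"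
      using insert by (subst XY.finsum_insert) auto
    also have "\<dots> = h \<bullet>\<^bsub>C\<^esub> f i \<oplus>\<^bsub>Hom C X Z\<^esub> finsum (Hom C X Z) (\<lambda>i. h \<bullet>\<^bsub>C\<^esub> f i) I"
      using insert fs by (subst comp_add_right[OF XYZ _ _ h]) auto
    also have "\<dots> = finsum (Hom C X Z) (\<lambda>i. h \<bullet>\<^bsub>C\<^esub> f i) (insert i I)"
      using insert.hyps c by (subst XZ.finsum_insert) auto
    finally show ?case .
  qed
qed

lemma comp_finsum_left:
  assumes XYZ: "X \<in> Obj C" "Y \<in> Obj C" "Z \<in> Obj C" and h: "h \<in> arr C X Y"
    and f: "f \<in> I \<rightarrow> arr C Y Z" and I: "finite I"
  shows "finsum (Hom C Y Z) f I \<bullet>\<^bsub>C\<^esub> h = finsum (Hom C X Z) (\<lambda>i. f i \<bullet>\<^bsub>C\<^esub> h) I"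
proof -
  interpret YZ: abelian_group "Hom C Y Z" using XYZ hom_abelian_group by blast
  interpret XZ: abelian_group "Hom C X Z" using XYZ hom_abelian_group by blast
  show ?thesis
    using I f
  proof (induction I rule: finite_induct)
    case empty
    then show ?case using comp_zero_left[OF XYZ h] by simp
  next
    case (insert i I)
    have c: "f j \<bullet>\<^bsub>C\<^esub> h \<in> arr C X Z" if "j \<in> insert i I" for j
      using insert.prems that XYZ h by (intro comp_closed[of X Y]) auto
    have fs: "finsum (Hom C Y Z) f I \<in> arr C Y Z"
      using insert.prems by (intro YZ.finsum_closed) auto
    have "finsum (Hom C Y Z) f (insert i I) \<bullet>\<^bsub>C\<^esub> h
        = (f i \<oplus>\<^bsub>Hom C Y Z\<^esub> finsum (Hom C Y Z) f I) \<bullet>\<^bsub>C\<^esub> h"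
      using insert by (subst YZ.finsum_insert) auto
    also have "\<dots> = f i \<bullet>\<^bsub>C\<^esub> h \<oplus>\<^bsub>Hom C X Z\<^esub> finsum (Hom C X Z) (\<lambda>i. f i \<bullet>\<^bsub>C\<^esub> h) I"
      using insert fs by (subst comp_add_left[OF XYZ h]) auto
    also have "\<dots> = finsum (Hom C X Z) (\<lambda>i. f i \<bullet>\<^bsub>C\<^esub> h) (insert i I)"
      using insert.hyps c by (subst XZ.finsum_insert) auto
    finally show ?case .
  qed
qed

lemma is_mono_arr: "is_mono C X Y f \<Longrightarrow> f \<in> arr C X Y"
  by (simp add: is_mono_def)

lemma is_mono_cancel:
  "\<lbrakk>is_mono C X Y f; W \<in> Obj C; g \<in> arr C W X; h \<in> arr C W X; f \<bullet>\<^bsub>C\<^esub> g = f \<bullet>\<^bsub>C\<^esub> h\<rbrakk> \<Longrightarrow> g = h"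
  by (simp add: is_mono_def)

lemma is_mono_comp:
  assumes "X \<in> Obj C" "Y \<in> Obj C" "Z \<in> Obj C" "is_mono C X Y f" "is_mono C Y Z g"
  shows "is_mono C X Z (g \<bullet>\<^bsub>C\<^esub> f)"
proof -
  have f: "f \<in> arr C X Y" and g: "g \<in> arr C Y Z" using assms is_mono_arr by auto
  have "a = b" if W: "W \<in> Obj C" and a: "a \<in> arr C W X" and b: "b \<in> arr C W X"
    and e: "(g \<bullet>\<^bsub>C\<^esub> f) \<bullet>\<^bsub>C\<^esub> a = (g \<bullet>\<^bsub>C\<^esub> f) \<bullet>\<^bsub>C\<^esub> b" for W a b
  proof -
    have "g \<bullet>\<^bsub>C\<^esub> (f \<bullet>\<^bsub>C\<^esub> a) = g \<bullet>\<^bsub>C\<^esub> (f \<bullet>\<^bsub>C\<^esub> b)"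
      using e comp_assoc[OF W assms(1-3) a f g] comp_assoc[OF W assms(1-3) b f g] by simp
    then have "f \<bullet>\<^bsub>C\<^esub> a = f \<bullet>\<^bsub>C\<^esub> b"
      using is_mono_cancel[OF assms(5) W] comp_closed[OF W assms(1,2) _ f] a b by blast
    then show ?thesis using is_mono_cancel[OF assms(4) W a b] by blast
  qed
  then show ?thesis unfolding is_mono_def using comp_closed[OF assms(1-3) f g] by blast
qed

lemma is_mono_of_comp:
  assumes "X \<in> Obj C" "Y \<in> Obj C" "Z \<in> Obj C" "f \<in> arr C X Y" "g \<in> arr C Y Z"
    and m: "is_mono C X Z (g \<bullet>\<^bsub>C\<^esub> f)"
  shows "is_mono C X Y f"
  unfolding is_mono_def
proof (intro conjI ballI impI)
  fix W a b
  assume W: "W \<in> Obj C" and a: "a \<in> arr C W X" and b: "b \<in> arr C W X"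
    and e: "f \<bullet>\<^bsub>C\<^esub> a = f \<bullet>\<^bsub>C\<^esub> b"
  have "(g \<bullet>\<^bsub>C\<^esub> f) \<bullet>\<^bsub>C\<^esub> a = (g \<bullet>\<^bsub>C\<^esub> f) \<bullet>\<^bsub>C\<^esub> b"
    using comp_assoc[OF W assms(1-3) a assms(4,5)] comp_assoc[OF W assms(1-3) b assms(4,5)] e
    by simp
  then show "a = b" using is_mono_cancel[OF m W a b] by blast
qed (use assms in auto)

lemma ident_is_mono: "X \<in> Obj C \<Longrightarrow> is_mono C X X (Ident C X)"
  unfolding is_mono_def using ident_closed ident_left by metis

lemma kernel_is_mono:
  assumes "X \<in> Obj C" "Y \<in> Obj C" "f \<in> arr C X Y" "is_kernel C X Y f K \<kappa>"
  shows "is_mono C K X \<kappa>"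
  unfolding is_mono_def
proof (intro conjI ballI impI)
  show "\<kappa> \<in> arr C K X" using assms(4) by (simp add: is_kernel_def)
  fix W a b
  assume W: "W \<in> Obj C" and a: "a \<in> arr C W K" and b: "b \<in> arr C W K"
    and e: "\<kappa> \<bullet>\<^bsub>C\<^esub> a = \<kappa> \<bullet>\<^bsub>C\<^esub> b"
  have K: "K \<in> Obj C" "\<kappa> \<in> arr C K X" "f \<bullet>\<^bsub>C\<^esub> \<kappa> = \<zero>\<^bsub>Hom C K Y\<^esub>"
    using assms(4) by (auto simp: is_kernel_def)
  have "f \<bullet>\<^bsub>C\<^esub> (\<kappa> \<bullet>\<^bsub>C\<^esub> a) = \<zero>\<^bsub>Hom C W Y\<^esub>"
    using comp_assoc[OF W K(1) assms(1,2) a K(2) assms(3)] K(3) comp_zero_left[OF W K(1) assms(2) a]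
    by simp
  moreover have "\<kappa> \<bullet>\<^bsub>C\<^esub> a \<in> arr C W X" using comp_closed[OF W K(1) assms(1) a K(2)] .
  ultimately have "\<exists>!h. h \<in> arr C W K \<and> \<kappa> \<bullet>\<^bsub>C\<^esub> h = \<kappa> \<bullet>\<^bsub>C\<^esub> a"
    using assms(4) W unfolding is_kernel_def by blast
  then show "a = b" using a b e by metis
qed

subsection \<open>Subobjects through their generalized elements\<close>

text \<open>Subobjects are compared through their generalized elements: arrows into the ambient object
  that factor through one (equivalently every) representative.\<close>

definition gen_elem :: "'o \<Rightarrow> 'm \<Rightarrow> ('o \<times> 'm) set \<Rightarrow> bool" where
  "gen_elem W u S \<longleftrightarrow> (\<exists>X i h. (X, i) \<in> S \<and> h \<in> arr C W X \<and> i \<bullet>\<^bsub>C\<^esub> h = u)"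

lemma MonosI: "\<lbrakk>X \<in> Obj C; is_mono C X A i\<rbrakk> \<Longrightarrow> (X, i) \<in> Monos C A"
  by (simp add: Monos_def)

lemma MonosD: "(X, i) \<in> Monos C A \<Longrightarrow> X \<in> Obj C \<and> is_mono C X A i \<and> i \<in> arr C X A"
  by (simp add: Monos_def is_mono_def)

lemma factors_refl:
  assumes "A \<in> Obj C" "x \<in> Monos C A"
  shows "factors C x x"
proof -
  obtain X i where x: "x = (X, i)" by (cases x)
  then have "X \<in> Obj C" "i \<in> arr C X A" using assms MonosD by auto
  then show ?thesis using x ident_right[of X A i] ident_closed[of X] assms
    by (auto simp: factors_def)
qed

lemma factors_trans:
  assumes A: "A \<in> Obj C" and "x \<in> Monos C A" "y \<in> Monos C A" "z \<in> Monos C A"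
    and "factors C x y" "factors C y z"
  shows "factors C x z"
proof -
  obtain X i Y j Z l where xyz: "x = (X, i)" "y = (Y, j)" "z = (Z, l)"
    by (cases x, cases y, cases z) auto
  obtain h h' where h: "h \<in> arr C X Y" "j \<bullet>\<^bsub>C\<^esub> h = i" and h': "h' \<in> arr C Y Z" "l \<bullet>\<^bsub>C\<^esub> h' = j"
    using assms xyz by (auto simp: factors_def)
  have o: "X \<in> Obj C" "Y \<in> Obj C" "Z \<in> Obj C" "l \<in> arr C Z A"
    using assms xyz MonosD by auto
  have "l \<bullet>\<^bsub>C\<^esub> (h' \<bullet>\<^bsub>C\<^esub> h) = i"
    using comp_assoc[OF o(1-3) A h(1) h'(1) o(4)] h h' by simp
  then show ?thesis
    using comp_closed[OF o(1-3) h(1) h'(1)] xyz by (auto simp: factors_def)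
qed

lemma equiv_mono_rel:
  assumes A: "A \<in> Obj C"
  shows "equiv (Monos C A) (mono_rel C A)"
proof (rule equivI)
  show "refl_on (Monos C A) (mono_rel C A)"
    using factors_refl[OF A] by (auto simp: refl_on_def mono_rel_def)
  show "trans (mono_rel C A)"
  proof (rule transI)
    fix x y z assume "(x, y) \<in> mono_rel C A" "(y, z) \<in> mono_rel C A"
    then show "(x, z) \<in> mono_rel C A"
      using factors_trans[OF A, of x y z] factors_trans[OF A, of z y x]
      by (simp add: mono_rel_def)
  qed
qed (auto simp: mono_rel_def sym_def)

lemma SubE:
  assumes "S \<in> Sub C A"
  obtains X i where "X \<in> Obj C" "is_mono C X A i" "S = mono_rel C A `` {(X, i)}"
  using assms unfolding Sub_def by (auto elim!: quotientE dest: MonosD)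

lemma Sub_class: "\<lbrakk>X \<in> Obj C; is_mono C X A i\<rbrakk> \<Longrightarrow> mono_rel C A `` {(X, i)} \<in> Sub C A"
  unfolding Sub_def by (intro quotientI MonosI)

lemma self_in_class:
  "\<lbrakk>A \<in> Obj C; X \<in> Obj C; is_mono C X A i\<rbrakk> \<Longrightarrow> (X, i) \<in> mono_rel C A `` {(X, i)}"
  using equiv_class_self[OF equiv_mono_rel] MonosI by blast

lemma Sub_member_exists:
  assumes "A \<in> Obj C" "S \<in> Sub C A"
  shows "\<exists>X i. (X, i) \<in> S"
  using assms(2) self_in_class[OF assms(1)] by (elim SubE) blast

lemma Sub_member:
  assumes A: "A \<in> Obj C" and S: "S \<in> Sub C A" and x: "(X, i) \<in> S"
  shows "X \<in> Obj C" "is_mono C X A i" "i \<in> arr C X A" "S = mono_rel C A `` {(X, i)}"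
proof -
  show c: "S = mono_rel C A `` {(X, i)}"
    using S x equiv_class_eq[OF equiv_mono_rel[OF A]] unfolding Sub_def
    by (elim quotientE) blast
  have "(X, i) \<in> Monos C A"
    using x c by (auto simp: mono_rel_def)
  then show "X \<in> Obj C" "is_mono C X A i" "i \<in> arr C X A"
    using MonosD by auto
qed

lemma gen_elem_arr:
  assumes "A \<in> Obj C" "S \<in> Sub C A" "W \<in> Obj C" "gen_elem W u S"
  shows "u \<in> arr C W A"
proof -
  obtain X i h where "(X, i) \<in> S" "h \<in> arr C W X" "i \<bullet>\<^bsub>C\<^esub> h = u"
    using assms(4) unfolding gen_elem_def by blast
  then show ?thesis
    using comp_closed[of W X A h i] Sub_member(1,3)[OF assms(1,2), of X i] assms(1,3) by simp
qed

lemma gen_elem_member: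
  assumes "A \<in> Obj C" "S \<in> Sub C A" "(X, i) \<in> S"
  shows "gen_elem X i S"
  using ident_closed[of X] ident_right[of X A i] Sub_member(1,3)[OF assms] assms(1,3)
  unfolding gen_elem_def by blast

text \<open>Any two representatives of \<open>S\<close> factor through each other, so a lift through
  one can be rerouted through the given one.\<close>

lemma gen_elem_iff:
  assumes A: "A \<in> Obj C" and S: "S \<in> Sub C A" and x: "(X, i) \<in> S" and W: "W \<in> Obj C"
  shows "gen_elem W u S \<longleftrightarrow> (\<exists>h\<in>arr C W X. i \<bullet>\<^bsub>C\<^esub> h = u)"
proof
  assume "gen_elem W u S"
  then obtain Y j h where y: "(Y, j) \<in> S" and h: "h \<in> arr C W Y" "j \<bullet>\<^bsub>C\<^esub> h = u"
    unfolding gen_elem_def by blast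
  note X = Sub_member[OF A S x] and Y = Sub_member[OF A S y]
  have "factors C (Y, j) (X, i)" using X(4) y by (auto simp: mono_rel_def)
  then obtain g where g: "g \<in> arr C Y X" "i \<bullet>\<^bsub>C\<^esub> g = j" by (auto simp: factors_def)
  have "i \<bullet>\<^bsub>C\<^esub> (g \<bullet>\<^bsub>C\<^esub> h) = u" using comp_assoc[OF W Y(1) X(1) A h(1) g(1) X(3)] g h by simp
  then show "\<exists>h\<in>arr C W X. i \<bullet>\<^bsub>C\<^esub> h = u" using comp_closed[OF W Y(1) X(1) h(1) g(1)] by blast
qed (use x in \<open>auto simp: gen_elem_def\<close>)

lemma gen_elem_comp:
  assumes A: "A \<in> Obj C" and S: "S \<in> Sub C A" and V: "V \<in> Obj C" and W: "W \<in> Obj C"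
    and u: "gen_elem W u S" and g: "g \<in> arr C V W"
  shows "gen_elem V (u \<bullet>\<^bsub>C\<^esub> g) S"
proof -
  obtain X i h where x: "(X, i) \<in> S" and h: "h \<in> arr C W X" "i \<bullet>\<^bsub>C\<^esub> h = u"
    using u unfolding gen_elem_def by blast
  note X = Sub_member[OF A S x]
  have "i \<bullet>\<^bsub>C\<^esub> (h \<bullet>\<^bsub>C\<^esub> g) = u \<bullet>\<^bsub>C\<^esub> g" using comp_assoc[OF V W X(1) A g h(1) X(3)] h by simp
  then show ?thesis using comp_closed[OF V W X(1) g h(1)] x unfolding gen_elem_def by blast
qed

lemma gen_elem_class:
  assumes "A \<in> Obj C" "X \<in> Obj C" "is_mono C X A i" "W \<in> Obj C"
  shows "gen_elem W u (mono_rel C A `` {(X, i)}) \<longleftrightarrow> (\<exists>h\<in>arr C W X. i \<bullet>\<^bsub>C\<^esub> h = u)"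
  using gen_elem_iff[OF assms(1) Sub_class self_in_class] assms by blast

text \<open>A Yoneda argument: the monomorphism \<open>i\<close> is the universal generalized
  element of \<open>S\<close>, so testing it alone decides the inclusion.\<close>

lemma sub_le_iff_gen_elem:
  assumes A: "A \<in> Obj C" and S: "S \<in> Sub C A" and T: "T \<in> Sub C A" and x: "(X, i) \<in> S"
  shows "sub_le C S T \<longleftrightarrow> gen_elem X i T"
proof
  assume "sub_le C S T"
  then obtain X' i' Y j where y: "(X', i') \<in> S" "(Y, j) \<in> T" "factors C (X', i') (Y, j)"
    unfolding sub_le_def by auto
  note X = Sub_member[OF A S x] and X' = Sub_member[OF A S y(1)] and Y = Sub_member[OF A T y(2)]
  obtain h where h: "h \<in> arr C X' Y" "j \<bullet>\<^bsub>C\<^esub> h = i'" using y(3) by (auto simp: factors_def)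
  obtain g where g: "g \<in> arr C X X'" "i' \<bullet>\<^bsub>C\<^esub> g = i"
    using gen_elem_member[OF A S x] gen_elem_iff[OF A S y(1) X(1)] by blast
  have "gen_elem X' i' T" using h y(2) unfolding gen_elem_def by blast
  then show "gen_elem X i T" using gen_elem_comp[OF A T X(1) X'(1)] g by blast
next
  assume "gen_elem X i T"
  then show "sub_le C S T" using x unfolding gen_elem_def sub_le_def factors_def by fastforce
qed

lemma gen_elem_mono:
  assumes A: "A \<in> Obj C" and S: "S \<in> Sub C A" and T: "T \<in> Sub C A" and W: "W \<in> Obj C"
    and le: "sub_le C S T" and u: "gen_elem W u S"
  shows "gen_elem W u T"
proof -
  obtain X i h where x: "(X, i) \<in> S" and h: "h \<in> arr C W X" "i \<bullet>\<^bsub>C\<^esub> h = u"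
    using u unfolding gen_elem_def by blast
  have "gen_elem X i T" using le sub_le_iff_gen_elem[OF A S T x] by blast
  then show ?thesis using gen_elem_comp[OF A T W Sub_member(1)[OF A S x]] h by blast
qed

lemma sub_le_refl: "\<lbrakk>A \<in> Obj C; S \<in> Sub C A\<rbrakk> \<Longrightarrow> sub_le C S S"
  using Sub_member_exists[of A S] gen_elem_member[of A S] sub_le_iff_gen_elem[of A S S] by blast

lemma sub_le_trans:
  assumes "A \<in> Obj C" "S \<in> Sub C A" "T \<in> Sub C A" "U \<in> Sub C A" "sub_le C S T" "sub_le C T U"
  shows "sub_le C S U"
proof -
  obtain X i where x: "(X, i) \<in> S" using Sub_member_exists[OF assms(1,2)] by blast
  have "gen_elem X i T" using sub_le_iff_gen_elem[OF assms(1-3) x] assms(5) by simp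
  then have "gen_elem X i U"
    using gen_elem_mono[OF assms(1,3,4) Sub_member(1)[OF assms(1,2) x] assms(6)] by simp
  then show ?thesis using sub_le_iff_gen_elem[OF assms(1,2,4) x] by simp
qed

lemma sub_le_antisym:
  assumes A: "A \<in> Obj C" and S: "S \<in> Sub C A" and T: "T \<in> Sub C A"
    and "sub_le C S T" "sub_le C T S"
  shows "S = T"
proof -
  obtain X i where X: "X \<in> Obj C" "is_mono C X A i" "S = mono_rel C A `` {(X, i)}"
    using S by (rule SubE)
  obtain Y j where Y: "Y \<in> Obj C" "is_mono C Y A j" "T = mono_rel C A `` {(Y, j)}"
    using T by (rule SubE)
  have x: "(X, i) \<in> S" and y: "(Y, j) \<in> T" using X Y self_in_class[OF A] by auto
  have "gen_elem X i T" "gen_elem Y j S" using assms sub_le_iff_gen_elem x y by blast+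
  then have "factors C (X, i) (Y, j)" "factors C (Y, j) (X, i)"
    using gen_elem_iff[OF A T y X(1)] gen_elem_iff[OF A S x Y(1)] by (auto simp: factors_def)
  then have "((X, i), (Y, j)) \<in> mono_rel C A" using X Y MonosI by (auto simp: mono_rel_def)
  then show ?thesis using X Y equiv_class_eq[OF equiv_mono_rel[OF A]] by blast
qed

lemma class_le_iff:
  assumes "A \<in> Obj C" "X \<in> Obj C" "is_mono C X A i" "Y \<in> Obj C" "is_mono C Y A j"
  shows "sub_le C (mono_rel C A `` {(X, i)}) (mono_rel C A `` {(Y, j)})
    \<longleftrightarrow> (\<exists>g\<in>arr C X Y. j \<bullet>\<^bsub>C\<^esub> g = i)"
  using sub_le_iff_gen_elem[OF assms(1) Sub_class[OF assms(2,3)] Sub_class[OF assms(4,5)]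
      self_in_class[OF assms(1-3)]]
    gen_elem_class[OF assms(1,4,5,2)] by simp

section \<open>Lengths of subobjects\<close>

lemma class_comp_le_iff:
  assumes A: "A \<in> Obj C" and X: "X \<in> Obj C" and i: "is_mono C X A i"
    and Y: "Y \<in> Obj C" "is_mono C Y X h" and Z: "Z \<in> Obj C" "is_mono C Z X l"
  shows "sub_le C (mono_rel C A `` {(Y, i \<bullet>\<^bsub>C\<^esub> h)}) (mono_rel C A `` {(Z, i \<bullet>\<^bsub>C\<^esub> l)})
    \<longleftrightarrow> sub_le C (mono_rel C X `` {(Y, h)}) (mono_rel C X `` {(Z, l)})"
proof -
  have "(i \<bullet>\<^bsub>C\<^esub> l) \<bullet>\<^bsub>C\<^esub> g = i \<bullet>\<^bsub>C\<^esub> h \<longleftrightarrow> l \<bullet>\<^bsub>C\<^esub> g = h" if g: "g \<in> arr C Y Z" for g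
  proof -
    have "(i \<bullet>\<^bsub>C\<^esub> l) \<bullet>\<^bsub>C\<^esub> g = i \<bullet>\<^bsub>C\<^esub> (l \<bullet>\<^bsub>C\<^esub> g)"
      by (rule comp_assoc[OF Y(1) Z(1) X A g is_mono_arr[OF Z(2)] is_mono_arr[OF i]])
    moreover have "l \<bullet>\<^bsub>C\<^esub> g \<in> arr C Y X"
      by (rule comp_closed[OF Y(1) Z(1) X g is_mono_arr[OF Z(2)]])
    ultimately show ?thesis
      using is_mono_cancel[OF i Y(1) _ is_mono_arr[OF Y(2)]] by auto
  qed
  then show ?thesis
    using class_le_iff[OF A Y(1) is_mono_comp[OF Y(1) X A Y(2) i] Z(1) is_mono_comp[OF Z(1) X A Z(2) i]]
      class_le_iff[OF X Y Z] by auto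
qed

text \<open>Chains go to chains of the same size. Injectivity is derived, not assumed: by
  reflexivity equal images are related both ways, and antisymmetry on \<open>P\<close> then
  identifies the points.\<close>

lemma poset_length_le_embedding:
  assumes maps: "\<And>x. x \<in> P \<Longrightarrow> p x \<in> Q"
    and emb: "\<And>x y. \<lbrakk>x \<in> P; y \<in> P\<rbrakk> \<Longrightarrow> rel' (p x) (p y) \<longleftrightarrow> rel x y"
    and refl: "\<And>x. x \<in> Q \<Longrightarrow> rel' x x"
    and antisym: "\<And>x y. \<lbrakk>x \<in> P; y \<in> P; rel x y; rel y x\<rbrakk> \<Longrightarrow> x = y"
  shows "poset_length P rel \<le> poset_length Q rel'"
  unfolding poset_length_def
proof (rule SUP_mono, clarsimp)
  fix F
  assume F: "F \<subseteq> P" "finite F" "F \<noteq> {}" and chain: "\<forall>x\<in>F. \<forall>y\<in>F. rel x y \<or> rel y x"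
  have "inj_on p F"
  proof (rule inj_onI)
    fix x y assume xy: "x \<in> F" "y \<in> F" "p x = p y"
    then have "rel x y" "rel y x"
      using emb[of x y] emb[of y x] refl[OF maps, of y] F(1) by auto
    then show "x = y" using antisym[of x y] xy F(1) by blast
  qed
  then have "card (p ` F) = card F" by (rule card_image)
  moreover have "\<forall>x\<in>p ` F. \<forall>y\<in>p ` F. rel' x y \<or> rel' y x"
    using chain emb F(1) by (simp add: subset_iff)
  ultimately show "\<exists>G. G \<subseteq> Q \<and> finite G \<and> G \<noteq> {} \<and>
      (\<forall>x\<in>G. \<forall>y\<in>G. rel' x y \<or> rel' y x) \<and> card F - Suc 0 \<le> card G - Suc 0"
    using F maps by (intro exI[of _ "p ` F"]) auto
qed

text \<open>Composition with \<open>i\<close> identifies the subobjects of \<open>X\<close> with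
  those of \<open>A\<close> below the class of \<open>i\<close>; an order embedding in each
  direction gives equal lengths. Applied with \<open>X\<close> equal to \<open>B\<close>, this shows
  that every copy of \<open>B\<close> inside a power has length \<open>d\<close>.\<close>

lemma poset_length_below:
  assumes A: "A \<in> Obj C" and X: "X \<in> Obj C" and i: "is_mono C X A i"
  shows "poset_length {T \<in> Sub C A. sub_le C T (mono_rel C A `` {(X, i)})} (sub_le C) = obj_length C X"
    (is "poset_length ?below _ = _")
proof (rule antisym)
  \<comment> \<open>A subobject is a class of monomorphisms, so the map back to
    \<open>Sub C X\<close> needs a chosen representative that factors through \<open>i\<close>.
    Domain and arrow are packed into one \<open>y\<close> for \<open>bchoice\<close>.\<close>
  have "\<forall>T\<in>?below. \<exists>y. fst y \<in> Obj C \<and> is_mono C (fst y) X (snd y)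
      \<and> T = mono_rel C A `` {(fst y, i \<bullet>\<^bsub>C\<^esub> snd y)}"
  proof
    fix T assume T: "T \<in> ?below"
    obtain Y j where Y: "Y \<in> Obj C" and j: "is_mono C Y A j" and Tj: "T = mono_rel C A `` {(Y, j)}"
      using T by (auto elim!: SubE)
    obtain h where h: "h \<in> arr C Y X" "i \<bullet>\<^bsub>C\<^esub> h = j"
      using T class_le_iff[OF A Y j X i] Tj by auto
    have "is_mono C Y X h"
      using is_mono_of_comp[OF Y X A h(1) is_mono_arr[OF i]] h(2) j by simp
    then show "\<exists>y. fst y \<in> Obj C \<and> is_mono C (fst y) X (snd y)
        \<and> T = mono_rel C A `` {(fst y, i \<bullet>\<^bsub>C\<^esub> snd y)}"
      using Y Tj h(2) by (intro exI[of _ "(Y, h)"]) simp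
  qed
  then obtain y where y: "\<forall>T\<in>?below. fst (y T) \<in> Obj C \<and> is_mono C (fst (y T)) X (snd (y T))
      \<and> T = mono_rel C A `` {(fst (y T), i \<bullet>\<^bsub>C\<^esub> snd (y T))}"
    by (rule bchoice[THEN exE])
  define Y h where "Y = fst \<circ> y" and "h = snd \<circ> y"
  have Y: "\<And>T. T \<in> ?below \<Longrightarrow> Y T \<in> Obj C"
    and h: "\<And>T. T \<in> ?below \<Longrightarrow> is_mono C (Y T) X (h T)"
    and Th: "\<And>T. T \<in> ?below \<Longrightarrow> T = mono_rel C A `` {(Y T, i \<bullet>\<^bsub>C\<^esub> h T)}"
    using y by (simp_all add: Y_def h_def)
  show "poset_length ?below (sub_le C) \<le> obj_length C X"
    unfolding obj_length_def
  proof (rule poset_length_le_embedding[where p = "\<lambda>T. mono_rel C X `` {(Y T, h T)}"])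
    show "sub_le C (mono_rel C X `` {(Y T, h T)}) (mono_rel C X `` {(Y U, h U)}) \<longleftrightarrow> sub_le C T U"
      if "T \<in> ?below" "U \<in> ?below" for T U
      using class_comp_le_iff[OF A X i Y h Y h] Th that by simp
    show "mono_rel C X `` {(Y T, h T)} \<in> Sub C X" if "T \<in> ?below" for T
      using Sub_class[OF Y h] that by blast
    show "sub_le C T T" if "T \<in> Sub C X" for T using sub_le_refl[OF X that] .
    show "T = U" if "T \<in> ?below" "U \<in> ?below" "sub_le C T U" "sub_le C U T" for T U
      using sub_le_antisym[OF A] that by auto
  qed
next
  have "\<forall>T\<in>Sub C X. \<exists>y. fst y \<in> Obj C \<and> is_mono C (fst y) X (snd y) \<and> T = mono_rel C X `` {y}"
    by (force elim!: SubE)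
  then obtain y where y: "\<forall>T\<in>Sub C X. fst (y T) \<in> Obj C \<and> is_mono C (fst (y T)) X (snd (y T))
      \<and> T = mono_rel C X `` {y T}"
    by (rule bchoice[THEN exE])
  define Y h where "Y = fst \<circ> y" and "h = snd \<circ> y"
  have Y: "\<And>T. T \<in> Sub C X \<Longrightarrow> Y T \<in> Obj C"
    and h: "\<And>T. T \<in> Sub C X \<Longrightarrow> is_mono C (Y T) X (h T)"
    and Th: "\<And>T. T \<in> Sub C X \<Longrightarrow> T = mono_rel C X `` {(Y T, h T)}"
    using y by (simp_all add: Y_def h_def)
  have ih: "is_mono C (Y T) A (i \<bullet>\<^bsub>C\<^esub> h T)" if "T \<in> Sub C X" for T
    using is_mono_comp[OF Y X A h i] that by blast
  show "obj_length C X \<le> poset_length ?below (sub_le C)"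
    unfolding obj_length_def
  proof (rule poset_length_le_embedding[where p = "\<lambda>T. mono_rel C A `` {(Y T, i \<bullet>\<^bsub>C\<^esub> h T)}"])
    show "sub_le C (mono_rel C A `` {(Y T, i \<bullet>\<^bsub>C\<^esub> h T)}) (mono_rel C A `` {(Y U, i \<bullet>\<^bsub>C\<^esub> h U)})
        \<longleftrightarrow> sub_le C T U" if "T \<in> Sub C X" "U \<in> Sub C X" for T U
      using class_comp_le_iff[OF A X i Y h Y h] Th that by simp
    show "mono_rel C A `` {(Y T, i \<bullet>\<^bsub>C\<^esub> h T)} \<in> ?below" if "T \<in> Sub C X" for T
      using Sub_class[OF Y ih] class_le_iff[OF A Y ih X i] is_mono_arr[OF h] that by blast
    show "sub_le C T T" if "T \<in> ?below" for T using sub_le_refl[OF A] that by blast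
    show "T = U" if "T \<in> Sub C X" "U \<in> Sub C X" "sub_le C T U" "sub_le C U T" for T U
      using sub_le_antisym[OF X] that by auto
  qed
qed

text \<open>If \<open>S\<close> were strictly smaller, every chain below \<open>S\<close> could be
  lengthened by \<open>T\<close>; chains below \<open>S\<close> would have at most \<open>d\<close>
  members, and its length would be at most \<open>d - 1\<close>. The contradiction depends on
  \<open>d\<close> being finite.\<close>

lemma sub_eq_if_length_le:
  assumes A: "A \<in> Obj C" and S: "S \<in> Sub C A" and T: "T \<in> Sub C A" and le: "sub_le C S T"
    and lS: "poset_length {U \<in> Sub C A. sub_le C U S} (sub_le C) = enat d"
    and lT: "poset_length {U \<in> Sub C A. sub_le C U T} (sub_le C) \<le> enat d"
  shows "S = T"
proof (rule ccontr)
  assume ne: "S \<noteq> T"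
  let ?ch = "\<lambda>S. {F. F \<subseteq> {U \<in> Sub C A. sub_le C U S} \<and> finite F \<and> F \<noteq> {} \<and>
      (\<forall>T\<in>F. \<forall>U\<in>F. sub_le C T U \<or> sub_le C U T)}"
  have bound: "card F \<le> d" if F: "F \<in> ?ch S" for F
  proof -
    have below: "sub_le C U T" if "U \<in> F" for U
      using that F sub_le_trans[OF A _ S T _ le] by auto
    have "T \<notin> F" using F ne sub_le_antisym[OF A S T le] by auto
    moreover have "insert T F \<in> ?ch T"
      using F below T sub_le_refl[OF A T] by auto
    then have "enat (card (insert T F) - 1) \<le> poset_length {U \<in> Sub C A. sub_le C U T} (sub_le C)"
      unfolding poset_length_def by (rule SUP_upper)
    then have "enat (card (insert T F) - 1) \<le> enat d" using lT by (rule order_trans)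
    ultimately show ?thesis using F by simp
  qed
  \<comment> \<open>Truncated subtraction would give \<open>d - 1 = d\<close> for
    \<open>d = 0\<close>; the one-member chain rules this out.\<close>
  have "{S} \<in> ?ch S" using S sub_le_refl[OF A S] by auto
  then have d: "1 \<le> d" using bound[of "{S}"] by simp
  have "poset_length {U \<in> Sub C A. sub_le C U S} (sub_le C) \<le> enat (d - 1)"
    unfolding poset_length_def
  proof (rule SUP_least)
    fix F assume "F \<in> ?ch S"
    then show "enat (card F - 1) \<le> enat (d - 1)" using bound by (simp add: diff_le_mono)
  qed
  then show False using lS d by simp
qed

end

section \<open>Images and the zero subobject\<close>

context abelian_linear_category
begin

text \<open>In an abelian category a monomorphism is the kernel of its cokernel, so it represents
  its own image. The graph of an endomorphism, defined as an image, thereby becomes the class of one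
  explicit monomorphism.\<close>

lemma image_sub_of_mono:
  assumes X: "X \<in> Obj C" and Y: "Y \<in> Obj C" and f: "is_mono C X Y f"
  shows "image_sub C X Y f = mono_rel C Y `` {(X, f)}"
proof -
  have fa: "f \<in> arr C X Y" using f by (rule is_mono_arr)
  obtain Z g where Z: "Z \<in> Obj C" and g: "g \<in> arr C Y Z" and ker: "is_kernel C Y Z g X f"
    using mono_normal[OF X Y f] by blast
  \<comment> \<open>\<open>f\<close> is the kernel of some \<open>g\<close>, and \<open>g\<close>
    factors through every cokernel \<open>q\<close> of \<open>f\<close>. Whatever \<open>q\<close>
    kills is then killed by \<open>g\<close> and lifts through \<open>f\<close>.\<close>
  have f_kernel: "is_kernel C Y Q q X f" if q: "is_cokernel C X Y f Q q" for Q q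
  proof -
    have Q: "Q \<in> Obj C" "q \<in> arr C Y Q" "q \<bullet>\<^bsub>C\<^esub> f = \<zero>\<^bsub>Hom C X Q\<^esub>"
      using q by (auto simp: is_cokernel_def)
    have "g \<bullet>\<^bsub>C\<^esub> f = \<zero>\<^bsub>Hom C X Z\<^esub>" using ker by (simp add: is_kernel_def)
    then obtain h where h: "h \<in> arr C Q Z" "h \<bullet>\<^bsub>C\<^esub> q = g"
      using q Z g unfolding is_cokernel_def by blast
    have "\<exists>!l. l \<in> arr C W X \<and> f \<bullet>\<^bsub>C\<^esub> l = u"
      if W: "W \<in> Obj C" and u: "u \<in> arr C W Y" and z: "q \<bullet>\<^bsub>C\<^esub> u = \<zero>\<^bsub>Hom C W Q\<^esub>" for W u
    proof -
      have "g \<bullet>\<^bsub>C\<^esub> u = \<zero>\<^bsub>Hom C W Z\<^esub>"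
        using comp_assoc[OF W Y Q(1) Z u Q(2) h(1)] h(2) z comp_zero_right[OF W Q(1) Z h(1)]
        by simp
      then show ?thesis using ker W u unfolding is_kernel_def by blast
    qed
    then show ?thesis using X fa Q unfolding is_kernel_def by blast
  qed
  \<comment> \<open>\<open>image_sub\<close> collects all choices of cokernel and kernel. To place a
    given representative in it, this one cokernel serves.\<close>
  obtain Q q where q: "is_cokernel C X Y f Q q" using cokernel_exists[OF X Y fa] by blast
  show ?thesis
  proof (intro equalityI subsetI)
    fix z assume "z \<in> image_sub C X Y f"
    then obtain Z' j Q' q' where z: "z = (Z', j)" and q': "is_cokernel C X Y f Q' q'"
      and j: "is_kernel C Y Q' q' Z' j" by (auto simp: image_sub_def)
    have Q': "Q' \<in> Obj C" "q' \<in> arr C Y Q'" using q' by (auto simp: is_cokernel_def)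
    have Z': "Z' \<in> Obj C" "j \<in> arr C Z' Y" "q' \<bullet>\<^bsub>C\<^esub> j = \<zero>\<^bsub>Hom C Z' Q'\<^esub>"
      using j by (auto simp: is_kernel_def)
    have "\<exists>h\<in>arr C Z' X. f \<bullet>\<^bsub>C\<^esub> h = j"
      using f_kernel[OF q'] Z' unfolding is_kernel_def by blast
    moreover have "\<exists>h\<in>arr C X Z'. j \<bullet>\<^bsub>C\<^esub> h = f"
      using j X fa q' unfolding is_kernel_def is_cokernel_def by blast
    ultimately show "z \<in> mono_rel C Y `` {(X, f)}"
      using z kernel_is_mono[OF Y Q'(1) Q'(2) j] MonosI[OF Z'(1)] MonosI[OF X f]
      by (auto simp: mono_rel_def factors_def)
  next
    fix z assume "z \<in> mono_rel C Y `` {(X, f)}"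
    then obtain Z' j h h' where z: "z = (Z', j)" and Z': "(Z', j) \<in> Monos C Y"
      and h: "h \<in> arr C X Z'" "j \<bullet>\<^bsub>C\<^esub> h = f" and h': "h' \<in> arr C Z' X" "f \<bullet>\<^bsub>C\<^esub> h' = j"
      by (auto simp: mono_rel_def factors_def)
    have j: "Z' \<in> Obj C" "is_mono C Z' Y j" "j \<in> arr C Z' Y" using MonosD[OF Z'] by auto
    have Q: "Q \<in> Obj C" "q \<in> arr C Y Q" "q \<bullet>\<^bsub>C\<^esub> f = \<zero>\<^bsub>Hom C X Q\<^esub>"
      using q by (auto simp: is_cokernel_def)
    have "q \<bullet>\<^bsub>C\<^esub> j = \<zero>\<^bsub>Hom C Z' Q\<^esub>"
      using comp_assoc[OF j(1) X Y Q(1) h'(1) fa Q(2)] h'(2) Q(3) comp_zero_left[OF j(1) X Q(1) h'(1)]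
      by simp
    moreover have "\<exists>!l. l \<in> arr C W Z' \<and> j \<bullet>\<^bsub>C\<^esub> l = u"
      if W: "W \<in> Obj C" and u: "u \<in> arr C W Y" and zero: "q \<bullet>\<^bsub>C\<^esub> u = \<zero>\<^bsub>Hom C W Q\<^esub>" for W u
    proof -
      obtain l where l: "l \<in> arr C W X" "f \<bullet>\<^bsub>C\<^esub> l = u"
        using f_kernel[OF q] W u zero unfolding is_kernel_def by blast
      have "j \<bullet>\<^bsub>C\<^esub> (h \<bullet>\<^bsub>C\<^esub> l) = u" using comp_assoc[OF W X j(1) Y l(1) h(1) j(3)] h l by simp
      moreover have "h \<bullet>\<^bsub>C\<^esub> l \<in> arr C W Z'" using comp_closed[OF W X j(1) l(1) h(1)] .
      ultimately show ?thesis using is_mono_cancel[OF j(2) W] by metis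
    qed
    ultimately have "is_kernel C Y Q q Z' j" using j unfolding is_kernel_def by blast
    then show "z \<in> image_sub C X Y f" using q z by (auto simp: image_sub_def)
  qed
qed

text \<open>The empty direct sum is a zero object: its identity is an empty sum, hence zero, and
  composing with it kills every incoming arrow. The family has no members, so
  \<open>undefined\<close> is harmless.\<close>

lemma zero_obj_exists: "\<exists>Z\<in>Obj C. \<forall>W\<in>Obj C. \<forall>f\<in>arr C W Z. f = \<zero>\<^bsub>Hom C W Z\<^esub>"
proof -
  obtain Z \<iota> \<pi> where b: "biproduct C 0 (\<lambda>_. undefined) Z \<iota> \<pi>"
    using biproduct_exists[of 0 "\<lambda>_. undefined"] by blast
  have Z: "Z \<in> Obj C" using b by (simp add: biproduct_def)
  interpret abelian_group "Hom C Z Z" using hom_abelian_group[OF Z Z] .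
  have "Ident C Z = \<zero>\<^bsub>Hom C Z Z\<^esub>" using b by (simp add: biproduct_def)
  then show ?thesis using Z ident_left comp_zero_left by metis
qed

text \<open>If \<open>S\<close> differed from the zero subobject, the two would form a chain of
  length 1. Arrows that factor through a zero object vanish.\<close>

lemma gen_elem_zero_of_length_zero:
  assumes A: "A \<in> Obj C" and S: "S \<in> Sub C A" and W: "W \<in> Obj C" and u: "gen_elem W u S"
    and l: "poset_length {T \<in> Sub C A. sub_le C T S} (sub_le C) = 0"
  shows "u = \<zero>\<^bsub>Hom C W A\<^esub>"
proof -
  obtain Z where Z: "Z \<in> Obj C" and zero: "\<And>W f. W \<in> Obj C \<Longrightarrow> f \<in> arr C W Z \<Longrightarrow> f = \<zero>\<^bsub>Hom C W Z\<^esub>"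
    using zero_obj_exists by blast
  let ?z = "\<zero>\<^bsub>Hom C Z A\<^esub>"
  have za: "?z \<in> arr C Z A" using zero_arr[OF Z A] .
  have zm: "is_mono C Z A ?z" unfolding is_mono_def using za zero by metis
  define N where "N = mono_rel C A `` {(Z, ?z)}"
  have N: "N \<in> Sub C A" and zN: "(Z, ?z) \<in> N"
    unfolding N_def using Sub_class[OF Z zm] self_in_class[OF A Z zm] by auto
  obtain X i where x: "(X, i) \<in> S" using u unfolding gen_elem_def by blast
  note X = Sub_member[OF A S x]
  have "gen_elem Z ?z S"
    using gen_elem_iff[OF A S x Z] comp_zero_right[OF Z X(1) A X(3)] zero_arr[OF Z X(1)] by blast
  then have NS: "sub_le C N S" using sub_le_iff_gen_elem[OF A N S zN] by blast
  have "S = N"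
  proof (rule ccontr)
    assume ne: "S \<noteq> N"
    let ?F = "{S, N}"
    have "?F \<subseteq> {T \<in> Sub C A. sub_le C T S} \<and> finite ?F \<and> ?F \<noteq> {} \<and>
        (\<forall>T\<in>?F. \<forall>U\<in>?F. sub_le C T U \<or> sub_le C U T)"
      using S N NS sub_le_refl[OF A] by auto
    then have "enat (card ?F - 1) \<le> poset_length {T \<in> Sub C A. sub_le C T S} (sub_le C)"
      unfolding poset_length_def by (intro SUP_upper) simp
    then show False using l ne by (simp add: zero_enat_def)
  qed
  then obtain h where "h \<in> arr C W Z" "?z \<bullet>\<^bsub>C\<^esub> h = u"
    using gen_elem_iff[OF A N zN W] u by blast
  then show ?thesis using comp_zero_left[OF W Z A] by simp
qed

end

subsection \<open>Powers of an object and the operations of its directory\<close>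

context linear_category
begin

lemma biproductD:
  assumes "biproduct C n A P \<iota> \<pi>"
  shows "P \<in> Obj C"
    and "\<And>r. r < n \<Longrightarrow> A r \<in> Obj C"
    and "\<And>r. r < n \<Longrightarrow> \<iota> r \<in> arr C (A r) P"
    and "\<And>r. r < n \<Longrightarrow> \<pi> r \<in> arr C P (A r)"
    and "\<And>r s. \<lbrakk>r < n; s < n\<rbrakk> \<Longrightarrow>
      \<pi> s \<bullet>\<^bsub>C\<^esub> \<iota> r = (if r = s then Ident C (A r) else \<zero>\<^bsub>Hom C (A r) (A s)\<^esub>)"
    and "finsum (Hom C P P) (\<lambda>r. \<iota> r \<bullet>\<^bsub>C\<^esub> \<pi> r) {..<n} = Ident C P"
  using assms unfolding biproduct_def by auto

lemma biproduct_decompose: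
  assumes b: "biproduct C n A P \<iota> \<pi>" and W: "W \<in> Obj C" and u: "u \<in> arr C W P"
  shows "u = finsum (Hom C W P) (\<lambda>r. \<iota> r \<bullet>\<^bsub>C\<^esub> (\<pi> r \<bullet>\<^bsub>C\<^esub> u)) {..<n}"
proof -
  note D = biproductD[OF b]
  interpret WP: abelian_group "Hom C W P" using hom_abelian_group W D by blast
  have "u = finsum (Hom C P P) (\<lambda>r. \<iota> r \<bullet>\<^bsub>C\<^esub> \<pi> r) {..<n} \<bullet>\<^bsub>C\<^esub> u"
    using ident_left[OF W D(1) u] D(6) by simp
  also have "\<dots> = finsum (Hom C W P) (\<lambda>r. (\<iota> r \<bullet>\<^bsub>C\<^esub> \<pi> r) \<bullet>\<^bsub>C\<^esub> u) {..<n}"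
    using comp_closed[OF D(1) D(2) D(1) D(4) D(3)] by (intro comp_finsum_left W D(1) u) auto
  also have "\<dots> = finsum (Hom C W P) (\<lambda>r. \<iota> r \<bullet>\<^bsub>C\<^esub> (\<pi> r \<bullet>\<^bsub>C\<^esub> u)) {..<n}"
  proof (rule WP.finsum_cong')
    show "(\<lambda>r. \<iota> r \<bullet>\<^bsub>C\<^esub> (\<pi> r \<bullet>\<^bsub>C\<^esub> u)) \<in> {..<n} \<rightarrow> arr C W P"
      using comp_closed[OF W D(2) D(1) comp_closed[OF W D(1) D(2) u D(4)] D(3)] by auto
    show "(\<iota> r \<bullet>\<^bsub>C\<^esub> \<pi> r) \<bullet>\<^bsub>C\<^esub> u = \<iota> r \<bullet>\<^bsub>C\<^esub> (\<pi> r \<bullet>\<^bsub>C\<^esub> u)" if "r \<in> {..<n}" for r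
      using that comp_assoc[OF W D(1) D(2) D(1) u D(4) D(3)] by simp
  qed simp
  finally show ?thesis .
qed

lemma biproduct_ext:
  assumes b: "biproduct C n A P \<iota> \<pi>" and W: "W \<in> Obj C"
    and u: "u \<in> arr C W P" and v: "v \<in> arr C W P"
    and eq: "\<And>r. r < n \<Longrightarrow> \<pi> r \<bullet>\<^bsub>C\<^esub> u = \<pi> r \<bullet>\<^bsub>C\<^esub> v"
  shows "u = v"
proof -
  note D = biproductD[OF b]
  interpret WP: abelian_group "Hom C W P" using hom_abelian_group W D by blast
  have "finsum (Hom C W P) (\<lambda>r. \<iota> r \<bullet>\<^bsub>C\<^esub> (\<pi> r \<bullet>\<^bsub>C\<^esub> u)) {..<n}
      = finsum (Hom C W P) (\<lambda>r. \<iota> r \<bullet>\<^bsub>C\<^esub> (\<pi> r \<bullet>\<^bsub>C\<^esub> v)) {..<n}"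
    using eq comp_closed[OF W D(2) D(1) comp_closed[OF W D(1) D(2) v D(4)] D(3)]
    by (intro WP.finsum_cong') auto
  then show ?thesis using biproduct_decompose[OF b W] u v by metis
qed

lemma biproduct_tuple:
  assumes b: "biproduct C n A P \<iota> \<pi>" and W: "W \<in> Obj C"
    and f: "\<And>r. r < n \<Longrightarrow> f r \<in> arr C W (A r)"
  defines "t \<equiv> finsum (Hom C W P) (\<lambda>r. \<iota> r \<bullet>\<^bsub>C\<^esub> f r) {..<n}"
  shows "t \<in> arr C W P" and "\<And>s. s < n \<Longrightarrow> \<pi> s \<bullet>\<^bsub>C\<^esub> t = f s"
proof -
  note D = biproductD[OF b]
  interpret WP: abelian_group "Hom C W P" using hom_abelian_group W D by blast
  have c: "\<iota> r \<bullet>\<^bsub>C\<^esub> f r \<in> arr C W P" if "r < n" for r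
    using comp_closed[OF W D(2) D(1) f D(3)] that by blast
  then show "t \<in> arr C W P" unfolding t_def by (intro WP.finsum_closed) auto
  fix s assume s: "s < n"
  interpret Ws: abelian_group "Hom C W (A s)" using hom_abelian_group W D(2)[OF s] by blast
  have "\<pi> s \<bullet>\<^bsub>C\<^esub> t = finsum (Hom C W (A s)) (\<lambda>r. \<pi> s \<bullet>\<^bsub>C\<^esub> (\<iota> r \<bullet>\<^bsub>C\<^esub> f r)) {..<n}"
    unfolding t_def using c by (intro comp_finsum_right[OF W D(1) D(2)[OF s] D(4)[OF s]]) auto
  also have "\<dots> = finsum (Hom C W (A s)) (\<lambda>r. if s = r then f s else \<zero>\<^bsub>Hom C W (A s)\<^esub>) {..<n}"
  proof (rule Ws.finsum_cong')
    show "\<pi> s \<bullet>\<^bsub>C\<^esub> (\<iota> r \<bullet>\<^bsub>C\<^esub> f r) = (if s = r then f s else \<zero>\<^bsub>Hom C W (A s)\<^esub>)"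
      if "r \<in> {..<n}" for r
      using that comp_assoc[OF W D(2) D(1) D(2)[OF s] f D(3) D(4)[OF s], of r] D(5)[of r s] s
        ident_left[OF W D(2)[OF s] f[OF s]] comp_zero_left[OF W D(2) D(2)[OF s] f]
      by (auto split: if_splits)
  qed (use f[OF s] in auto)
  also have "\<dots> = f s" using Ws.finsum_singleton[of s "{..<n}" "\<lambda>_. f s"] s f[OF s] by auto
  finally show "\<pi> s \<bullet>\<^bsub>C\<^esub> t = f s" .
qed

end

context abelian_linear_category
begin

lemma pow_biproduct:
  assumes "B \<in> Obj C"
  shows "biproduct C n (\<lambda>_. B) (pow_obj C B n) (pow_inj C B n) (pow_prj C B n)"
proof -
  have "\<exists>x. case x of (P, \<iota>, \<pi>) \<Rightarrow> biproduct C n (\<lambda>_. B) P \<iota> \<pi>"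
    using biproduct_exists[of n "\<lambda>_. B"] assms by auto
  then have "case pow_data C B n of (P, \<iota>, \<pi>) \<Rightarrow> biproduct C n (\<lambda>_. B) P \<iota> \<pi>"
    unfolding pow_data_def by (rule someI_ex)
  then show ?thesis by (simp add: pow_obj_def pow_inj_def pow_prj_def split: prod.splits)
qed

lemma pow_obj: "B \<in> Obj C \<Longrightarrow> pow_obj C B n \<in> Obj C"
  and pow_inj_arr: "\<lbrakk>B \<in> Obj C; r < n\<rbrakk> \<Longrightarrow> pow_inj C B n r \<in> arr C B (pow_obj C B n)"
  and pow_prj_arr: "\<lbrakk>B \<in> Obj C; r < n\<rbrakk> \<Longrightarrow> pow_prj C B n r \<in> arr C (pow_obj C B n) B"
  and pow_prj_inj: "\<lbrakk>B \<in> Obj C; r < n; s < n\<rbrakk> \<Longrightarrow>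
    pow_prj C B n s \<bullet>\<^bsub>C\<^esub> pow_inj C B n r = (if r = s then Ident C B else \<zero>\<^bsub>Hom C B B\<^esub>)"
  by (rule biproductD[OF pow_biproduct]; assumption)+

definition tuple :: "'c \<Rightarrow> 'c \<Rightarrow> nat \<Rightarrow> (nat \<Rightarrow> 'd) \<Rightarrow> 'd" where
  "tuple W B n f = finsum (Hom C W (pow_obj C B n)) (\<lambda>r. pow_inj C B n r \<bullet>\<^bsub>C\<^esub> f r) {..<n}"

lemma tuple_arr:
  "\<lbrakk>B \<in> Obj C; W \<in> Obj C; \<And>r. r < n \<Longrightarrow> f r \<in> arr C W B\<rbrakk> \<Longrightarrow> tuple W B n f \<in> arr C W (pow_obj C B n)"
  and pow_prj_tuple:
  "\<lbrakk>B \<in> Obj C; W \<in> Obj C; \<And>r. r < n \<Longrightarrow> f r \<in> arr C W B; s < n\<rbrakk>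
    \<Longrightarrow> pow_prj C B n s \<bullet>\<^bsub>C\<^esub> tuple W B n f = f s"
  unfolding tuple_def
  by (rule biproduct_tuple(1)[OF pow_biproduct]; assumption)
    (rule biproduct_tuple(2)[OF pow_biproduct]; assumption)

lemma pow_ext:
  "\<lbrakk>B \<in> Obj C; W \<in> Obj C; u \<in> arr C W (pow_obj C B n); v \<in> arr C W (pow_obj C B n);
    \<And>r. r < n \<Longrightarrow> pow_prj C B n r \<bullet>\<^bsub>C\<^esub> u = pow_prj C B n r \<bullet>\<^bsub>C\<^esub> v\<rbrakk> \<Longrightarrow> u = v"
  by (rule biproduct_ext[OF pow_biproduct])

lemma mat_arrow_closed:
  assumes B: "B \<in> Obj C" and g: "\<And>r s. \<lbrakk>r < n; s < n\<rbrakk> \<Longrightarrow> g $$ (r, s) \<in> carrier k"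
  shows "mat_arrow C B n g \<in> arr C (pow_obj C B n) (pow_obj C B n)"
proof -
  let ?P = "pow_obj C B n"
  note P = pow_obj[OF B, of n]
  interpret PP: abelian_group "Hom C ?P ?P" using hom_abelian_group P by blast
  show ?thesis unfolding mat_arrow_def
    using smult_arr[OF P P g comp_closed[OF P B P pow_prj_arr[OF B] pow_inj_arr[OF B]]]
    by (intro PP.finsum_closed) auto
qed

text \<open>This is the matrix-vector product in coordinates: projecting to coordinate
  \<open>r\<close> annihilates every injection except the one with index \<open>r\<close>, so a
  single row of the double sum survives.\<close>

lemma pow_prj_mat_arrow:
  assumes B: "B \<in> Obj C" and g: "\<And>r s. \<lbrakk>r < n; s < n\<rbrakk> \<Longrightarrow> g $$ (r, s) \<in> carrier k"
    and W: "W \<in> Obj C" and u: "u \<in> arr C W (pow_obj C B n)" and r: "r < n"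
  shows "pow_prj C B n r \<bullet>\<^bsub>C\<^esub> (mat_arrow C B n g \<bullet>\<^bsub>C\<^esub> u)
    = finsum (Hom C W B) (\<lambda>s. g $$ (r, s) \<odot>\<^bsub>Hom C W B\<^esub> (pow_prj C B n s \<bullet>\<^bsub>C\<^esub> u)) {..<n}"
proof -
  let ?P = "pow_obj C B n" and ?i = "pow_inj C B n" and ?p = "pow_prj C B n"
  note P = pow_obj[OF B, of n] and i = pow_inj_arr[OF B, of _ n] and p = pow_prj_arr[OF B, of _ n]
  interpret PP: abelian_group "Hom C ?P ?P" using hom_abelian_group P by blast
  interpret WB: Module.module k "Hom C W B" using hom_module W B by blast
  let ?E = "\<lambda>(a, s). g $$ (a, s) \<odot>\<^bsub>Hom C ?P ?P\<^esub> (?i a \<bullet>\<^bsub>C\<^esub> ?p s)"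
  let ?I = "{..<n} \<times> {..<n}"
  let ?c = "\<lambda>s. g $$ (r, s) \<odot>\<^bsub>Hom C W B\<^esub> (?p s \<bullet>\<^bsub>C\<^esub> u)"
  have ip: "?i a \<bullet>\<^bsub>C\<^esub> ?p s \<in> arr C ?P ?P" if "a < n" "s < n" for a s
    using comp_closed[OF P B P p i] that by blast
  have E: "?E \<in> ?I \<rightarrow> arr C ?P ?P" using smult_arr[OF P P g ip] by auto
  have pE: "(\<lambda>x. ?p r \<bullet>\<^bsub>C\<^esub> ?E x) \<in> ?I \<rightarrow> arr C ?P B"
    using comp_closed[OF P P B _ p[OF r]] E by (auto simp: Pi_iff)
  have pu: "?p s \<bullet>\<^bsub>C\<^esub> u \<in> arr C W B" if "s < n" for s
    using comp_closed[OF W P B u p] that by blast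
  have c: "?c s \<in> arr C W B" if "s < n" for s using g[OF r that] pu[OF that] by simp
  have pEu: "(?p r \<bullet>\<^bsub>C\<^esub> ?E (a, s)) \<bullet>\<^bsub>C\<^esub> u = (if a = r then ?c s else \<zero>\<^bsub>Hom C W B\<^esub>)"
    if as: "a < n" "s < n" for a s
  proof -
    have "(?p r \<bullet>\<^bsub>C\<^esub> ?E (a, s)) \<bullet>\<^bsub>C\<^esub> u = ?p r \<bullet>\<^bsub>C\<^esub> (?E (a, s) \<bullet>\<^bsub>C\<^esub> u)"
      by (rule comp_assoc[OF W P P B u _ p[OF r]]) (use smult_arr[OF P P g ip] as in simp)
    also have "?E (a, s) \<bullet>\<^bsub>C\<^esub> u = g $$ (a, s) \<odot>\<^bsub>Hom C W ?P\<^esub> (?i a \<bullet>\<^bsub>C\<^esub> (?p s \<bullet>\<^bsub>C\<^esub> u))"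
      using comp_smult_left[OF W P P g[OF as] u ip[OF as]] comp_assoc[OF W P B P u p i] as by simp
    also have "?p r \<bullet>\<^bsub>C\<^esub> \<dots> = g $$ (a, s) \<odot>\<^bsub>Hom C W B\<^esub> (?p r \<bullet>\<^bsub>C\<^esub> (?i a \<bullet>\<^bsub>C\<^esub> (?p s \<bullet>\<^bsub>C\<^esub> u)))"
      using comp_smult_right[OF W P B g[OF as] comp_closed[OF W B P pu i] p[OF r]] as by simp
    also have "?p r \<bullet>\<^bsub>C\<^esub> (?i a \<bullet>\<^bsub>C\<^esub> (?p s \<bullet>\<^bsub>C\<^esub> u)) = (?p r \<bullet>\<^bsub>C\<^esub> ?i a) \<bullet>\<^bsub>C\<^esub> (?p s \<bullet>\<^bsub>C\<^esub> u)"
      using comp_assoc[OF W B P B pu i p[OF r]] as by simp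
    also have "\<dots> = (if a = r then ?p s \<bullet>\<^bsub>C\<^esub> u else \<zero>\<^bsub>Hom C W B\<^esub>)"
      using pow_prj_inj[OF B as(1) r] ident_left[OF W B pu] comp_zero_left[OF W B B pu] as by simp
    finally show ?thesis using g[OF as] by simp
  qed
  have "?p r \<bullet>\<^bsub>C\<^esub> (mat_arrow C B n g \<bullet>\<^bsub>C\<^esub> u) = (?p r \<bullet>\<^bsub>C\<^esub> mat_arrow C B n g) \<bullet>\<^bsub>C\<^esub> u"
    using comp_assoc[OF W P P B u mat_arrow_closed[OF B g] p[OF r]] by simp
  also have "?p r \<bullet>\<^bsub>C\<^esub> mat_arrow C B n g = finsum (Hom C ?P B) (\<lambda>x. ?p r \<bullet>\<^bsub>C\<^esub> ?E x) ?I"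
    unfolding mat_arrow_def by (rule comp_finsum_right[OF P P B p[OF r] E]) simp
  also have "\<dots> \<bullet>\<^bsub>C\<^esub> u = finsum (Hom C W B) (\<lambda>x. (?p r \<bullet>\<^bsub>C\<^esub> ?E x) \<bullet>\<^bsub>C\<^esub> u) ?I"
    by (rule comp_finsum_left[OF W P B u pE]) simp
  \<comment> \<open>The terms outside row \<open>r\<close> vanish; afterwards the row is reindexed
    by its columns.\<close>
  also have "\<dots> = finsum (Hom C W B) (\<lambda>x. ?c (snd x)) ((\<lambda>s. (r, s)) ` {..<n})"
  proof (rule WB.add.finprod_mono_neutral_cong_right[simplified])
    show "(\<lambda>x. (?p r \<bullet>\<^bsub>C\<^esub> ?E x) \<bullet>\<^bsub>C\<^esub> u) \<in> ?I \<rightarrow> arr C W B"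
      using comp_closed[OF W P B u] pE by (auto simp: Pi_iff)
  qed (use pEu r in auto)
  also have "\<dots> = finsum (Hom C W B) ?c {..<n}"
  proof -
    have "(\<lambda>x. ?c (snd x)) \<in> (\<lambda>s. (r, s)) ` {..<n} \<rightarrow> arr C W B" using c by auto
    then show ?thesis
      using WB.finsum_reindex[of "\<lambda>x. ?c (snd x)" "\<lambda>s. (r, s)" "{..<n}"] by (simp add: inj_on_def)
  qed
  finally show ?thesis .
qed

lemma block_arrow_closed:
  assumes B: "B \<in> Obj C" and N: "c + n \<le> N"
  shows "block_arrow C B n N c \<in> arr C (pow_obj C B n) (pow_obj C B N)"
proof -
  note P = pow_obj[OF B]
  interpret PP: abelian_group "Hom C (pow_obj C B n) (pow_obj C B N)"
    using hom_abelian_group P by blast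
  show ?thesis unfolding block_arrow_def
    using comp_closed[OF P B P pow_prj_arr[OF B] pow_inj_arr[OF B]] N
    by (intro PP.finsum_closed) auto
qed

lemma pow_prj_block_arrow:
  assumes B: "B \<in> Obj C" and N: "c + n \<le> N" and s: "s < N"
  shows "pow_prj C B N s \<bullet>\<^bsub>C\<^esub> block_arrow C B n N c
    = (if c \<le> s \<and> s < c + n then pow_prj C B n (s - c) else \<zero>\<^bsub>Hom C (pow_obj C B n) B\<^esub>)"
proof -
  let ?P = "pow_obj C B n" and ?Q = "pow_obj C B N" and ?i = "pow_inj C B N" and ?p = "pow_prj C B n"
  note P = pow_obj[OF B, of n] and Q = pow_obj[OF B, of N] and i = pow_inj_arr[OF B, of _ N]
    and p = pow_prj_arr[OF B, of _ n] and q = pow_prj_arr[OF B s]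
  interpret PB: abelian_group "Hom C ?P B" using hom_abelian_group P B by blast
  have "pow_prj C B N s \<bullet>\<^bsub>C\<^esub> block_arrow C B n N c
      = finsum (Hom C ?P B) (\<lambda>r. pow_prj C B N s \<bullet>\<^bsub>C\<^esub> (?i (c + r) \<bullet>\<^bsub>C\<^esub> ?p r)) {..<n}"
    unfolding block_arrow_def using comp_closed[OF P B Q p i] N
    by (intro comp_finsum_right[OF P Q B q]) auto
  also have "\<dots> = finsum (Hom C ?P B) (\<lambda>r. if s = c + r then ?p r else \<zero>\<^bsub>Hom C ?P B\<^esub>) {..<n}"
  proof (rule PB.finsum_cong')
    show "(\<lambda>r. if s = c + r then ?p r else \<zero>\<^bsub>Hom C ?P B\<^esub>) \<in> {..<n} \<rightarrow> arr C ?P B"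
      using p by auto
    show "pow_prj C B N s \<bullet>\<^bsub>C\<^esub> (?i (c + r) \<bullet>\<^bsub>C\<^esub> ?p r) = (if s = c + r then ?p r else \<zero>\<^bsub>Hom C ?P B\<^esub>)"
      if "r \<in> {..<n}" for r
      using that N comp_assoc[OF P B Q B p i q, of r "c + r"] pow_prj_inj[OF B _ s, of "c + r"]
        ident_left[OF P B p, of r] comp_zero_left[OF P B B p, of r]
      by (cases "c + r = s") auto
  qed simp
  also have "\<dots> = (if c \<le> s \<and> s < c + n then ?p (s - c) else \<zero>\<^bsub>Hom C ?P B\<^esub>)"
  proof (cases "c \<le> s \<and> s < c + n")
    case True
    have "finsum (Hom C ?P B) (\<lambda>r. if s = c + r then ?p r else \<zero>\<^bsub>Hom C ?P B\<^esub>) {..<n}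
        = finsum (Hom C ?P B) (\<lambda>r. if s - c = r then ?p r else \<zero>\<^bsub>Hom C ?P B\<^esub>) {..<n}"
      using True p by (intro PB.finsum_cong') auto
    also have "\<dots> = ?p (s - c)"
      using True p by (intro PB.finsum_singleton) auto
    finally show ?thesis using True by simp
  next
    case False
    have "finsum (Hom C ?P B) (\<lambda>r. if s = c + r then ?p r else \<zero>\<^bsub>Hom C ?P B\<^esub>) {..<n}
        = finsum (Hom C ?P B) (\<lambda>r. \<zero>\<^bsub>Hom C ?P B\<^esub>) {..<n}"
      using False by (intro PB.finsum_cong') auto
    then show ?thesis using False by (auto simp: PB.finsum_zero)
  qed
  finally show ?thesis .
qed

text \<open>An arrow into a direct sum of representatives has two components, one through each
  summand. The conclusion is phrased in coordinates so that the block embeddings do not have to be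
  handled again.\<close>

lemma gen_elem_sub_oplus:
  assumes B: "B \<in> Obj C" and S: "S \<in> Sub C (pow_obj C B n)" and T: "T \<in> Sub C (pow_obj C B m)"
    and W: "W \<in> Obj C" and u: "gen_elem W u (sub_oplus C B n m S T)"
  obtains v w where "gen_elem W v S" "gen_elem W w T"
    "\<And>r. r < n \<Longrightarrow> pow_prj C B (n + m) r \<bullet>\<^bsub>C\<^esub> u = pow_prj C B n r \<bullet>\<^bsub>C\<^esub> v"
    "\<And>r. r < m \<Longrightarrow> pow_prj C B (n + m) (n + r) \<bullet>\<^bsub>C\<^esub> u = pow_prj C B m r \<bullet>\<^bsub>C\<^esub> w"
proof -
  let ?P = "pow_obj C B n" and ?Q = "pow_obj C B m" and ?R = "pow_obj C B (n + m)"
  let ?b = "block_arrow C B n (n + m) 0" and ?c = "block_arrow C B m (n + m) n"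
  note P = pow_obj[OF B, of n] and Q = pow_obj[OF B, of m] and R = pow_obj[OF B, of "n + m"]
  have b: "?b \<in> arr C ?P ?R" and c: "?c \<in> arr C ?Q ?R"
    using block_arrow_closed[OF B] by simp_all
  obtain Z h X i Y j \<iota> \<pi> where h: "h \<in> arr C W Z" and x: "(X, i) \<in> S" and y: "(Y, j) \<in> T"
    and bip: "biproduct C 2 (\<lambda>r. if r = 0 then X else Y) Z \<iota> \<pi>"
    and uh: "((?b \<bullet>\<^bsub>C\<^esub> i \<bullet>\<^bsub>C\<^esub> \<pi> 0) \<oplus>\<^bsub>Hom C Z ?R\<^esub> (?c \<bullet>\<^bsub>C\<^esub> j \<bullet>\<^bsub>C\<^esub> \<pi> 1)) \<bullet>\<^bsub>C\<^esub> h = u"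
    using u unfolding gen_elem_def sub_oplus_def by blast
  note X = Sub_member[OF P S x] and Y = Sub_member[OF Q T y]
  have Z: "Z \<in> Obj C" and p0: "\<pi> 0 \<in> arr C Z X" and p1: "\<pi> 1 \<in> arr C Z Y"
    using biproductD(1)[OF bip] biproductD(4)[OF bip, of 0] biproductD(4)[OF bip, of 1] by simp_all
  have h0: "\<pi> 0 \<bullet>\<^bsub>C\<^esub> h \<in> arr C W X" and h1: "\<pi> 1 \<bullet>\<^bsub>C\<^esub> h \<in> arr C W Y"
    using comp_closed[OF W Z _ h] X(1) Y(1) p0 p1 by auto
  define v where "v = i \<bullet>\<^bsub>C\<^esub> (\<pi> 0 \<bullet>\<^bsub>C\<^esub> h)"
  define w where "w = j \<bullet>\<^bsub>C\<^esub> (\<pi> 1 \<bullet>\<^bsub>C\<^esub> h)"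
  have v: "gen_elem W v S" and w: "gen_elem W w T"
    unfolding gen_elem_def v_def w_def using h0 h1 x y by blast+
  have va: "v \<in> arr C W ?P" and wa: "w \<in> arr C W ?Q"
    using gen_elem_arr[OF P S W v] gen_elem_arr[OF Q T W w] .
  have bi: "?b \<bullet>\<^bsub>C\<^esub> i \<in> arr C X ?R" and cj: "?c \<bullet>\<^bsub>C\<^esub> j \<in> arr C Y ?R"
    using comp_closed[OF X(1) P R X(3) b] comp_closed[OF Y(1) Q R Y(3) c] .
  have "(?b \<bullet>\<^bsub>C\<^esub> i \<bullet>\<^bsub>C\<^esub> \<pi> 0) \<bullet>\<^bsub>C\<^esub> h = ?b \<bullet>\<^bsub>C\<^esub> v"
    unfolding v_def
    using comp_assoc[OF W Z X(1) R h p0 bi] comp_assoc[OF W X(1) P R h0 X(3) b] by simp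
  moreover have "(?c \<bullet>\<^bsub>C\<^esub> j \<bullet>\<^bsub>C\<^esub> \<pi> 1) \<bullet>\<^bsub>C\<^esub> h = ?c \<bullet>\<^bsub>C\<^esub> w"
    unfolding w_def
    using comp_assoc[OF W Z Y(1) R h p1 cj] comp_assoc[OF W Y(1) Q R h1 Y(3) c] by simp
  ultimately have uvw: "u = ?b \<bullet>\<^bsub>C\<^esub> v \<oplus>\<^bsub>Hom C W ?R\<^esub> ?c \<bullet>\<^bsub>C\<^esub> w"
    using comp_add_left[OF W Z R h comp_closed[OF Z X(1) R p0 bi] comp_closed[OF Z Y(1) R p1 cj]] uh
    by simp
  have bv: "?b \<bullet>\<^bsub>C\<^esub> v \<in> arr C W ?R" and cw: "?c \<bullet>\<^bsub>C\<^esub> w \<in> arr C W ?R"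
    using comp_closed[OF W P R va b] comp_closed[OF W Q R wa c] .
  interpret WB: abelian_group "Hom C W B" using hom_abelian_group W B by blast
  \<comment> \<open>Each coordinate of the sum is a sum of two block projections. One of them is
    zero, the other is a coordinate of \<open>v\<close> or of \<open>w\<close>.\<close>
  have coord: "pow_prj C B (n + m) s \<bullet>\<^bsub>C\<^esub> u
      = (pow_prj C B (n + m) s \<bullet>\<^bsub>C\<^esub> ?b) \<bullet>\<^bsub>C\<^esub> v \<oplus>\<^bsub>Hom C W B\<^esub> (pow_prj C B (n + m) s \<bullet>\<^bsub>C\<^esub> ?c) \<bullet>\<^bsub>C\<^esub> w"
    if s: "s < n + m" for s
    using comp_add_right[OF W R B bv cw pow_prj_arr[OF B s]] uvw
      comp_assoc[OF W P R B va b pow_prj_arr[OF B s]] comp_assoc[OF W Q R B wa c pow_prj_arr[OF B s]]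
    by simp
  show thesis
  proof (rule that[OF v w])
    fix r assume r: "r < n"
    have "pow_prj C B n r \<bullet>\<^bsub>C\<^esub> v \<in> arr C W B" using comp_closed[OF W P B va pow_prj_arr[OF B r]] .
    then show "pow_prj C B (n + m) r \<bullet>\<^bsub>C\<^esub> u = pow_prj C B n r \<bullet>\<^bsub>C\<^esub> v"
      using coord[of r] r pow_prj_block_arrow[OF B, of 0 n "n + m" r]
        pow_prj_block_arrow[OF B, of n m "n + m" r] comp_zero_left[OF W Q B wa] by simp
  next
    fix r assume r: "r < m"
    have "pow_prj C B m r \<bullet>\<^bsub>C\<^esub> w \<in> arr C W B" using comp_closed[OF W Q B wa pow_prj_arr[OF B r]] .
    then show "pow_prj C B (n + m) (n + r) \<bullet>\<^bsub>C\<^esub> u = pow_prj C B m r \<bullet>\<^bsub>C\<^esub> w"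
      using coord[of "n + r"] r pow_prj_block_arrow[OF B, of 0 n "n + m" "n + r"]
        pow_prj_block_arrow[OF B, of n m "n + m" "n + r"] comp_zero_left[OF W P B va] by simp
  qed
qed

end

subsection \<open>Lines in the directory of a field\<close>

definition line :: "'a::field vec \<Rightarrow> 'a vec set" where
  "line v = range (\<lambda>c. c \<cdot>\<^sub>v v)"

lemma line_graph_eq: "line_graph \<alpha> = line (vec_of_list [1, \<alpha>])"
proof -
  have "vec_of_list [x, \<alpha> * x] = x \<cdot>\<^sub>v vec_of_list [1, \<alpha>]" for x
    by (intro eq_vecI) (auto simp: vec_of_list_index less_Suc_eq mult.commute)
  then show ?thesis by (auto simp: line_graph_def line_def)
qed

lemma line_smult: "c \<noteq> 0 \<Longrightarrow> line (c \<cdot>\<^sub>v v) = line v"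
proof (intro equalityI subsetI)
  fix x assume "c \<noteq> 0" "x \<in> line v"
  then obtain a where "x = a \<cdot>\<^sub>v v" by (auto simp: line_def)
  then have "x = (a / c) \<cdot>\<^sub>v (c \<cdot>\<^sub>v v)" using \<open>c \<noteq> 0\<close> by (simp add: smult_smult_assoc)
  then show "x \<in> line (c \<cdot>\<^sub>v v)" by (auto simp: line_def)
qed (auto simp: line_def smult_smult_assoc)

lemma mat_image_line:
  "\<lbrakk>g \<in> carrier_mat m n; v \<in> carrier_vec n\<rbrakk> \<Longrightarrow> (\<lambda>x. g *\<^sub>v x) ` line v = line (g *\<^sub>v v)"
  by (auto simp: line_def image_image mult_mat_vec)

lemma subspace_vecI:
  fixes V :: "'a::field vec set"
  assumes "V \<subseteq> carrier_vec n" "0\<^sub>v n \<in> V" "\<And>v w. \<lbrakk>v \<in> V; w \<in> V\<rbrakk> \<Longrightarrow> v + w \<in> V"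
    "\<And>c v. v \<in> V \<Longrightarrow> c \<cdot>\<^sub>v v \<in> V"
  shows "VectorSpace.subspace class_ring V (module_vec TYPE('a) n)"
proof -
  interpret vec_space "TYPE('a)" n .
  show ?thesis using assms
    by unfold_locales (auto simp: module_vec_simps class_ring_simps)
qed

lemma line_subspace:
  fixes v :: "'a::field vec"
  assumes v: "v \<in> carrier_vec n"
  shows "VectorSpace.subspace class_ring (line v) (module_vec TYPE('a) n)"
proof (rule subspace_vecI)
  show "0\<^sub>v n \<in> line v" unfolding line_def by (rule range_eqI[of _ _ 0]) (use v in auto)
  show "x + y \<in> line v" if "x \<in> line v" "y \<in> line v" for x y
    using that v unfolding line_def by (auto simp: add_smult_distrib_vec[symmetric])
  show "c \<cdot>\<^sub>v x \<in> line v" if "x \<in> line v" for c x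
    using that unfolding line_def by (auto simp: smult_smult_assoc)
qed (use v in \<open>auto simp: line_def\<close>)

text \<open>\<open>dim\<close> is the least size of a generating set, so it suffices that
  \<open>v\<close> alone generates the line and that the empty set does so exactly when
  \<open>v\<close> is zero.\<close>

lemma line_dim:
  fixes v :: "'a::field vec"
  assumes v: "v \<in> carrier_vec n"
  shows "subspace_dim n (line v) = (if v = 0\<^sub>v n then 0 else 1)"
proof -
  interpret V: vec_space "TYPE('a)" n .
  interpret L: vectorspace class_ring "V.vs (line v)"
    using V.subspace_is_vs[OF line_subspace[OF v]] .
  have 0: "L.span {} = {0\<^sub>v n}"
    by (auto simp: L.span_def L.lincomb_def module_vec_simps)
  have vl: "v \<in> line v" unfolding line_def by (rule range_eqI[of _ _ 1]) simp
  have 1: "L.span {v} = line v"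
  proof -
    have "L.span {v} = {L.lincomb a {v} | a. a \<in> {v} \<rightarrow> carrier class_ring}"
      using vl by (intro L.finite_span) auto
    moreover have "L.lincomb a {v} = a v \<cdot>\<^sub>v v" for a
    proof -
      \<comment> \<open>The linear combination is formed in the record whose carrier is the line, so
        its only summand has to be shown to lie there.\<close>
      have "a v \<cdot>\<^sub>v v \<in> line v" by (simp add: line_def)
      moreover have "finsum (V.vs (line v)) (\<lambda>w. a w \<odot>\<^bsub>V.vs (line v)\<^esub> w) {v}
          = a v \<odot>\<^bsub>V.vs (line v)\<^esub> v \<oplus>\<^bsub>V.vs (line v)\<^esub> finsum (V.vs (line v)) (\<lambda>w. a w \<odot>\<^bsub>V.vs (line v)\<^esub> w) {}"
        using calculation by (intro L.finsum_insert) (auto simp: module_vec_simps)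
      ultimately show ?thesis using v by (simp add: L.lincomb_def module_vec_simps)
    qed
    ultimately have "L.span {v} = {a v \<cdot>\<^sub>v v | a. True}" by (auto simp: class_ring_simps)
    also have "\<dots> = line v"
      unfolding line_def by (auto intro: exI[of _ "\<lambda>_. c" for c])
    finally show ?thesis .
  qed
  have gen0: "L.gen_set {} \<longleftrightarrow> v = 0\<^sub>v n"
  proof
    assume "L.gen_set {}"
    then show "v = 0\<^sub>v n" using 0 vl by auto
  next
    assume "v = 0\<^sub>v n"
    then have "line v = {0\<^sub>v n}" by (auto simp: line_def)
    then show "L.gen_set {}" using 0 by simp
  qed
  have "L.dim = (if v = 0\<^sub>v n then 0 else 1)"
  proof (cases "v = 0\<^sub>v n")
    case True
    have "L.dim = 0" unfolding L.dim_def
      by (rule Least_eq_0) (use gen0 True in \<open>auto intro!: exI[of _ "{}"]\<close>)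
    then show ?thesis using True by simp
  next
    case False
    have "L.dim = 1" unfolding L.dim_def
    proof (rule Least_equality)
      show "\<exists>A. finite A \<and> card A = 1 \<and> A \<subseteq> carrier (V.vs (line v)) \<and> L.gen_set A"
        using 1 vl by (intro exI[of _ "{v}"]) simp
      show "1 \<le> m" if "\<exists>A. finite A \<and> card A = m \<and> A \<subseteq> carrier (V.vs (line v)) \<and> L.gen_set A" for m
        using that gen0 False by (cases m) auto
    qed
    then show ?thesis using False by simp
  qed
  then show ?thesis by (simp add: subspace_dim_def)
qed

section \<open>Elementary matrices and concatenated vectors\<close>

lemma addrow_mat_mult_vec:
  assumes v: "v \<in> carrier_vec n" and k: "k < n" and l: "l < n"
  shows "addrow_mat n a k l *\<^sub>v v = vec n (\<lambda>i. if i = k then a * v $ l + v $ k else v $ i)"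
proof (rule eq_vecI)
  fix i assume "i < dim_vec (vec n (\<lambda>i. if i = k then a * v $ l + v $ k else v $ i))"
  then have i: "i < n" by simp
  show "(addrow_mat n a k l *\<^sub>v v) $ i = vec n (\<lambda>i. if i = k then a * v $ l + v $ k else v $ i) $ i"
  proof (cases "i = k")
    case True
    have "row (addrow_mat n a k l) k \<bullet> v = (a \<cdot>\<^sub>v unit_vec n l) \<bullet> v + unit_vec n k \<bullet> v"
      unfolding row_addrow(2)[OF k l] using v by (intro add_scalar_prod_distrib) auto
    then show ?thesis using True v k l i by (simp add: smult_scalar_prod_distrib[of _ n])
  next
    case False
    then show ?thesis using row_addrow(1)[of k i n a l] v i by simp
  qed
qed simp

lemma swaprows_mat_mult_vec:
  fixes v :: "'a::field vec"
  assumes v: "v \<in> carrier_vec n" and k: "k < n" and l: "l < n"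
  shows "swaprows_mat n k l *\<^sub>v v = vec n (\<lambda>i. v $ (if i = k then l else if i = l then k else i))"
proof (rule eq_vecI)
  fix i assume "i < dim_vec (vec n (\<lambda>i. v $ (if i = k then l else if i = l then k else i)))"
  then have i: "i < n" by simp
  define j where "j = (if i = k then l else if i = l then k else i)"
  have "row (swaprows_mat n k l) i = (unit_vec n j :: 'a vec)"
    unfolding j_def using row_swaprows[of _ n] k l i by auto
  moreover have "unit_vec n j \<bullet> v = v $ j"
    unfolding j_def using v k l i by (intro scalar_prod_left_unit) auto
  moreover have "vec n (\<lambda>i. v $ (if i = k then l else if i = l then k else i)) $ i = v $ j"
    using i by (simp add: j_def)
  ultimately show "(swaprows_mat n k l *\<^sub>v v) $ i
      = vec n (\<lambda>i. v $ (if i = k then l else if i = l then k else i)) $ i"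
    using i by simp
qed simp

lemma smult_vec_of_list_append:
  "c \<cdot>\<^sub>v vec_of_list (xs @ ys) = (c \<cdot>\<^sub>v vec_of_list xs) @\<^sub>v (c \<cdot>\<^sub>v vec_of_list ys)"
  by (intro eq_vecI) (auto simp: vec_of_list_index nth_append)

text \<open>Enlarging the trailing factor to the whole space keeps the leading line intact. For a
  monotone \<open>\<sigma>\<close> compatible with direct sums, this inclusion stands in for the
  projection to the leading coordinates.\<close>

lemma line_append_left: "line (vec_of_list (xs @ ys)) \<subseteq>
    {v @\<^sub>v w | v w. v \<in> line (vec_of_list xs) \<and> w \<in> carrier_vec (length ys)}"
proof
  fix x assume "x \<in> line (vec_of_list (xs @ ys))"
  then obtain c where "x = (c \<cdot>\<^sub>v vec_of_list xs) @\<^sub>v (c \<cdot>\<^sub>v vec_of_list ys)"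
    unfolding line_def smult_vec_of_list_append by blast
  moreover have "c \<cdot>\<^sub>v vec_of_list xs \<in> line (vec_of_list xs)" by (simp add: line_def)
  moreover have "c \<cdot>\<^sub>v vec_of_list ys \<in> carrier_vec (length ys)" by (rule carrier_vecI) simp
  ultimately show "x \<in> {v @\<^sub>v w | v w. v \<in> line (vec_of_list xs) \<and> w \<in> carrier_vec (length ys)}"
    by blast
qed

lemma line_append_right: "line (vec_of_list (xs @ ys)) \<subseteq>
    {v @\<^sub>v w | v w. v \<in> carrier_vec (length xs) \<and> w \<in> line (vec_of_list ys)}"
proof
  fix x assume "x \<in> line (vec_of_list (xs @ ys))"
  then obtain c where "x = (c \<cdot>\<^sub>v vec_of_list xs) @\<^sub>v (c \<cdot>\<^sub>v vec_of_list ys)"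
    unfolding line_def smult_vec_of_list_append by blast
  moreover have "c \<cdot>\<^sub>v vec_of_list xs \<in> carrier_vec (length xs)" by (rule carrier_vecI) simp
  moreover have "c \<cdot>\<^sub>v vec_of_list ys \<in> line (vec_of_list ys)" by (simp add: line_def)
  ultimately show "x \<in> {v @\<^sub>v w | v w. v \<in> carrier_vec (length xs) \<and> w \<in> line (vec_of_list ys)}"
    by blast
qed

lemma carrier_vec_subspace:
  "VectorSpace.subspace class_ring (carrier_vec n :: 'a::field vec set) (module_vec TYPE('a) n)"
  by (rule subspace_vecI) auto

lemma vec_of_list_closed: "vec_of_list xs \<in> carrier_vec (length xs)"
  by (rule carrier_vecI) simp

lemma line_subset: "v \<in> line w \<Longrightarrow> line v \<subseteq> line w"
  by (auto simp: line_def smult_smult_assoc)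


subsection \<open>Specialization\<close>

text \<open>The base field is \<open>class_ring\<close> with its carrier cut down to
  \<open>K0\<close>: scalars share the type of the large field, and the module laws apply once
  membership in \<open>K0\<close> is known.\<close>

locale field_inflator =
  abelian_linear_category "(class_ring :: 'a::field ring)\<lparr>carrier := K0\<rparr>" C
  for K0 :: "'a::field set" and C :: "('a::field, 'o, 'm) linear_cat" +
  fixes B :: 'o and d :: nat and \<sigma> :: "nat \<Rightarrow> 'a vec set \<Rightarrow> ('o \<times> 'm) set"
  assumes subfield_K0: "subfield K0 (class_ring :: 'a ring)"
    and B: "B \<in> Obj C"
    and inflator: "inflator K0 C B d \<sigma>"
begin

abbreviation Bpow :: "nat \<Rightarrow> 'o" where "Bpow \<equiv> pow_obj C B"
abbreviation proj :: "nat \<Rightarrow> nat \<Rightarrow> 'm" where "proj \<equiv> pow_prj C B"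
abbreviation id_B :: 'm where "id_B \<equiv> Ident C B"
abbreviation zero_B :: 'm where "zero_B \<equiv> \<zero>\<^bsub>Hom C B B\<^esub>"

lemmas pow = pow_obj[OF B]
lemmas proj_arr = pow_prj_arr[OF B]

lemma K0_closed:
  shows "0 \<in> K0" "1 \<in> K0" "\<And>a. a \<in> K0 \<Longrightarrow> - a \<in> K0" "\<And>a b. \<lbrakk>a \<in> K0; b \<in> K0\<rbrakk> \<Longrightarrow> a + b \<in> K0"
proof -
  have K: "subring K0 (class_ring :: 'a ring)"
    using subfieldE(1)[OF subfield_K0] .
  show "0 \<in> K0" "1 \<in> K0" "\<And>a. a \<in> K0 \<Longrightarrow> - a \<in> K0" "\<And>a b. \<lbrakk>a \<in> K0; b \<in> K0\<rbrakk> \<Longrightarrow> a + b \<in> K0"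
    using subringE[OF K] by (simp_all add: class_ring_simps)
qed

lemma scalar_module:
  assumes "X \<in> Obj C" "Y \<in> Obj C" "f \<in> arr C X Y"
  shows "(0::'a) \<odot>\<^bsub>Hom C X Y\<^esub> f = \<zero>\<^bsub>Hom C X Y\<^esub>" "(1::'a) \<odot>\<^bsub>Hom C X Y\<^esub> f = f"
    "\<And>a b. \<lbrakk>a \<in> K0; b \<in> K0\<rbrakk> \<Longrightarrow> (a + b) \<odot>\<^bsub>Hom C X Y\<^esub> f = a \<odot>\<^bsub>Hom C X Y\<^esub> f \<oplus>\<^bsub>Hom C X Y\<^esub> b \<odot>\<^bsub>Hom C X Y\<^esub> f"
    "\<And>a. a \<in> K0 \<Longrightarrow> a \<odot>\<^bsub>Hom C X Y\<^esub> f \<in> arr C X Y"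
proof -
  interpret M: Module.module "(class_ring :: 'a ring)\<lparr>carrier := K0\<rparr>" "Hom C X Y"
    using hom_module assms by blast
  show "(0::'a) \<odot>\<^bsub>Hom C X Y\<^esub> f = \<zero>\<^bsub>Hom C X Y\<^esub>" "(1::'a) \<odot>\<^bsub>Hom C X Y\<^esub> f = f"
    "\<And>a b. \<lbrakk>a \<in> K0; b \<in> K0\<rbrakk> \<Longrightarrow> (a + b) \<odot>\<^bsub>Hom C X Y\<^esub> f = a \<odot>\<^bsub>Hom C X Y\<^esub> f \<oplus>\<^bsub>Hom C X Y\<^esub> b \<odot>\<^bsub>Hom C X Y\<^esub> f"
    "\<And>a. a \<in> K0 \<Longrightarrow> a \<odot>\<^bsub>Hom C X Y\<^esub> f \<in> arr C X Y"
    using M.smult_l_null[OF assms(3)] M.smult_one[OF assms(3)] M.smult_l_distr[OF _ _ assms(3)]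
      M.smult_closed[OF _ assms(3)]
    by (simp_all add: class_ring_simps)
qed

section \<open>The inflator axioms in terms of subspaces\<close>

lemma sigma_Sub:
  "\<lbrakk>1 \<le> n; VectorSpace.subspace class_ring V (module_vec TYPE('a) n)\<rbrakk> \<Longrightarrow> \<sigma> n V \<in> Sub C (Bpow n)"
  using inflator by (simp add: inflator_def dir_morphism_def Dir_field_def Dir_def)

lemma sigma_line_Sub: "\<lbrakk>1 \<le> n; v \<in> carrier_vec n\<rbrakk> \<Longrightarrow> \<sigma> n (line v) \<in> Sub C (Bpow n)"
  by (intro sigma_Sub line_subspace)

lemma sigma_length:
  "\<lbrakk>1 \<le> n; VectorSpace.subspace class_ring V (module_vec TYPE('a) n)\<rbrakk>
    \<Longrightarrow> poset_length {T \<in> Sub C (Bpow n). sub_le C T (\<sigma> n V)} (sub_le C) = enat (d * subspace_dim n V)"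
  using inflator by (simp add: inflator_def dir_length_def Dir_field_def Dir_def)

lemma sigma_morphism: "dir_morphism K0 Dir_field (Dir C B) \<sigma>"
  using inflator by (simp add: inflator_def)

lemma sigma_mono:
  assumes "1 \<le> n" "VectorSpace.subspace class_ring V (module_vec TYPE('a) n)"
    "VectorSpace.subspace class_ring V' (module_vec TYPE('a) n)" "V \<subseteq> V'"
  shows "sub_le C (\<sigma> n V) (\<sigma> n V')"
proof -
  have "\<forall>n\<ge>1. \<forall>x\<in>Sort (Dir_field :: ('a, 'a vec set) directory) n. \<forall>y\<in>Sort Dir_field n.
      Leq Dir_field n x y \<longrightarrow> Leq (Dir C B) n (\<sigma> n x) (\<sigma> n y)"
    using sigma_morphism unfolding dir_morphism_def by (elim conjE)
  then show ?thesis using assms by (simp add: Dir_field_def Dir_def)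
qed

lemma sigma_act:
  assumes "1 \<le> n" "g \<in> GL K0 n" "VectorSpace.subspace class_ring V (module_vec TYPE('a) n)"
  shows "\<sigma> n ((\<lambda>v. g *\<^sub>v v) ` V) = (\<lambda>(X, i). (X, mat_arrow C B n g \<bullet>\<^bsub>C\<^esub> i)) ` \<sigma> n V"
proof -
  have "\<forall>n\<ge>1. \<forall>g\<in>GL K0 n. \<forall>x\<in>Sort Dir_field n.
      \<sigma> n (Act Dir_field n g x) = Act (Dir C B) n g (\<sigma> n x)"
    using sigma_morphism unfolding dir_morphism_def by (elim conjE)
  then show ?thesis using assms by (simp add: Dir_field_def Dir_def)
qed

lemma sigma_Oplus:
  assumes "1 \<le> n" "1 \<le> m" "VectorSpace.subspace class_ring V (module_vec TYPE('a) n)"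
    "VectorSpace.subspace class_ring V' (module_vec TYPE('a) m)"
  shows "\<sigma> (n + m) {v @\<^sub>v w | v w. v \<in> V \<and> w \<in> V'} = sub_oplus C B n m (\<sigma> n V) (\<sigma> m V')"
proof -
  have "\<forall>n\<ge>1. \<forall>m\<ge>1. \<forall>x\<in>Sort Dir_field n. \<forall>y\<in>Sort Dir_field m.
      \<sigma> (n + m) (Oplus Dir_field n m x y) = Oplus (Dir C B) n m (\<sigma> n x) (\<sigma> m y)"
    using sigma_morphism unfolding dir_morphism_def by (elim conjE)
  then show ?thesis using assms by (simp add: Dir_field_def Dir_def)
qed

lemma obj_length_B: "obj_length C B = enat d"
  using inflator by (simp add: inflator_def semisimple_of_length_def)

section \<open>Row operations and direct sums on generalized elements\<close>

lemma gen_elem_act: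
  assumes n: "1 \<le> n" and g: "g \<in> GL K0 n" and v: "v \<in> carrier_vec n" and W: "W \<in> Obj C"
    and u: "gen_elem W u (\<sigma> n (line v))"
  shows "gen_elem W (mat_arrow C B n g \<bullet>\<^bsub>C\<^esub> u) (\<sigma> n (line (g *\<^sub>v v)))"
proof -
  have gc: "g \<in> carrier_mat n n" and "elements_mat g \<subseteq> K0" using g by (auto simp: GL_def)
  then have gK: "g $$ (r, s) \<in> K0" if "r < n" "s < n" for r s
    using that elements_matI[OF gc that refl] by auto
  have gM: "mat_arrow C B n g \<in> arr C (Bpow n) (Bpow n)"
    using gK by (intro mat_arrow_closed[OF B]) simp
  \<comment> \<open>The action composes every representative with \<open>mat_arrow\<close>, so a
    lift \<open>h\<close> of \<open>u\<close> also lifts the transformed arrow through the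
    transformed representative.\<close>
  have "\<sigma> n (line (g *\<^sub>v v)) = (\<lambda>(X, i). (X, mat_arrow C B n g \<bullet>\<^bsub>C\<^esub> i)) ` \<sigma> n (line v)"
    using sigma_act[OF n g line_subspace[OF v]] mat_image_line[OF gc v] by simp
  moreover obtain X i h where x: "(X, i) \<in> \<sigma> n (line v)" and h: "h \<in> arr C W X" "i \<bullet>\<^bsub>C\<^esub> h = u"
    using u unfolding gen_elem_def by blast
  moreover have "(mat_arrow C B n g \<bullet>\<^bsub>C\<^esub> i) \<bullet>\<^bsub>C\<^esub> h = mat_arrow C B n g \<bullet>\<^bsub>C\<^esub> u"
    using comp_assoc[OF W Sub_member(1)[OF pow sigma_line_Sub[OF n v] x] pow pow h(1)
        Sub_member(3)[OF pow sigma_line_Sub[OF n v] x] gM] h(2) by simp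
  ultimately show ?thesis unfolding gen_elem_def by force
qed

lemma finsum_delta_smult:
  fixes n :: nat
  assumes W: "W \<in> Obj C" and t: "t < n" and c: "c \<in> K0" and v: "\<And>s. s < n \<Longrightarrow> v s \<in> arr C W B"
  shows "finsum (Hom C W B) (\<lambda>s. (if s = t then c else 0) \<odot>\<^bsub>Hom C W B\<^esub> v s) {..<n} = c \<odot>\<^bsub>Hom C W B\<^esub> v t"
proof -
  interpret WB: abelian_group "Hom C W B" using hom_abelian_group[OF W B] .
  have cv: "c \<odot>\<^bsub>Hom C W B\<^esub> v s \<in> arr C W B" if "s < n" for s
    using scalar_module(4)[OF W B v c] that by simp
  have "finsum (Hom C W B) (\<lambda>s. (if s = t then c else 0) \<odot>\<^bsub>Hom C W B\<^esub> v s) {..<n}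
      = finsum (Hom C W B) (\<lambda>s. if t = s then c \<odot>\<^bsub>Hom C W B\<^esub> v s else \<zero>\<^bsub>Hom C W B\<^esub>) {..<n}"
    using cv scalar_module(1)[OF W B v] by (intro WB.finsum_cong') auto
  also have "\<dots> = c \<odot>\<^bsub>Hom C W B\<^esub> v t" 
    using WB.finsum_singleton[of t "{..<n}" "\<lambda>s. c \<odot>\<^bsub>Hom C W B\<^esub> v s"] t cv by auto
  finally show ?thesis .
qed

text \<open>The shear is invertible over \<open>K0\<close>, its inverse being the shear by
  \<open>- a\<close>; this is where \<open>a \<in> K0\<close> and \<open>k \<noteq> l\<close> enter.
  Asserting only the coordinates of some \<open>u'\<close> hides the matrix arrow from later
  proofs.\<close>

lemma gen_elem_addrow:
  assumes v: "v \<in> carrier_vec n" and k: "k < n" and l: "l < n" and kl: "k \<noteq> l" and a: "a \<in> K0"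
    and W: "W \<in> Obj C" and u: "gen_elem W u (\<sigma> n (line v))"
  shows "\<exists>u'. gen_elem W u' (\<sigma> n (line (vec n (\<lambda>i. if i = k then a * v $ l + v $ k else v $ i)))) \<and>
    (\<forall>r<n. proj n r \<bullet>\<^bsub>C\<^esub> u'
      = (if r = k then a \<odot>\<^bsub>Hom C W B\<^esub> (proj n l \<bullet>\<^bsub>C\<^esub> u) \<oplus>\<^bsub>Hom C W B\<^esub> proj n k \<bullet>\<^bsub>C\<^esub> u else proj n r \<bullet>\<^bsub>C\<^esub> u))"
proof -
  let ?g = "addrow_mat n a k l"
  have n: "1 \<le> n" using k by simp
  have elem: "elements_mat (addrow_mat n b k l) \<subseteq> K0" if "b \<in> K0" for b
    using that kl K0_closed by (auto simp: elements_mat_def)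
  have g: "?g \<in> GL K0 n"
    unfolding GL_def using elem[OF a] elem[OF K0_closed(3)[OF a]]
      addrow_mat_inv[OF k l kl, of a] addrow_mat_inv[OF k l kl, of "- a"]
    by (auto simp: inverts_mat_def intro!: bexI[of _ "addrow_mat n (- a) k l"])
  have gK: "?g $$ (r, s) \<in> carrier ((class_ring :: 'a ring)\<lparr>carrier := K0\<rparr>)" if "r < n" "s < n" for r s
    using that kl K0_closed a by auto
  have ua: "u \<in> arr C W (Bpow n)" using gen_elem_arr[OF pow sigma_line_Sub[OF n v] W u] .
  have pu: "proj n s \<bullet>\<^bsub>C\<^esub> u \<in> arr C W B" if "s < n" for s
    using comp_closed[OF W pow B ua proj_arr[OF that]] .
  interpret WB: abelian_group "Hom C W B" using hom_abelian_group[OF W B] .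
  have "proj n r \<bullet>\<^bsub>C\<^esub> (mat_arrow C B n ?g \<bullet>\<^bsub>C\<^esub> u)
      = (if r = k then a \<odot>\<^bsub>Hom C W B\<^esub> (proj n l \<bullet>\<^bsub>C\<^esub> u) \<oplus>\<^bsub>Hom C W B\<^esub> proj n k \<bullet>\<^bsub>C\<^esub> u else proj n r \<bullet>\<^bsub>C\<^esub> u)"
    if r: "r < n" for r
  proof -
    have "proj n r \<bullet>\<^bsub>C\<^esub> (mat_arrow C B n ?g \<bullet>\<^bsub>C\<^esub> u)
        = finsum (Hom C W B) (\<lambda>s. ?g $$ (r, s) \<odot>\<^bsub>Hom C W B\<^esub> (proj n s \<bullet>\<^bsub>C\<^esub> u)) {..<n}"
      by (rule pow_prj_mat_arrow[OF B gK W ua r])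
    also have "\<dots> = (if r = k then a \<odot>\<^bsub>Hom C W B\<^esub> (proj n l \<bullet>\<^bsub>C\<^esub> u) \<oplus>\<^bsub>Hom C W B\<^esub> proj n k \<bullet>\<^bsub>C\<^esub> u
        else proj n r \<bullet>\<^bsub>C\<^esub> u)"
    proof (cases "r = k")
      case True
      let ?c = "\<lambda>t c s. (if s = t then c else 0) \<odot>\<^bsub>Hom C W B\<^esub> (proj n s \<bullet>\<^bsub>C\<^esub> u)"
      have c: "?c t c s \<in> arr C W B" if "s < n" "c \<in> K0" for t c s
        using scalar_module(4)[OF W B pu] that K0_closed(1) by simp
      have "finsum (Hom C W B) (\<lambda>s. ?g $$ (r, s) \<odot>\<^bsub>Hom C W B\<^esub> (proj n s \<bullet>\<^bsub>C\<^esub> u)) {..<n}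
          = finsum (Hom C W B) (\<lambda>s. ?c l a s \<oplus>\<^bsub>Hom C W B\<^esub> ?c k 1 s) {..<n}"
      proof (rule WB.finsum_cong')
        show "(\<lambda>s. ?c l a s \<oplus>\<^bsub>Hom C W B\<^esub> ?c k 1 s) \<in> {..<n} \<rightarrow> arr C W B"
          using c a K0_closed(2) by auto
        fix s assume s: "s \<in> {..<n}"
        \<comment> \<open>Row \<open>k\<close> is \<open>a\<close> times one delta row plus another
          delta row, so the coordinate splits into two sums with one surviving term each.\<close>
        have "?g $$ (r, s) = (if s = l then a else 0) + (if s = k then 1 else 0)"
          using True r s by auto
        moreover have "(if s = l then a else 0) \<in> K0" "(if s = k then 1 else 0) \<in> K0"
          using a K0_closed(1,2) by simp_all
        ultimately show "?g $$ (r, s) \<odot>\<^bsub>Hom C W B\<^esub> (proj n s \<bullet>\<^bsub>C\<^esub> u) = ?c l a s \<oplus>\<^bsub>Hom C W B\<^esub> ?c k 1 s"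
          using scalar_module(3)[OF W B pu] s by simp
      qed simp
      also have "\<dots> = finsum (Hom C W B) (?c l a) {..<n} \<oplus>\<^bsub>Hom C W B\<^esub> finsum (Hom C W B) (?c k 1) {..<n}"
        using c a K0_closed(2) by (intro WB.finsum_addf) auto
      also have "\<dots> = a \<odot>\<^bsub>Hom C W B\<^esub> (proj n l \<bullet>\<^bsub>C\<^esub> u) \<oplus>\<^bsub>Hom C W B\<^esub> proj n k \<bullet>\<^bsub>C\<^esub> u"
        using finsum_delta_smult[OF W l a pu] finsum_delta_smult[OF W k K0_closed(2) pu]
          scalar_module(2)[OF W B pu[OF k]] by simp
      finally show ?thesis using True by simp
    next
      case False
      have "finsum (Hom C W B) (\<lambda>s. ?g $$ (r, s) \<odot>\<^bsub>Hom C W B\<^esub> (proj n s \<bullet>\<^bsub>C\<^esub> u)) {..<n}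
          = finsum (Hom C W B) (\<lambda>s. (if s = r then 1 else 0) \<odot>\<^bsub>Hom C W B\<^esub> (proj n s \<bullet>\<^bsub>C\<^esub> u)) {..<n}"
        using False r scalar_module(4)[OF W B pu] K0_closed by (intro WB.finsum_cong') auto
      then show ?thesis
        using False finsum_delta_smult[OF W r K0_closed(2) pu] scalar_module(2)[OF W B pu[OF r]] by simp
    qed
    finally show ?thesis .
  qed
  moreover have "gen_elem W (mat_arrow C B n ?g \<bullet>\<^bsub>C\<^esub> u)
      (\<sigma> n (line (vec n (\<lambda>i. if i = k then a * v $ l + v $ k else v $ i))))"
    using gen_elem_act[OF n g v W u] addrow_mat_mult_vec[OF v k l] by simp
  ultimately show ?thesis by blast
qed

text \<open>A transposition is its own inverse and has entries 0 and 1, so it lies in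
  \<open>GL K0 n\<close> whatever the base field.\<close>

lemma gen_elem_swaprows:
  assumes v: "v \<in> carrier_vec n" and k: "k < n" and l: "l < n" and kl: "k \<noteq> l"
    and W: "W \<in> Obj C" and u: "gen_elem W u (\<sigma> n (line v))"
  shows "\<exists>u'.
    gen_elem W u' (\<sigma> n (line (vec n (\<lambda>i. v $ (if i = k then l else if i = l then k else i))))) \<and>
    (\<forall>r<n. proj n r \<bullet>\<^bsub>C\<^esub> u' = proj n (if r = k then l else if r = l then k else r) \<bullet>\<^bsub>C\<^esub> u)"
proof -
  let ?g = "swaprows_mat n k l :: 'a mat" and ?t = "\<lambda>r. if r = k then l else if r = l then k else r"
  have n: "1 \<le> n" using k by simp
  have "elements_mat ?g \<subseteq> K0" using K0_closed by (auto simp: elements_mat_def)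
  then have g: "?g \<in> GL K0 n"
    unfolding GL_def using swaprows_mat_inv[OF k l]
    by (auto simp: inverts_mat_def intro!: bexI[of _ ?g])
  have gK: "?g $$ (r, s) \<in> carrier ((class_ring :: 'a ring)\<lparr>carrier := K0\<rparr>)" if "r < n" "s < n" for r s
    using that K0_closed by auto
  have ua: "u \<in> arr C W (Bpow n)" using gen_elem_arr[OF pow sigma_line_Sub[OF n v] W u] .
  have pu: "proj n s \<bullet>\<^bsub>C\<^esub> u \<in> arr C W B" if "s < n" for s
    using comp_closed[OF W pow B ua proj_arr[OF that]] .
  interpret WB: abelian_group "Hom C W B" using hom_abelian_group[OF W B] .
  have "proj n r \<bullet>\<^bsub>C\<^esub> (mat_arrow C B n ?g \<bullet>\<^bsub>C\<^esub> u) = proj n (?t r) \<bullet>\<^bsub>C\<^esub> u" if r: "r < n" for r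
  proof -
    have tr: "?t r < n" using k l r by simp
    have "proj n r \<bullet>\<^bsub>C\<^esub> (mat_arrow C B n ?g \<bullet>\<^bsub>C\<^esub> u)
        = finsum (Hom C W B) (\<lambda>s. ?g $$ (r, s) \<odot>\<^bsub>Hom C W B\<^esub> (proj n s \<bullet>\<^bsub>C\<^esub> u)) {..<n}"
      by (rule pow_prj_mat_arrow[OF B gK W ua r])
    also have "\<dots> = finsum (Hom C W B) (\<lambda>s. (if s = ?t r then 1 else 0) \<odot>\<^bsub>Hom C W B\<^esub> (proj n s \<bullet>\<^bsub>C\<^esub> u)) {..<n}"
      using r kl scalar_module(4)[OF W B pu] K0_closed by (intro WB.finsum_cong') auto
    also have "\<dots> = proj n (?t r) \<bullet>\<^bsub>C\<^esub> u"
      using finsum_delta_smult[OF W tr K0_closed(2) pu] scalar_module(2)[OF W B pu[OF tr]] by simp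
    finally show ?thesis .
  qed
  moreover have "gen_elem W (mat_arrow C B n ?g \<bullet>\<^bsub>C\<^esub> u) (\<sigma> n (line (vec n (\<lambda>i. v $ ?t i))))"
    using gen_elem_act[OF n g v W u] swaprows_mat_mult_vec[OF v k l] by simp
  ultimately show ?thesis by blast
qed

text \<open>Monotonicity places the image of \<open>U\<close> below the image of the direct sum of
  \<open>V\<close> and \<open>V'\<close>, which is the direct sum of their images. Upper bounds on
  images of lines come from here.\<close>

lemma gen_elem_sigma_append:
  assumes "1 \<le> n" "1 \<le> m"
    and V: "VectorSpace.subspace class_ring V (module_vec TYPE('a) n)"
    and V': "VectorSpace.subspace class_ring V' (module_vec TYPE('a) m)"
    and U: "VectorSpace.subspace class_ring U (module_vec TYPE('a) (n + m))"
    and le: "U \<subseteq> {v @\<^sub>v w | v w. v \<in> V \<and> w \<in> V'}"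
    and W: "W \<in> Obj C" and u: "gen_elem W u (\<sigma> (n + m) U)"
  shows "\<exists>v w. gen_elem W v (\<sigma> n V) \<and> gen_elem W w (\<sigma> m V') \<and>
    (\<forall>r<n. proj (n + m) r \<bullet>\<^bsub>C\<^esub> u = proj n r \<bullet>\<^bsub>C\<^esub> v) \<and>
    (\<forall>r<m. proj (n + m) (n + r) \<bullet>\<^bsub>C\<^esub> u = proj m r \<bullet>\<^bsub>C\<^esub> w)"
proof -
  let ?O = "{v @\<^sub>v w | v w. v \<in> V \<and> w \<in> V'}"
  have Vc: "V \<subseteq> carrier_vec n" "V' \<subseteq> carrier_vec m"
    using submodule.subset[OF subspace.submod[OF V]] submodule.subset[OF subspace.submod[OF V']]
    by (simp_all add: module_vec_simps)
  have Vs: "0\<^sub>v n \<in> V" "\<And>x y. x \<in> V \<Longrightarrow> y \<in> V \<Longrightarrow> x + y \<in> V" "\<And>c x. x \<in> V \<Longrightarrow> c \<cdot>\<^sub>v x \<in> V"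
    using submodule.zero_closed[OF subspace.submod[OF V]] submodule.m_closed[OF subspace.submod[OF V]]
      submodule.smult_closed[OF subspace.submod[OF V]]
    by (simp_all add: module_vec_simps class_ring_simps)
  have Vs': "0\<^sub>v m \<in> V'" "\<And>x y. x \<in> V' \<Longrightarrow> y \<in> V' \<Longrightarrow> x + y \<in> V'" "\<And>c x. x \<in> V' \<Longrightarrow> c \<cdot>\<^sub>v x \<in> V'"
    using submodule.zero_closed[OF subspace.submod[OF V']] submodule.m_closed[OF subspace.submod[OF V']]
      submodule.smult_closed[OF subspace.submod[OF V']]
    by (simp_all add: module_vec_simps class_ring_simps)
  \<comment> \<open>The axioms for \<open>\<sigma>\<close> speak about members of a sort, so the set
    of concatenations must first be recognized as a subspace.\<close>
  have O: "VectorSpace.subspace class_ring ?O (module_vec TYPE('a) (n + m))"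
  proof (rule subspace_vecI)
    show "?O \<subseteq> carrier_vec (n + m)" using Vc by auto
    have "0\<^sub>v (n + m) = (0\<^sub>v n :: 'a vec) @\<^sub>v 0\<^sub>v m" by (intro eq_vecI) auto
    then show "0\<^sub>v (n + m) \<in> ?O" using Vs(1) Vs'(1) by blast
  next
    fix x y assume "x \<in> ?O" "y \<in> ?O"
    then obtain a b a' b' where x: "x = a @\<^sub>v b" "a \<in> V" "b \<in> V'" and y: "y = a' @\<^sub>v b'" "a' \<in> V" "b' \<in> V'"
      by blast
    have "x + y = (a + a') @\<^sub>v (b + b')"
      unfolding x(1) y(1) by (rule append_vec_add[of _ n _ _ m]) (use x y Vc in blast)+
    then show "x + y \<in> ?O" using Vs(2) Vs'(2) x y by blast
  next
    fix c x assume "x \<in> ?O"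
    then obtain a b where x: "x = a @\<^sub>v b" "a \<in> V" "b \<in> V'" by blast
    then have "c \<cdot>\<^sub>v x = (c \<cdot>\<^sub>v a) @\<^sub>v (c \<cdot>\<^sub>v b)" by (intro eq_vecI) auto
    then show "c \<cdot>\<^sub>v x \<in> ?O" using Vs(3) Vs'(3) x by blast
  qed
  have "sub_le C (\<sigma> (n + m) U) (\<sigma> (n + m) ?O)"
    using sigma_mono[OF _ U O le] assms(1) by simp
  moreover have "\<sigma> (n + m) ?O = sub_oplus C B n m (\<sigma> n V) (\<sigma> m V')"
    by (rule sigma_Oplus[OF assms(1,2) V V'])
  moreover have "gen_elem W u (\<sigma> (n + m) ?O)"
    using gen_elem_mono[OF pow sigma_Sub[OF _ U] sigma_Sub[OF _ O] W calculation(1) u] assms(1) by simp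
  ultimately have "gen_elem W u (sub_oplus C B n m (\<sigma> n V) (\<sigma> m V'))" by simp
  then show ?thesis
    by (rule gen_elem_sub_oplus[OF B sigma_Sub[OF assms(1) V] sigma_Sub[OF assms(2) V'] W]) blast
qed

lemma gen_elem_left:
  assumes ne: "xs \<noteq> []" "ys \<noteq> []" and W: "W \<in> Obj C"
    and u: "gen_elem W u (\<sigma> (length xs + length ys) (line (vec_of_list (xs @ ys))))"
  shows "\<exists>v. gen_elem W v (\<sigma> (length xs) (line (vec_of_list xs))) \<and>
    (\<forall>r<length xs. proj (length xs + length ys) r \<bullet>\<^bsub>C\<^esub> u = proj (length xs) r \<bullet>\<^bsub>C\<^esub> v)"
proof -
  have l: "1 \<le> length xs" "1 \<le> length ys" using ne by (simp_all add: Suc_leI)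
  have c: "vec_of_list (xs @ ys) \<in> carrier_vec (length xs + length ys)"
    using vec_of_list_closed[of "xs @ ys"] by simp
  show ?thesis
    using gen_elem_sigma_append[OF l line_subspace[OF vec_of_list_closed] carrier_vec_subspace
        line_subspace[OF c] line_append_left W u] by blast
qed

text \<open>The tail \<open>ys\<close> only has to lie on the line of \<open>v\<close>. This permits
  a normalized \<open>v\<close> even when \<open>ys\<close> is not normalized or is zero, and also
  the choice of the zero vector for \<open>v\<close>.\<close>

lemma gen_elem_right:
  assumes ne: "xs \<noteq> []" "ys \<noteq> []" and W: "W \<in> Obj C"
    and v: "v \<in> carrier_vec (length ys)" "vec_of_list ys \<in> line v"
    and u: "gen_elem W u (\<sigma> (length xs + length ys) (line (vec_of_list (xs @ ys))))"
  shows "\<exists>w. gen_elem W w (\<sigma> (length ys) (line v)) \<and>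
    (\<forall>r<length ys. proj (length xs + length ys) (length xs + r) \<bullet>\<^bsub>C\<^esub> u = proj (length ys) r \<bullet>\<^bsub>C\<^esub> w)"
proof -
  have l: "1 \<le> length xs" "1 \<le> length ys" using ne by (simp_all add: Suc_leI)
  have c: "vec_of_list (xs @ ys) \<in> carrier_vec (length xs + length ys)"
    using vec_of_list_closed[of "xs @ ys"] by simp
  have sub: "line (vec_of_list (xs @ ys)) \<subseteq>
      {a @\<^sub>v b | a b. a \<in> carrier_vec (length xs) \<and> b \<in> line v}"
    using line_append_right[of xs ys] line_subset[OF v(2)] by blast
  show ?thesis
    using gen_elem_sigma_append[OF l carrier_vec_subspace line_subspace[OF v(1)]
        line_subspace[OF c] sub W u] by blast
qed

section \<open>Lines whose image is a graph\<close>

lemma tuple_is_mono: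
  assumes n: "0 < n" and f: "\<And>r. r < n \<Longrightarrow> f r \<in> arr C B B" and f0: "f 0 = id_B"
  shows "is_mono C B (Bpow n) (tuple B B n f)"
proof (rule is_mono_of_comp[OF B pow B tuple_arr[OF B B f] proj_arr[OF n]])
  \<comment> \<open>Since coordinate 0 is the identity, \<open>proj n 0\<close> is a retraction of
    the tuple.\<close>
  show "is_mono C B B (proj n 0 \<bullet>\<^bsub>C\<^esub> tuple B B n f)"
    using pow_prj_tuple[OF B B f n] f0 ident_is_mono[OF B] by simp
qed

lemma sigma_line_length:
  assumes "0 < n" "v \<in> carrier_vec n" "v \<noteq> 0\<^sub>v n"
  shows "poset_length {T \<in> Sub C (Bpow n). sub_le C T (\<sigma> n (line v))} (sub_le C) = enat d"
  using sigma_length[OF _ line_subspace[OF assms(2)]] line_dim[OF assms(2)] assms by simp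

text \<open>From lower bound to equality: the subobject given by \<open>t\<close> is a copy of
  \<open>B\<close> and has length \<open>d\<close>, and so has the image of a line.\<close>

lemma sigma_line_eq_of_gen_elem:
  assumes n: "0 < n" and v: "v \<in> carrier_vec n" "v \<noteq> 0\<^sub>v n"
    and t: "is_mono C B (Bpow n) t" and mem: "gen_elem B t (\<sigma> n (line v))"
  shows "\<sigma> n (line v) = mono_rel C (Bpow n) `` {(B, t)}"
proof -
  have S: "\<sigma> n (line v) \<in> Sub C (Bpow n)" using n by (intro sigma_line_Sub v(1)) simp
  note T = Sub_class[OF B t] and t' = self_in_class[OF pow B t]
  have "sub_le C (mono_rel C (Bpow n) `` {(B, t)}) (\<sigma> n (line v))"
    using sub_le_iff_gen_elem[OF pow T S t'] mem by blast
  then show ?thesis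
    using sub_eq_if_length_le[OF pow T S, of d] poset_length_below[OF pow B t] obj_length_B
      sigma_line_length[OF n v] by simp
qed

text \<open>From upper bound to equality: \<open>coord\<close> says that every generalized element
  is determined by its first coordinate through \<open>f\<close>, which puts the image of the line
  inside the graph of \<open>f\<close>. Both have length \<open>d\<close>.\<close>

lemma sigma_line_eq_tuple:
  assumes n: "0 < n" and v: "v \<in> carrier_vec n" "v \<noteq> 0\<^sub>v n"
    and f: "\<And>r. r < n \<Longrightarrow> f r \<in> arr C B B" and f0: "f 0 = id_B"
    and coord: "\<And>W u r. \<lbrakk>W \<in> Obj C; gen_elem W u (\<sigma> n (line v)); r < n\<rbrakk>
      \<Longrightarrow> proj n r \<bullet>\<^bsub>C\<^esub> u = f r \<bullet>\<^bsub>C\<^esub> (proj n 0 \<bullet>\<^bsub>C\<^esub> u)"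
  shows "\<sigma> n (line v) = mono_rel C (Bpow n) `` {(B, tuple B B n f)}"
proof -
  let ?t = "tuple B B n f"
  have S: "\<sigma> n (line v) \<in> Sub C (Bpow n)" using n by (intro sigma_line_Sub v(1)) simp
  have t: "is_mono C B (Bpow n) ?t" using n f f0 by (rule tuple_is_mono)
  note T = Sub_class[OF B t]
  obtain X i where x: "(X, i) \<in> \<sigma> n (line v)" using Sub_member_exists[OF pow S] by blast
  note X = Sub_member[OF pow S x]
  have p: "proj n 0 \<bullet>\<^bsub>C\<^esub> i \<in> arr C X B" using comp_closed[OF X(1) pow B X(3) proj_arr[OF n]] .
  \<comment> \<open>The lift of \<open>i\<close> through the tuple is forced: it is the first
    coordinate of \<open>i\<close>.\<close>
  have "?t \<bullet>\<^bsub>C\<^esub> (proj n 0 \<bullet>\<^bsub>C\<^esub> i) = i"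
  proof (rule pow_ext[OF B X(1) comp_closed[OF X(1) B pow p is_mono_arr[OF t]] X(3)])
    fix r assume r: "r < n"
    have "proj n r \<bullet>\<^bsub>C\<^esub> (?t \<bullet>\<^bsub>C\<^esub> (proj n 0 \<bullet>\<^bsub>C\<^esub> i)) = f r \<bullet>\<^bsub>C\<^esub> (proj n 0 \<bullet>\<^bsub>C\<^esub> i)"
      using comp_assoc[OF X(1) B pow B p is_mono_arr[OF t] proj_arr[OF r]] pow_prj_tuple[OF B B f r]
      by simp
    also have "\<dots> = proj n r \<bullet>\<^bsub>C\<^esub> i"
      using coord[OF X(1) gen_elem_member[OF pow S x] r] by simp
    finally show "proj n r \<bullet>\<^bsub>C\<^esub> (?t \<bullet>\<^bsub>C\<^esub> (proj n 0 \<bullet>\<^bsub>C\<^esub> i)) = proj n r \<bullet>\<^bsub>C\<^esub> i" .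
  qed
  then have "gen_elem X i (mono_rel C (Bpow n) `` {(B, ?t)})"
    using gen_elem_class[OF pow B t X(1)] p by blast
  then have "sub_le C (\<sigma> n (line v)) (mono_rel C (Bpow n) `` {(B, ?t)})"
    using sub_le_iff_gen_elem[OF pow S T x] by blast
  then show ?thesis
    using sub_eq_if_length_le[OF pow S T, of d] poset_length_below[OF pow B t] obj_length_B
      sigma_line_length[OF n v] by simp
qed

text \<open>The equality obtained from an upper bound is read backwards: the tuple itself belongs to
  the image of the line, and can then be moved by row operations and cut down to fewer
  coordinates.\<close>

lemma gen_elem_tuple:
  assumes "0 < n" "v \<in> carrier_vec n" "v \<noteq> 0\<^sub>v n" "\<And>r. r < n \<Longrightarrow> f r \<in> arr C B B" "f 0 = id_B"
    "\<And>W u r. \<lbrakk>W \<in> Obj C; gen_elem W u (\<sigma> n (line v)); r < n\<rbrakk>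
      \<Longrightarrow> proj n r \<bullet>\<^bsub>C\<^esub> u = f r \<bullet>\<^bsub>C\<^esub> (proj n 0 \<bullet>\<^bsub>C\<^esub> u)"
  shows "gen_elem B (tuple B B n f) (\<sigma> n (line v))"
proof -
  have "is_mono C B (Bpow n) (tuple B B n f)" using assms(1,4,5) by (rule tuple_is_mono)
  moreover have "\<sigma> n (line v) = mono_rel C (Bpow n) `` {(B, tuple B B n f)}"
    using assms by (rule sigma_line_eq_tuple)
  ultimately show ?thesis
    using gen_elem_member[OF pow Sub_class[OF B] self_in_class[OF pow B]] by simp
qed

definition graph :: "'m \<Rightarrow> 'm" where
  "graph \<phi> = tuple B B 2 (\<lambda>r. if r = 0 then id_B else \<phi>)"

lemma
  assumes "\<phi> \<in> arr C B B"
  shows graph_is_mono: "is_mono C B (Bpow 2) (graph \<phi>)"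
    and proj_graph_0: "proj 2 0 \<bullet>\<^bsub>C\<^esub> graph \<phi> = id_B"
    and proj_graph_1: "proj 2 1 \<bullet>\<^bsub>C\<^esub> graph \<phi> = \<phi>"
  unfolding graph_def
  by (rule tuple_is_mono; use assms ident_closed[OF B] in simp)
    (subst pow_prj_tuple[OF B B]; use assms ident_closed[OF B] in simp)+

lemma graph_unique:
  assumes "u \<in> arr C B (Bpow 2)" "\<phi> \<in> arr C B B"
    "proj 2 0 \<bullet>\<^bsub>C\<^esub> u = id_B" "proj 2 1 \<bullet>\<^bsub>C\<^esub> u = \<phi>"
  shows "u = graph \<phi>"
  by (rule pow_ext[OF B B assms(1) is_mono_arr[OF graph_is_mono[OF assms(2)]]])
    (use assms proj_graph_0[OF assms(2)] proj_graph_1[OF assms(2)] in \<open>auto simp: less_2_cases_iff\<close>)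

lemma arrow_graph_eq:
  assumes \<phi>: "\<phi> \<in> arr C B B"
  shows "arrow_graph C B \<phi> = mono_rel C (Bpow 2) `` {(B, graph \<phi>)}"
proof -
  let ?i = "pow_inj C B 2"
  interpret BP: abelian_group "Hom C B (Bpow 2)" using hom_abelian_group[OF B pow] .
  have i: "?i 0 \<bullet>\<^bsub>C\<^esub> id_B \<in> arr C B (Bpow 2)" "?i 1 \<bullet>\<^bsub>C\<^esub> \<phi> \<in> arr C B (Bpow 2)"
    using comp_closed[OF B B pow ident_closed[OF B] pow_inj_arr[OF B]]
      comp_closed[OF B B pow \<phi> pow_inj_arr[OF B]] by simp_all
  have "graph \<phi> = (?i 0 \<bullet>\<^bsub>C\<^esub> id_B) \<oplus>\<^bsub>Hom C B (Bpow 2)\<^esub> (?i 1 \<bullet>\<^bsub>C\<^esub> \<phi>)"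
  proof -
    have "{..<2::nat} = insert 0 {1}" by auto
    then show ?thesis unfolding graph_def tuple_def using i by simp
  qed
  then show ?thesis
    using image_sub_of_mono[OF B pow graph_is_mono[OF \<phi>]] by (simp add: arrow_graph_def)
qed

section \<open>Calculus of specializations\<close>

abbreviation spec :: "'a \<Rightarrow> 'm \<Rightarrow> bool" where
  "spec \<equiv> specializes C B \<sigma>"

lemma unit_line:
  "vec_of_list [1, \<alpha>] \<in> carrier_vec 2" "vec_of_list [1, \<alpha>] \<noteq> (0\<^sub>v 2 :: 'a vec)"
  "vec_of_list [1, \<alpha>, \<beta>] \<in> carrier_vec 3" "vec_of_list [1, \<alpha>, \<beta>] \<noteq> (0\<^sub>v 3 :: 'a vec)"
proof -
  show "vec_of_list [1, \<alpha>] \<in> carrier_vec 2" "vec_of_list [1, \<alpha>, \<beta>] \<in> carrier_vec 3"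
    by (rule carrier_vecI, simp)+
  have "vec_of_list [1, \<alpha>] $ 0 = 1" "vec_of_list [1, \<alpha>, \<beta>] $ 0 = 1"
    by (simp_all add: vec_of_list_index)
  then show "vec_of_list [1, \<alpha>] \<noteq> (0\<^sub>v 2 :: 'a vec)" "vec_of_list [1, \<alpha>, \<beta>] \<noteq> (0\<^sub>v 3 :: 'a vec)"
    by (metis index_zero_vec(1) zero_less_numeral zero_neq_one)+
qed

lemma spec_arr: "spec \<alpha> \<phi> \<Longrightarrow> \<phi> \<in> arr C B B"
  by (simp add: specializes_def)

text \<open>One arrow is a sufficient witness: its coordinates force it to be the graph map, and a
  copy of \<open>B\<close> inside the image of a line fills it by length. The constructions of
  specializations below end with this criterion.\<close>

lemma specI:
  assumes u: "gen_elem B u (\<sigma> 2 (line (vec_of_list [1, \<alpha>])))" and \<phi>: "\<phi> \<in> arr C B B"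
    and "proj 2 0 \<bullet>\<^bsub>C\<^esub> u = id_B" "proj 2 1 \<bullet>\<^bsub>C\<^esub> u = \<phi>"
  shows "spec \<alpha> \<phi>"
proof -
  have "u \<in> arr C B (Bpow 2)"
    using gen_elem_arr[OF pow sigma_line_Sub B u] unit_line(1) by simp
  then have "u = graph \<phi>" using assms graph_unique by blast
  then show ?thesis
    using sigma_line_eq_of_gen_elem[OF _ unit_line(1,2) graph_is_mono[OF \<phi>]] u \<phi>
    by (simp add: specializes_def line_graph_eq arrow_graph_eq)
qed

lemma gen_elem_graph: "spec \<alpha> \<phi> \<Longrightarrow> gen_elem B (graph \<phi>) (\<sigma> 2 (line (vec_of_list [1, \<alpha>])))"
  using gen_elem_member[OF pow Sub_class[OF B] self_in_class[OF pow B]] graph_is_mono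
  by (simp add: specializes_def line_graph_eq arrow_graph_eq)

text \<open>An arrow into the graph is \<open>graph \<phi>\<close> after some \<open>h\<close>, and
  its first coordinate recovers \<open>h\<close>.\<close>

lemma spec_coord:
  assumes sp: "spec \<alpha> \<phi>" and W: "W \<in> Obj C"
    and u: "gen_elem W u (\<sigma> 2 (line (vec_of_list [1, \<alpha>])))"
  shows "proj 2 1 \<bullet>\<^bsub>C\<^esub> u = \<phi> \<bullet>\<^bsub>C\<^esub> (proj 2 0 \<bullet>\<^bsub>C\<^esub> u)"
proof -
  note \<phi> = spec_arr[OF sp]
  have "gen_elem W u (mono_rel C (Bpow 2) `` {(B, graph \<phi>)})"
    using sp u by (simp add: specializes_def line_graph_eq arrow_graph_eq)
  then obtain h where h: "h \<in> arr C W B" "graph \<phi> \<bullet>\<^bsub>C\<^esub> h = u"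
    using gen_elem_class[OF pow B graph_is_mono[OF \<phi>] W] by blast
  have "proj 2 0 \<bullet>\<^bsub>C\<^esub> u = h" "proj 2 1 \<bullet>\<^bsub>C\<^esub> u = \<phi> \<bullet>\<^bsub>C\<^esub> h"
    using comp_assoc[OF W B pow B h(1) is_mono_arr[OF graph_is_mono[OF \<phi>]] proj_arr, of 0]
      comp_assoc[OF W B pow B h(1) is_mono_arr[OF graph_is_mono[OF \<phi>]] proj_arr, of 1]
      proj_graph_0[OF \<phi>] proj_graph_1[OF \<phi>] h ident_left[OF W B h(1)] by simp_all
  then show ?thesis by simp
qed

text \<open>The graph map of \<open>\<psi>\<close> lies in the image of the same line, so its
  coordinates obey the equation for \<open>\<phi>\<close>; its first coordinate is the
  identity.\<close>

lemma spec_unique: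
  assumes "spec \<alpha> \<phi>" "spec \<alpha> \<psi>"
  shows "\<phi> = \<psi>"
  using spec_coord[OF assms(1) B gen_elem_graph[OF assms(2)]]
    proj_graph_0[OF spec_arr[OF assms(2)]] proj_graph_1[OF spec_arr[OF assms(2)]]
    ident_right[OF B B spec_arr[OF assms(1)]] by simp

lemma gen_elem_first_two:
  assumes W: "W \<in> Obj C" and u: "gen_elem W u (\<sigma> 3 (line (vec_of_list [1, \<alpha>, \<beta>])))"
  shows "\<exists>v. gen_elem W v (\<sigma> 2 (line (vec_of_list [1, \<alpha>]))) \<and>
    proj 3 0 \<bullet>\<^bsub>C\<^esub> u = proj 2 0 \<bullet>\<^bsub>C\<^esub> v \<and> proj 3 1 \<bullet>\<^bsub>C\<^esub> u = proj 2 1 \<bullet>\<^bsub>C\<^esub> v"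
proof -
  have l: "length [1, \<alpha>] = 2" "length [1, \<alpha>] + length [\<beta>] = 3" by simp_all
  have "gen_elem W u (\<sigma> (length [1, \<alpha>] + length [\<beta>]) (line (vec_of_list ([1, \<alpha>] @ [\<beta>]))))"
    using u unfolding l by simp
  from gen_elem_left[OF _ _ W this]
  obtain v where "gen_elem W v (\<sigma> 2 (line (vec_of_list [1, \<alpha>])))"
    "\<forall>r<2. proj 3 r \<bullet>\<^bsub>C\<^esub> u = proj 2 r \<bullet>\<^bsub>C\<^esub> v"
    unfolding l by auto
  then show ?thesis by (intro exI[of _ v]) simp
qed

lemma spec_coord_first_two:
  assumes sp: "spec \<alpha> \<phi>" and W: "W \<in> Obj C"
    and u: "gen_elem W u (\<sigma> 3 (line (vec_of_list [1, \<alpha>, \<beta>])))"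
  shows "proj 3 1 \<bullet>\<^bsub>C\<^esub> u = \<phi> \<bullet>\<^bsub>C\<^esub> (proj 3 0 \<bullet>\<^bsub>C\<^esub> u)"
proof -
  obtain v where "gen_elem W v (\<sigma> 2 (line (vec_of_list [1, \<alpha>])))"
    "proj 3 0 \<bullet>\<^bsub>C\<^esub> u = proj 2 0 \<bullet>\<^bsub>C\<^esub> v" "proj 3 1 \<bullet>\<^bsub>C\<^esub> u = proj 2 1 \<bullet>\<^bsub>C\<^esub> v"
    using gen_elem_first_two[OF W u] by blast
  then show ?thesis using spec_coord[OF sp W] by simp
qed

text \<open>\<open>gen_elem_first_two\<close> keeps the leading coordinates, so an entry in the last
  place has to be brought to the middle before it can be used.\<close>

lemma gen_elem_swap:
  assumes W: "W \<in> Obj C" and u: "gen_elem W u (\<sigma> 3 (line (vec_of_list [1, \<alpha>, \<beta>])))"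
  shows "\<exists>v. gen_elem W v (\<sigma> 3 (line (vec_of_list [1, \<beta>, \<alpha>]))) \<and>
    proj 3 0 \<bullet>\<^bsub>C\<^esub> v = proj 3 0 \<bullet>\<^bsub>C\<^esub> u \<and> proj 3 1 \<bullet>\<^bsub>C\<^esub> v = proj 3 2 \<bullet>\<^bsub>C\<^esub> u"
proof -
  have e: "vec 3 (\<lambda>i. vec_of_list [1, \<alpha>, \<beta>] $ (if i = 1 then 2 else if i = 2 then 1 else i))
      = vec_of_list [1, \<beta>, \<alpha>]"
    by (intro eq_vecI) (auto simp: vec_of_list_index less_Suc_eq numeral_2_eq_2)
  have "\<exists>v. gen_elem W v (\<sigma> 3 (line (vec_of_list [1, \<beta>, \<alpha>]))) \<and>
    (\<forall>r<3. proj 3 r \<bullet>\<^bsub>C\<^esub> v = proj 3 (if r = 1 then 2 else if r = 2 then 1 else r) \<bullet>\<^bsub>C\<^esub> u)"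
    unfolding e[symmetric] by (rule gen_elem_swaprows[OF unit_line(3) _ _ _ W u]) simp_all
  then obtain v where "gen_elem W v (\<sigma> 3 (line (vec_of_list [1, \<beta>, \<alpha>])))"
    and c: "\<forall>r<3. proj 3 r \<bullet>\<^bsub>C\<^esub> v = proj 3 (if r = 1 then 2 else if r = 2 then 1 else r) \<bullet>\<^bsub>C\<^esub> u"
    by blast
  then show ?thesis using c[rule_format, of 0] c[rule_format, of 1] by (intro exI[of _ v]) simp
qed

text \<open>The head (1, \<beta>) makes coordinate 1 the image of coordinate 0 under
  \<open>\<psi>\<close>, and the tail (\<beta>, \<alpha> \<beta>) makes coordinate 2 the image of
  coordinate 1 under \<open>\<phi>\<close>. Hence coordinate 2 is the composite applied to
  coordinate 0.\<close>

lemma spec_mult: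
  assumes \<alpha>: "spec \<alpha> \<phi>" and \<beta>: "spec \<beta> \<psi>"
  shows "spec (\<alpha> * \<beta>) (\<phi> \<bullet>\<^bsub>C\<^esub> \<psi>)"
proof -
  let ?v = "vec_of_list [1, \<beta>, \<alpha> * \<beta>]"
  let ?f = "\<lambda>r::nat. if r = 0 then id_B else if r = 1 then \<psi> else \<phi> \<bullet>\<^bsub>C\<^esub> \<psi>"
  note a = spec_arr[OF \<alpha>] spec_arr[OF \<beta>] ident_closed[OF B]
  have ab: "\<phi> \<bullet>\<^bsub>C\<^esub> \<psi> \<in> arr C B B" using comp_closed[OF B B B a(2,1)] .
  have f: "?f r \<in> arr C B B" for r using a ab by simp
  have t: "gen_elem B (tuple B B 3 ?f) (\<sigma> 3 (line ?v))"
  proof (rule gen_elem_tuple[OF _ unit_line(3,4) f])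
    fix W u r assume W: "W \<in> Obj C" and u: "gen_elem W u (\<sigma> 3 (line ?v))" and r: "r < (3::nat)"
    have ua: "u \<in> arr C W (Bpow 3)" using gen_elem_arr[OF pow sigma_line_Sub W u] unit_line(3) by simp
    have p0: "proj 3 0 \<bullet>\<^bsub>C\<^esub> u \<in> arr C W B" using comp_closed[OF W pow B ua proj_arr] by simp
    have 1: "proj 3 1 \<bullet>\<^bsub>C\<^esub> u = \<psi> \<bullet>\<^bsub>C\<^esub> (proj 3 0 \<bullet>\<^bsub>C\<^esub> u)"
      by (rule spec_coord_first_two[OF \<beta> W u])
    have l: "length [\<beta>, \<alpha> * \<beta>] = 2" "length [1::'a] = 1" "1 + 2 = (3::nat)"
      by simp_all
    \<comment> \<open>Containment in the line of (1, \<alpha>) is enough and also covers \<beta> =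
      0, where the tail is the zero vector.\<close>
    have "vec_of_list [\<beta>, \<alpha> * \<beta>] = \<beta> \<cdot>\<^sub>v vec_of_list [1, \<alpha>]"
      by (intro eq_vecI) (auto simp: vec_of_list_index less_Suc_eq mult.commute)
    then have m: "vec_of_list [\<beta>, \<alpha> * \<beta>] \<in> line (vec_of_list [1, \<alpha>])" by (simp add: line_def)
    have "gen_elem W u (\<sigma> (length [1::'a] + length [\<beta>, \<alpha> * \<beta>]) (line (vec_of_list ([1] @ [\<beta>, \<alpha> * \<beta>]))))"
      using u unfolding l by simp
    from gen_elem_right[OF _ _ W _ m this]
    obtain w where w: "gen_elem W w (\<sigma> 2 (line (vec_of_list [1, \<alpha>])))"
      and c: "\<forall>r<2. proj 3 (1 + r) \<bullet>\<^bsub>C\<^esub> u = proj 2 r \<bullet>\<^bsub>C\<^esub> w"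
      using unit_line(1) unfolding l by blast
    have "proj 3 1 \<bullet>\<^bsub>C\<^esub> u = proj 2 0 \<bullet>\<^bsub>C\<^esub> w" "proj 3 2 \<bullet>\<^bsub>C\<^esub> u = proj 2 1 \<bullet>\<^bsub>C\<^esub> w"
      using c[rule_format, of 0] c[rule_format, of 1] by (simp_all add: numeral_2_eq_2)
    then have "proj 3 2 \<bullet>\<^bsub>C\<^esub> u = \<phi> \<bullet>\<^bsub>C\<^esub> (proj 3 1 \<bullet>\<^bsub>C\<^esub> u)"
      using spec_coord[OF \<alpha> W w] by simp
    then have "proj 3 2 \<bullet>\<^bsub>C\<^esub> u = (\<phi> \<bullet>\<^bsub>C\<^esub> \<psi>) \<bullet>\<^bsub>C\<^esub> (proj 3 0 \<bullet>\<^bsub>C\<^esub> u)"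
      using 1 comp_assoc[OF W B B B p0 a(2,1)] by simp
    moreover have "r = 0 \<or> r = 1 \<or> r = 2" using r by auto
    ultimately show "proj 3 r \<bullet>\<^bsub>C\<^esub> u = ?f r \<bullet>\<^bsub>C\<^esub> (proj 3 0 \<bullet>\<^bsub>C\<^esub> u)"
      using 1 ident_left[OF W B p0] by auto
  qed simp_all
  obtain u where u: "gen_elem B u (\<sigma> 3 (line (vec_of_list [1, \<alpha> * \<beta>, \<beta>])))"
    "proj 3 0 \<bullet>\<^bsub>C\<^esub> u = id_B" "proj 3 1 \<bullet>\<^bsub>C\<^esub> u = \<phi> \<bullet>\<^bsub>C\<^esub> \<psi>"
  proof -
    have "proj 3 0 \<bullet>\<^bsub>C\<^esub> tuple B B 3 ?f = id_B" "proj 3 2 \<bullet>\<^bsub>C\<^esub> tuple B B 3 ?f = \<phi> \<bullet>\<^bsub>C\<^esub> \<psi>"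
      by (subst pow_prj_tuple[OF B B f]; simp)+
    then show thesis using gen_elem_swap[OF B t] that by auto
  qed
  obtain v where "gen_elem B v (\<sigma> 2 (line (vec_of_list [1, \<alpha> * \<beta>])))"
    "proj 2 0 \<bullet>\<^bsub>C\<^esub> v = id_B" "proj 2 1 \<bullet>\<^bsub>C\<^esub> v = \<phi> \<bullet>\<^bsub>C\<^esub> \<psi>"
    using gen_elem_first_two[OF B u(1)] u(2,3) by auto
  then show ?thesis by (intro specI[OF _ ab])
qed

lemma spec_add:
  assumes \<alpha>: "spec \<alpha> \<phi>" and \<beta>: "spec \<beta> \<psi>"
  shows "spec (\<alpha> + \<beta>) (\<phi> \<oplus>\<^bsub>Hom C B B\<^esub> \<psi>)"
proof -
  let ?v = "vec_of_list [1, \<beta>, \<alpha>]"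
  let ?f = "\<lambda>r::nat. if r = 0 then id_B else if r = 1 then \<psi> else \<phi>"
  note a = spec_arr[OF \<alpha>] spec_arr[OF \<beta>] ident_closed[OF B]
  have f: "?f r \<in> arr C B B" for r using a by simp
  have t: "gen_elem B (tuple B B 3 ?f) (\<sigma> 3 (line ?v))"
  proof (rule gen_elem_tuple[OF _ unit_line(3,4) f])
    fix W u r assume W: "W \<in> Obj C" and u: "gen_elem W u (\<sigma> 3 (line ?v))" and r: "r < (3::nat)"
    have ua: "u \<in> arr C W (Bpow 3)" using gen_elem_arr[OF pow sigma_line_Sub W u] unit_line(3) by simp
    have p0: "proj 3 0 \<bullet>\<^bsub>C\<^esub> u \<in> arr C W B" using comp_closed[OF W pow B ua proj_arr] by simp
    have 1: "proj 3 1 \<bullet>\<^bsub>C\<^esub> u = \<psi> \<bullet>\<^bsub>C\<^esub> (proj 3 0 \<bullet>\<^bsub>C\<^esub> u)"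
      by (rule spec_coord_first_two[OF \<beta> W u])
    have 2: "proj 3 2 \<bullet>\<^bsub>C\<^esub> u = \<phi> \<bullet>\<^bsub>C\<^esub> (proj 3 0 \<bullet>\<^bsub>C\<^esub> u)"
    proof -
      obtain v where "gen_elem W v (\<sigma> 3 (line (vec_of_list [1, \<alpha>, \<beta>])))"
        "proj 3 0 \<bullet>\<^bsub>C\<^esub> v = proj 3 0 \<bullet>\<^bsub>C\<^esub> u" "proj 3 1 \<bullet>\<^bsub>C\<^esub> v = proj 3 2 \<bullet>\<^bsub>C\<^esub> u"
        using gen_elem_swap[OF W u] by blast
      then show ?thesis using spec_coord_first_two[OF \<alpha> W] by simp
    qed
    have "r = 0 \<or> r = 1 \<or> r = 2" using r by auto
    then show "proj 3 r \<bullet>\<^bsub>C\<^esub> u = ?f r \<bullet>\<^bsub>C\<^esub> (proj 3 0 \<bullet>\<^bsub>C\<^esub> u)"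
      using 1 2 ident_left[OF W B p0] by auto
  qed simp_all
  \<comment> \<open>The shear has coefficient 1, an element of \<open>K0\<close>; \<alpha> enters
    through the vector only and may lie outside \<open>K0\<close>. The remaining entry \<alpha> is
    dropped by the projection.\<close>
  have e: "vec 3 (\<lambda>i. if i = 1 then 1 * ?v $ 2 + ?v $ 1 else ?v $ i) = vec_of_list [1, \<alpha> + \<beta>, \<alpha>]"
    by (intro eq_vecI) (auto simp: vec_of_list_index less_Suc_eq numeral_2_eq_2)
  have p: "proj 3 r \<bullet>\<^bsub>C\<^esub> tuple B B 3 ?f = ?f r" if "r < 3" for r
    using pow_prj_tuple[OF B B f that] .
  have "\<exists>u. gen_elem B u (\<sigma> 3 (line (vec_of_list [1, \<alpha> + \<beta>, \<alpha>]))) \<and>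
      (\<forall>r<3. proj 3 r \<bullet>\<^bsub>C\<^esub> u = (if r = 1
        then (1::'a) \<odot>\<^bsub>Hom C B B\<^esub> (proj 3 2 \<bullet>\<^bsub>C\<^esub> tuple B B 3 ?f) \<oplus>\<^bsub>Hom C B B\<^esub> proj 3 1 \<bullet>\<^bsub>C\<^esub> tuple B B 3 ?f
        else proj 3 r \<bullet>\<^bsub>C\<^esub> tuple B B 3 ?f))"
    unfolding e[symmetric] by (rule gen_elem_addrow[OF unit_line(3) _ _ _ K0_closed(2) B t]) simp_all
  then obtain u where u: "gen_elem B u (\<sigma> 3 (line (vec_of_list [1, \<alpha> + \<beta>, \<alpha>])))"
    and c: "\<forall>r<3. proj 3 r \<bullet>\<^bsub>C\<^esub> u = (if r = 1
      then (1::'a) \<odot>\<^bsub>Hom C B B\<^esub> (proj 3 2 \<bullet>\<^bsub>C\<^esub> tuple B B 3 ?f) \<oplus>\<^bsub>Hom C B B\<^esub> proj 3 1 \<bullet>\<^bsub>C\<^esub> tuple B B 3 ?f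
      else proj 3 r \<bullet>\<^bsub>C\<^esub> tuple B B 3 ?f)"
    by blast
  have "proj 3 0 \<bullet>\<^bsub>C\<^esub> u = id_B" "proj 3 1 \<bullet>\<^bsub>C\<^esub> u = \<phi> \<oplus>\<^bsub>Hom C B B\<^esub> \<psi>"
    using c[rule_format, of 0] c[rule_format, of 1] p[of 0] p[of 1] p[of 2]
      scalar_module(2)[OF B B a(1)] by simp_all
  then obtain v where "gen_elem B v (\<sigma> 2 (line (vec_of_list [1, \<alpha> + \<beta>])))"
    "proj 2 0 \<bullet>\<^bsub>C\<^esub> v = id_B" "proj 2 1 \<bullet>\<^bsub>C\<^esub> v = \<phi> \<oplus>\<^bsub>Hom C B B\<^esub> \<psi>"
    using gen_elem_first_two[OF B u] by auto
  then show ?thesis by (intro specI[OF _ add_arr[OF B B a(1,2)]])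
qed

text \<open>The last entry of (1, 0) lies on the line of the zero vector, whose image has length 0.
  So the second coordinate of every generalized element vanishes, and the length comparison yields
  the graph of the zero endomorphism.\<close>

lemma spec_zero: "spec 0 zero_B"
proof -
  let ?v = "vec_of_list [1, 0 :: 'a]"
  let ?f = "\<lambda>r::nat. if r = 0 then id_B else zero_B"
  have f: "?f r \<in> arr C B B" for r using ident_closed[OF B] zero_arr[OF B B] by simp
  have "gen_elem B (tuple B B 2 ?f) (\<sigma> 2 (line ?v))"
  proof (rule gen_elem_tuple[OF _ unit_line(1,2) f])
    fix W u r assume W: "W \<in> Obj C" and u: "gen_elem W u (\<sigma> 2 (line ?v))" and r: "r < (2::nat)"
    have ua: "u \<in> arr C W (Bpow 2)" using gen_elem_arr[OF pow sigma_line_Sub W u] unit_line(1) by simp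
    have p0: "proj 2 0 \<bullet>\<^bsub>C\<^esub> u \<in> arr C W B" using comp_closed[OF W pow B ua proj_arr] by simp
    have l: "length [0::'a] = 1" "length [1::'a] = 1" "1 + 1 = (2::nat)"
      by simp_all
    have "vec_of_list [0] = 0 \<cdot>\<^sub>v (0\<^sub>v 1 :: 'a vec)"
      by (intro eq_vecI) (auto simp: vec_of_list_index)
    then have m: "vec_of_list [0] \<in> line (0\<^sub>v 1 :: 'a vec)" by (simp add: line_def)
    have "gen_elem W u (\<sigma> (length [1::'a] + length [0::'a]) (line (vec_of_list ([1] @ [0]))))"
      using u unfolding l by simp
    from gen_elem_right[OF _ _ W _ m this]
    obtain w where w: "gen_elem W w (\<sigma> 1 (line (0\<^sub>v 1)))"
      and c: "\<forall>r<1. proj 2 (1 + r) \<bullet>\<^bsub>C\<^esub> u = proj 1 r \<bullet>\<^bsub>C\<^esub> w"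
      using zero_carrier_vec unfolding l by blast
    \<comment> \<open>The length is \<open>d * 0\<close>, because \<open>line_dim\<close> assigns
      dimension 0 to the line of the zero vector.\<close>
    have l0: "poset_length {T \<in> Sub C (Bpow 1). sub_le C T (\<sigma> 1 (line (0\<^sub>v 1)))} (sub_le C) = 0"
      using sigma_length[OF _ line_subspace[of "0\<^sub>v 1" 1]] line_dim[of "0\<^sub>v 1 :: 'a vec" 1]
      by (simp add: zero_enat_def)
    have "w = \<zero>\<^bsub>Hom C W (Bpow 1)\<^esub>"
      by (rule gen_elem_zero_of_length_zero[OF pow sigma_line_Sub W w l0]) simp_all
    then have "proj 2 1 \<bullet>\<^bsub>C\<^esub> u = \<zero>\<^bsub>Hom C W B\<^esub>"
      using c[rule_format, of 0] comp_zero_right[OF W pow B proj_arr, of 0 1] by simp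
    then show "proj 2 r \<bullet>\<^bsub>C\<^esub> u = ?f r \<bullet>\<^bsub>C\<^esub> (proj 2 0 \<bullet>\<^bsub>C\<^esub> u)"
      using r ident_left[OF W B p0] comp_zero_left[OF W B B p0] by (auto simp: less_2_cases_iff)
  qed simp_all
  then show ?thesis
    by (rule specI; (subst pow_prj_tuple[OF B B f])?; use zero_arr[OF B B] in simp)
qed

lemma spec_scalar:
  assumes a: "a \<in> K0"
  shows "spec a (a \<odot>\<^bsub>Hom C B B\<^esub> id_B)"
proof -
  let ?v = "vec_of_list [1, 0 :: 'a]"
  note g = gen_elem_graph[OF spec_zero] and z = zero_arr[OF B B]
  interpret BB: abelian_group "Hom C B B" using hom_abelian_group[OF B B] .
  have ai: "a \<odot>\<^bsub>Hom C B B\<^esub> id_B \<in> arr C B B"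
    using scalar_module(4)[OF B B ident_closed[OF B] a] .
  have e: "vec 2 (\<lambda>i. if i = 1 then a * ?v $ 0 + ?v $ 1 else ?v $ i) = vec_of_list [1, a]"
    by (intro eq_vecI) (auto simp: vec_of_list_index less_Suc_eq)
  have "\<exists>u. gen_elem B u (\<sigma> 2 (line (vec_of_list [1, a]))) \<and>
      (\<forall>r<2. proj 2 r \<bullet>\<^bsub>C\<^esub> u = (if r = 1
        then a \<odot>\<^bsub>Hom C B B\<^esub> (proj 2 0 \<bullet>\<^bsub>C\<^esub> graph zero_B) \<oplus>\<^bsub>Hom C B B\<^esub> proj 2 1 \<bullet>\<^bsub>C\<^esub> graph zero_B
        else proj 2 r \<bullet>\<^bsub>C\<^esub> graph zero_B))"
    unfolding e[symmetric] by (rule gen_elem_addrow[OF unit_line(1) _ _ _ a B g]) simp_all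
  then obtain u where u: "gen_elem B u (\<sigma> 2 (line (vec_of_list [1, a])))"
    and c: "\<forall>r<2. proj 2 r \<bullet>\<^bsub>C\<^esub> u = (if r = 1
      then a \<odot>\<^bsub>Hom C B B\<^esub> (proj 2 0 \<bullet>\<^bsub>C\<^esub> graph zero_B) \<oplus>\<^bsub>Hom C B B\<^esub> proj 2 1 \<bullet>\<^bsub>C\<^esub> graph zero_B
      else proj 2 r \<bullet>\<^bsub>C\<^esub> graph zero_B)"
    by blast
  have "proj 2 0 \<bullet>\<^bsub>C\<^esub> u = id_B" "proj 2 1 \<bullet>\<^bsub>C\<^esub> u = a \<odot>\<^bsub>Hom C B B\<^esub> id_B"
    using c[rule_format, of 0] c[rule_format, of 1] proj_graph_0[OF z] proj_graph_1[OF z] ai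
    by simp_all
  then show ?thesis by (rule specI[OF u ai])
qed

lemma spec_one: "spec 1 id_B"
  using spec_scalar[OF K0_closed(2)] scalar_module(2)[OF B B ident_closed[OF B]] by simp

lemma spec_inverse_of_id:
  assumes \<alpha>: "spec \<alpha> id_B" and nz: "\<alpha> \<noteq> 0"
  shows "spec (inverse \<alpha>) id_B"
proof -
  let ?v = "vec_of_list [1, \<alpha>]"
  note g = gen_elem_graph[OF \<alpha>] and i = ident_closed[OF B]
  \<comment> \<open>Swapping gives (\<alpha>, 1). Factoring out the nonzero \<alpha> restores the
    leading 1 and leaves the line unchanged.\<close>
  have "vec 2 (\<lambda>k. ?v $ (if k = 0 then 1 else if k = 1 then 0 else k)) = \<alpha> \<cdot>\<^sub>v vec_of_list [1, inverse \<alpha>]"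
    using nz by (intro eq_vecI) (auto simp: vec_of_list_index less_Suc_eq)
  then have e: "line (vec 2 (\<lambda>k. ?v $ (if k = 0 then 1 else if k = 1 then 0 else k)))
      = line (vec_of_list [1, inverse \<alpha>])"
    using line_smult[OF nz] by simp
  have "\<exists>u. gen_elem B u (\<sigma> 2 (line (vec_of_list [1, inverse \<alpha>]))) \<and>
      (\<forall>r<2. proj 2 r \<bullet>\<^bsub>C\<^esub> u = proj 2 (if r = 0 then 1 else if r = 1 then 0 else r) \<bullet>\<^bsub>C\<^esub> graph id_B)"
    unfolding e[symmetric] by (rule gen_elem_swaprows[OF unit_line(1) _ _ _ B g]) simp_all
  then obtain u where u: "gen_elem B u (\<sigma> 2 (line (vec_of_list [1, inverse \<alpha>])))"
    and c: "\<forall>r<2. proj 2 r \<bullet>\<^bsub>C\<^esub> u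
      = proj 2 (if r = 0 then 1 else if r = 1 then 0 else r) \<bullet>\<^bsub>C\<^esub> graph id_B"
    by blast
  have "proj 2 0 \<bullet>\<^bsub>C\<^esub> u = id_B" "proj 2 1 \<bullet>\<^bsub>C\<^esub> u = id_B"
    using c[rule_format, of 0] c[rule_format, of 1] proj_graph_0[OF i] proj_graph_1[OF i]
    by simp_all
  then show ?thesis by (rule specI[OF u i])
qed

text \<open>If the identity were zero, every monomorphism into \<open>B\<close> would be zero, all
  subobjects would coincide, and the length of \<open>B\<close> would be 0.\<close>

lemma id_neq_zero:
  assumes d: "0 < d"
  shows "id_B \<noteq> zero_B"
proof
  assume iz: "id_B = zero_B"
  have eq: "S = T" if S: "S \<in> Sub C B" and T: "T \<in> Sub C B" for S T
  proof -
    have le: "sub_le C S T" if S: "S \<in> Sub C B" and T: "T \<in> Sub C B" for S T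
    proof -
      obtain X i where x: "(X, i) \<in> S" using Sub_member_exists[OF B S] by blast
      obtain Y j where y: "(Y, j) \<in> T" using Sub_member_exists[OF B T] by blast
      note X = Sub_member[OF B S x] and Y = Sub_member[OF B T y]
      have "i = \<zero>\<^bsub>Hom C X B\<^esub>"
        using ident_left[OF X(1) B X(3)] comp_zero_left[OF X(1) B B X(3)] iz by simp
      then have "j \<bullet>\<^bsub>C\<^esub> \<zero>\<^bsub>Hom C X Y\<^esub> = i" using comp_zero_right[OF X(1) Y(1) B Y(3)] by simp
      then have "gen_elem X i T" using gen_elem_iff[OF B T y X(1)] zero_arr[OF X(1) Y(1)] by blast
      then show ?thesis using sub_le_iff_gen_elem[OF B S T x] by blast
    qed
    show ?thesis using sub_le_antisym[OF B S T le[OF S T] le[OF T S]] .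
  qed
  have "obj_length C B \<le> 0"
    unfolding obj_length_def poset_length_def
  proof (rule SUP_least, clarsimp)
    fix F assume F: "F \<subseteq> Sub C B" "finite F"
    then have "card F \<le> 1" using eq by (auto simp: card_le_Suc0_iff_eq)
    then show "enat (card F - Suc 0) = 0" by (simp add: zero_enat_def)
  qed
  then show False using obj_length_B d by (simp add: zero_enat_def)
qed

section \<open>The ring of specializing elements and its residue map\<close>

abbreviation R :: "'a set" where "R \<equiv> spec_ring C B \<sigma>"
abbreviation R_ring :: "'a ring" where "R_ring \<equiv> (class_ring :: 'a ring)\<lparr>carrier := R\<rparr>"
abbreviation res :: "'a \<Rightarrow> 'm" where "res \<equiv> res_hat C B \<sigma>"

lemma res_eq: "spec x \<phi> \<Longrightarrow> res x = \<phi>"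
  unfolding res_hat_def using spec_unique by (intro the_equality)

lemma spec_ringI: "spec x \<phi> \<Longrightarrow> x \<in> R"
  by (auto simp: spec_ring_def)

lemma spec_res: "x \<in> R \<Longrightarrow> spec x (res x)"
  using res_eq by (auto simp: spec_ring_def)

lemma res_add: "\<lbrakk>x \<in> R; y \<in> R\<rbrakk> \<Longrightarrow> x + y \<in> R \<and> res (x + y) = res x \<oplus>\<^bsub>Hom C B B\<^esub> res y"
  using spec_add[OF spec_res spec_res] spec_ringI res_eq by blast

lemma res_mult: "\<lbrakk>x \<in> R; y \<in> R\<rbrakk> \<Longrightarrow> x * y \<in> R \<and> res (x * y) = res x \<bullet>\<^bsub>C\<^esub> res y"
  using spec_mult[OF spec_res spec_res] spec_ringI res_eq by blast

text \<open>Scaling by \<open>a\<close> is multiplication by an element that specializes to a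
  multiple of the identity, so no further argument with lines is required.\<close>

lemma res_scalar:
  assumes "a \<in> K0" "x \<in> R"
  shows "a * x \<in> R \<and> res (a * x) = a \<odot>\<^bsub>Hom C B B\<^esub> res x"
proof -
  have r: "res x \<in> arr C B B" using spec_arr[OF spec_res[OF assms(2)]] .
  have "a * x \<in> R" "res (a * x) = (a \<odot>\<^bsub>Hom C B B\<^esub> id_B) \<bullet>\<^bsub>C\<^esub> res x"
    using spec_mult[OF spec_scalar[OF assms(1)] spec_res[OF assms(2)]] spec_ringI res_eq by blast+
  then show ?thesis
    using comp_smult_left[OF B B B _ r ident_closed[OF B], of a] ident_left[OF B B r] assms(1) by simp
qed

lemma R_subring: "subring R (class_ring :: 'a ring)"
proof (rule ring.subringI)
  show "ring (class_ring :: 'a ring)" using class_field by (rule field.is_ring)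
  show "\<one>\<^bsub>class_ring\<^esub> \<in> R" using spec_ringI[OF spec_one] by (simp add: class_ring_simps)
  \<comment> \<open>Negation is scaling by -1, an element of \<open>K0\<close>.\<close>
  show "\<ominus>\<^bsub>class_ring\<^esub> h \<in> R" if "h \<in> R" for h
    using res_scalar[OF K0_closed(3)[OF K0_closed(2)] that] by (simp add: class_ring_simps)
qed (use res_mult res_add in \<open>auto simp: class_ring_simps\<close>)

lemma R_cring: "cring R_ring"
proof -
  interpret ring R_ring
    by (rule ring.subring_is_ring[OF field.is_ring[OF class_field] R_subring])
  show ?thesis by unfold_locales (simp add: class_ring_simps mult.commute)
qed

lemma End_alg_ring: "ring (End_alg C B)"
proof -
  interpret BB: abelian_group "Hom C B B" using hom_abelian_group[OF B B] .
  \<comment> \<open>\<open>End_alg\<close> overwrites only the fields \<open>mult\<close> and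
    \<open>one\<close>, so the additive group of \<open>Hom C B B\<close> is kept verbatim.\<close>
  have "add_monoid (End_alg C B) = add_monoid (Hom C B B)" by (simp add: End_alg_def)
  then have "abelian_group (End_alg C B)"
    using BB.a_comm_group BB.a_comm_monoid
    by (simp add: abelian_group_def abelian_group_axioms_def abelian_monoid_def)
  moreover have "monoid (End_alg C B)"
    using comp_closed[OF B B B] comp_assoc[OF B B B B] ident_closed[OF B] ident_left[OF B B]
      ident_right[OF B B]
    by (intro monoidI) (auto simp: End_alg_def)
  ultimately show ?thesis
    using comp_add_left[OF B B B] comp_add_right[OF B B B]
    by (intro ringI) (auto simp: End_alg_def)
qed

lemma res_hom: "res \<in> Ring.ring_hom R_ring (End_alg C B)"
  using spec_arr[OF spec_res] res_add res_mult res_eq[OF spec_one]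
  by (intro ring_hom_memI) (auto simp: End_alg_def class_ring_simps)

lemma spec_ideal_eq_kernel: "spec_ideal C B \<sigma> = a_kernel R_ring (End_alg C B) res"
proof -
  have "x \<in> spec_ideal C B \<sigma> \<longleftrightarrow> x \<in> R \<and> res x = zero_B" for x
  proof
    assume "x \<in> spec_ideal C B \<sigma>"
    then have s: "spec x zero_B" by (simp add: spec_ideal_def)
    show "x \<in> R \<and> res x = zero_B" using spec_ringI[OF s] res_eq[OF s] by simp
  next
    assume "x \<in> R \<and> res x = zero_B"
    then show "x \<in> spec_ideal C B \<sigma>" using spec_res[of x] by (simp add: spec_ideal_def)
  qed
  then show ?thesis
    by (auto simp: a_kernel_def kernel_def End_alg_def)
qed

lemma spec_ideal_ideal: "ideal (spec_ideal C B \<sigma>) R_ring"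
proof -
  interpret ring_hom_ring R_ring "End_alg C B" res
    by (rule ring_hom_ringI2[OF cring.axioms(1)[OF R_cring] End_alg_ring res_hom])
  show ?thesis unfolding spec_ideal_eq_kernel by (rule kernel_is_ideal)
qed

section \<open>The Jacobson radical\<close>

lemma one_plus_ideal_unit:
  assumes d: "0 < d" and x: "x \<in> spec_ideal C B \<sigma>"
  shows "inverse (1 + x) \<in> R \<and> 1 + x \<noteq> 0"
proof -
  interpret BB: abelian_group "Hom C B B" using hom_abelian_group[OF B B] .
  have "spec x zero_B" using x by (simp add: spec_ideal_def)
  from spec_add[OF spec_one this] have s: "spec (1 + x) id_B"
    using ident_closed[OF B] by simp
  \<comment> \<open>If \<open>1 + x\<close> were 0, it would specialize both to zero and to the
    identity, which differ for \<open>0 < d\<close>. As \<open>inverse 0\<close> is 0 and lies in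
    \<open>R\<close>, this inequality is what makes \<open>1 + x\<close> a unit.\<close>
  have "1 + x \<noteq> 0" using s spec_unique[OF spec_zero] id_neq_zero[OF d] by metis
  then show ?thesis using spec_ringI[OF spec_inverse_of_id[OF s]] by blast
qed

text \<open>An element \<open>x\<close> of the ideal lies in every maximal ideal \<open>M\<close>: otherwise \<open>1 = m + r x\<close> with
  \<open>m \<in> M\<close>, and \<open>m = 1 - r x\<close> is a unit.\<close>

lemma spec_ideal_le_jacobson:
  assumes d: "0 < d"
  shows "spec_ideal C B \<sigma> \<subseteq> jacobson_radical R_ring"
proof
  interpret R: cring R_ring by (rule R_cring)
  interpret I: ideal "spec_ideal C B \<sigma>" R_ring by (rule spec_ideal_ideal)
  fix x assume x: "x \<in> spec_ideal C B \<sigma>"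
  then have xR: "x \<in> carrier R_ring" using I.a_subset by blast
  have "x \<in> M" if "maximalideal M R_ring" for M
  proof (rule ccontr)
    assume xM: "x \<notin> M"
    interpret M: maximalideal M R_ring by fact
    let ?J = "M <+>\<^bsub>R_ring\<^esub> PIdl\<^bsub>R_ring\<^esub> x"
    have P: "ideal (PIdl\<^bsub>R_ring\<^esub> x) R_ring" using R.cgenideal_ideal[OF xR] .
    have J: "ideal ?J R_ring" using R.add_ideals[OF M.is_ideal P] .
    have zM: "0 \<in> M" using M.zero_closed by (simp add: class_ring_simps)
    have zP: "0 \<in> PIdl\<^bsub>R_ring\<^esub> x"
      using additive_subgroup.zero_closed[OF ideal.axioms(1)[OF P]] by (simp add: class_ring_simps)
    \<comment> \<open>\<open>R_ring\<close> changes only the carrier of \<open>class_ring\<close>,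
      so sums of ideals are formed with the ordinary addition of the field.\<close>
    have mem: "y \<in> ?J \<longleftrightarrow> (\<exists>m\<in>M. \<exists>p\<in>PIdl\<^bsub>R_ring\<^esub> x. y = m + p)" for y
      by (auto simp: set_add_def set_mult_def class_ring_simps)
    have "M \<subseteq> ?J" using zP mem by force
    moreover have "x \<in> ?J" using zM mem R.cgenideal_self[OF xR] by force
    ultimately have "?J = carrier R_ring"
      using M.I_maximal[OF J] xM ideal.Icarr[OF J] by blast
    then have "1 \<in> ?J" using R.one_closed by (simp add: class_ring_simps)
    then obtain m p where m: "m \<in> M" and p: "p \<in> PIdl\<^bsub>R_ring\<^esub> x" and mp: "1 = m + p"
      using mem by blast
    obtain c where c: "c \<in> R" "p = c * x"
      using p by (auto simp: cgenideal_def class_ring_simps)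
    have "- c \<in> R" using R_subring c(1) subringE(5)[OF R_subring c(1)] by (simp add: class_ring_simps)
    then have "- c * x \<in> spec_ideal C B \<sigma>"
      using I.I_l_closed[OF x, of "- c"] by (simp add: class_ring_simps)
    then have inv: "inverse (1 + - c * x) \<in> R" "1 + - c * x \<noteq> 0"
      using one_plus_ideal_unit[OF d] by blast+
    have m1: "m = 1 + - c * x" using mp c(2) by (simp add: algebra_simps)
    have "inverse (1 + - c * x) * m \<in> M"
      using M.I_l_closed[OF m, of "inverse (1 + - c * x)"] inv(1) by (simp add: class_ring_simps)
    then have "1 \<in> M" using m1 inv(2) by simp
    then have "M = carrier R_ring"
      using M.one_imp_carrier by (simp add: class_ring_simps)
    then show False using M.I_notcarr by simp
  qed
  then show "x \<in> jacobson_radical R_ring" using xR by (simp add: jacobson_radical_def)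
qed

end

theorem proposition5p7:
  fixes K0 :: "'a::field set"
    and C :: "('a, 'o, 'm) linear_cat"
    and B :: 'o
    and d :: nat
    and \<sigma> :: "nat \<Rightarrow> 'a vec set \<Rightarrow> ('o \<times> 'm) set"
  assumes "subfield K0 (class_ring :: 'a ring)"
    and "infinite K0"
    and "abelian_linear_category ((class_ring :: 'a ring)\<lparr>carrier := K0\<rparr>) C"
    and "B \<in> Obj C"
    and "semisimple_of_length C B d"
    and "inflator K0 C B d \<sigma>"
  shows "
      (subring (spec_ring C B \<sigma>) (class_ring :: 'a ring)
        \<and> subalgebra K0 (spec_ring C B \<sigma>) (class_ring :: 'a ring))
    \<and> (res_hat C B \<sigma> \<in>
          Ring.ring_hom ((class_ring :: 'a ring)\<lparr>carrier := spec_ring C B \<sigma>\<rparr>) (End_alg C B)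
        \<and> (\<forall>a\<in>K0. \<forall>x\<in>spec_ring C B \<sigma>.
              res_hat C B \<sigma> (a * x) = a \<odot>\<^bsub>End_alg C B\<^esub> res_hat C B \<sigma> x))
    \<and> (spec_ideal C B \<sigma> =
          a_kernel ((class_ring :: 'a ring)\<lparr>carrier := spec_ring C B \<sigma>\<rparr>) (End_alg C B) (res_hat C B \<sigma>)
        \<and> ideal (spec_ideal C B \<sigma>) ((class_ring :: 'a ring)\<lparr>carrier := spec_ring C B \<sigma>\<rparr>))
    \<and> (0 < d \<longrightarrow> spec_ideal C B \<sigma> \<subseteq>
          jacobson_radical ((class_ring :: 'a ring)\<lparr>carrier := spec_ring C B \<sigma>\<rparr>))"
proof -
  interpret field_inflator K0 C B d \<sigma>
    by (intro field_inflator.intro field_inflator_axioms.intro) fact+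
  \<comment> \<open>Beyond the additive subgroup already contained in \<open>subring\<close>, a
    subalgebra asks for closure under multiplication by \<open>K0\<close>.\<close>
  have "subalgebra K0 (spec_ring C B \<sigma>) (class_ring :: 'a ring)"
    using subring.axioms(1)[OF R_subring] res_scalar
    by (auto simp: subalgebra_def subalgebra_axioms_def class_ring_simps)
  moreover have "res_hat C B \<sigma> (a * x) = a \<odot>\<^bsub>End_alg C B\<^esub> res_hat C B \<sigma> x"
    if "a \<in> K0" "x \<in> spec_ring C B \<sigma>" for a x
    using res_scalar[OF that] by (simp add: End_alg_def)
  ultimately show ?thesis
    using R_subring res_hom spec_ideal_eq_kernel spec_ideal_ideal spec_ideal_le_jacobson by blast
qed

end
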